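(* For every integer $g \geq 0$, the radius of convergence of the formal power series \[ \vec{\mathbf{F}}_g(z) = \sum_{d=1}^{\infty} \Big( \sum_{\alpha,\beta \vdash d} \vec{H}_g(\alpha,\beta) \Big) \frac{z^d}{d!} \] is at least $1/54$ and at most $2/27$.
   Context: For $d \geq 1$, the symmetric group $S(d)$ is viewed as its right Cayley graph with respect to all transpositions. Each transposition is written $(s\ t)$ with $s<t$, and $t$ is called its colour. An $r$-step walk from $\rho \in S(d)$ is a sequence of transpositions $((s_1\ t_1),\dots,(s_r\ t_r))$, $s_i<t_i$; it ends at $\sigma = \rho (s_1\ t_1)\cdots(s_r\ t_r)$. The walk is monotone if $t_1 \leq t_2 \leq \dots \leq t_r$. It is transitive if the subgroup of $S(d)$ generated by $\rho$, $\sigma$ and the transpositions $(s_i\ t_i)$ acts transitively on $\{1,\dots,d\}$. For partitions $\alpha,\beta$ of $d$, with $\ell(\cdot)$ denoting the number of parts, and for an integer $g \geq 0$, put $r_g(\alpha,\beta) = 2g-2+\ell(\alpha)+\ell(\beta)$. The monotone double Hurwitz number $\vec{H}_g(\alpha,\beta)$ is the number of pairs consisting of a starting permutation $\rho$ of cycle type $\alpha$ and a monotone transitive $r_g(\alpha,\beta)$-step walk from $\rho$ whose endpoint has cycle type $\beta$. *)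

theory Defs
  imports "HOL-Analysis.Analysis" "HOL-Algebra.Sym_Groups" "HOL-Combinatorics.Orbits"
begin

text \<open>Permutations of {1..d} are functions nat => nat permuting {1..d} (carrier of sym_group d).
  A transposition (s t), s < t, is encoded as the pair (s,t); t is its colour.
  Products are read left to right as in the right Cayley graph: rho (s1 t1) ... (sr tr)
  is the function composition rho o transpose s1 t1 o ... o transpose sr tr.\<close>

definition cycle_type :: "nat \<Rightarrow> (nat \<Rightarrow> nat) \<Rightarrow> nat multiset" where
  "cycle_type d p = image_mset card (mset_set ((\<lambda>x. Orbits.orbit p x) ` {1..d}))"

definition partitions_of :: "nat \<Rightarrow> nat multiset set" where
  "partitions_of d = {\<alpha>. (\<forall>k\<in>#\<alpha>. 0 < k) \<and> sum_mset \<alpha> = d}"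

definition is_walk :: "nat \<Rightarrow> (nat \<times> nat) list \<Rightarrow> bool" where
  "is_walk d w \<longleftrightarrow> (\<forall>(s,t)\<in>set w. 1 \<le> s \<and> s < t \<and> t \<le> d)"

definition walk_end :: "(nat \<Rightarrow> nat) \<Rightarrow> (nat \<times> nat) list \<Rightarrow> (nat \<Rightarrow> nat)" where
  "walk_end \<rho> w = foldl (\<lambda>p (s,t). p \<circ> Transposition.transpose s t) \<rho> w"

definition monotone_walk :: "(nat \<times> nat) list \<Rightarrow> bool" where
  "monotone_walk w \<longleftrightarrow> sorted (map snd w)"

definition transitive_walk :: "nat \<Rightarrow> (nat \<Rightarrow> nat) \<Rightarrow> (nat \<times> nat) list \<Rightarrow> bool" where
  "transitive_walk d \<rho> w \<longleftrightarrow>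
     (\<forall>x\<in>{1..d}. \<forall>y\<in>{1..d}. \<exists>p\<in>generate (sym_group d)
        ({\<rho>, walk_end \<rho> w} \<union> (\<lambda>(s,t). Transposition.transpose s t) ` set w). p x = y)"

definition monotone_hurwitz :: "nat \<Rightarrow> nat multiset \<Rightarrow> nat multiset \<Rightarrow> nat" where
  "monotone_hurwitz g \<alpha> \<beta> = (let d = sum_mset \<alpha> in
     card {(\<rho>, w). \<rho> permutes {1..d} \<and> cycle_type d \<rho> = \<alpha> \<and>
        int (length w) = 2 * int g - 2 + int (size \<alpha>) + int (size \<beta>) \<and>
        is_walk d w \<and> monotone_walk w \<and> transitive_walk d \<rho> w \<and>
        cycle_type d (walk_end \<rho> w) = \<beta>})"

definition F_coeff :: "nat \<Rightarrow> nat \<Rightarrow> real" where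
  "F_coeff g d = (if d = 0 then 0 else
     real (\<Sum>\<alpha>\<in>partitions_of d. \<Sum>\<beta>\<in>partitions_of d. monotone_hurwitz g \<alpha> \<beta>) / fact d)"

end

theory Submission
  imports Defs
begin

text \<open>
  Monotone walks are words in Jucys--Murphy elements, counted by complete homogeneous symmetric
  polynomials in these commuting elements. A permutation with \<open>l\<close> cycles on \<open>d\<close> points has a strictly
  monotone factorisation of length \<open>d - l\<close>; completing a walk by such factorisations of its endpoints and
  sorting the colours costs a factor of at most 4 per colour and leaves a transitive monotone walk of
  length \<open>2 g - 2 + 2 d\<close> from the identity to itself. It thus suffices that these closed walks have growth
  rate 27/2, and for the lower bound that they do so in genus 0, as inserting a transposition twice
  raises the genus.

  By symmetry every point may play the role of the largest colour. Removing the last step of a walk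
  gives a cut-and-join recursion, in which one follows finitely many marked cycles and sums over the
  number \<open>m\<close> of unmarked fixed points with weight \<open>y ^ m / m!\<close>. In genus 0 with one marked cycle this is
  the equation \<open>A = x + (y/x) (A - x A\<^sub>1) + A\<^sup>2\<close>, solved explicitly for \<open>y = u (1 - 2 u)\<^sup>2\<close> and critical at
  \<open>u = 1/6\<close>, that is at \<open>y = 2/27\<close>. For smaller \<open>u\<close> the linearised equation is a contraction in a weighted
  supremum norm: this bounds all genera inductively and shows that the explicit solution is the
  generating function in genus 0, which is not smooth at \<open>y = 2/27\<close>.
\<close>

section \<open>Words in Jucys--Murphy elements\<close>

text \<open>The recursion cannot be run by cycle length: swallowing a fixed point leads from cycles
  of length \<open>k\<close> to length \<open>k + 1\<close>. Counted with at most \<open>N\<close>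
  unmarked points it becomes well-founded, since the swallowed point leaves the background; hence
  truncated sums and inequalities come before any power series. In the limit the quadratic equation
  still contains the unknown \<open>A\<^sub>1\<close>, and the quadratic method finds it:
  \<open>A\<^sub>1\<close> is chosen so that the discriminant has a double root. With
  \<open>y = u (1 - 2 u)\<^sup>2\<close> this double root is \<open>x = u (1 - 2 u)\<close>, while
  the remaining root, the branch point of \<open>A\<close>, is
  \<open>x = (1 - 2 u)\<^sup>2 / 4\<close>. They collide exactly for \<open>u = 1/6\<close>, which
  is where 2/27 comes from. For smaller \<open>u\<close> there is a gap between them, and there the
  derivative \<open>y / x + 2 A\<close> of the right-hand side with respect to \<open>A\<close> is
  below 1. Every contraction takes its weight from this gap. In higher genus the part of the
  recursion that involves the genus itself is again this derivative.\<close>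

abbreviation tr :: "nat \<Rightarrow> nat \<Rightarrow> nat \<Rightarrow> nat" where "tr \<equiv> Transposition.transpose"
abbreviation orb :: "(nat \<Rightarrow> nat) \<Rightarrow> nat \<Rightarrow> nat set" where "orb \<equiv> Orbits.orbit"

text \<open>A state consists of the permutation reached by a walk and of the equivalence relation whose
  classes are the points joined by the transpositions used so far (an initial relation included).\<close>

type_synonym state = "(nat \<Rightarrow> nat) \<times> (nat \<times> nat) set"

text \<open>A closure of edges rather than an explicit union of classes: iterated links are then
  closures of the set of all edges, so that their order does not matter.\<close>

definition link :: "(nat \<times> nat) set \<Rightarrow> nat \<Rightarrow> nat \<Rightarrow> (nat \<times> nat) set" where
  "link e a b = (e \<union> {(a, b), (b, a)})\<^sup>*"

definition step :: "state \<Rightarrow> nat \<Rightarrow> nat \<Rightarrow> state" where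
  "step s a x = (fst s \<circ> tr a x, link (snd s) a x)"

text \<open>Multiplication by the Jucys--Murphy element of colour \<open>x\<close>, if \<open>A\<close> is the set of smaller points.\<close>

definition jm :: "nat \<Rightarrow> nat set \<Rightarrow> (state \<Rightarrow> nat) \<Rightarrow> state \<Rightarrow> nat" where
  "jm x A f s = (\<Sum>a\<in>A. f (step s a x))"

text \<open>Complete homogeneous symmetric polynomials in the Jucys--Murphy elements; lists have the largest
  colour first, so that a word lists its colours in nonincreasing order.\<close>

fun hsym :: "nat list \<Rightarrow> nat \<Rightarrow> (state \<Rightarrow> nat) \<Rightarrow> state \<Rightarrow> nat" where
  "hsym [] 0 f = f"
| "hsym [] (Suc r) f = (\<lambda>s. 0)"
| "hsym (x # xs) 0 f = f"
| "hsym (x # xs) (Suc r) f = (\<lambda>s. hsym xs (Suc r) f s + jm x (set xs) (hsym (x # xs) r f) s)"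

lemma hsym_0 [simp]: "hsym xs 0 f = f"
  by (cases xs) auto

section \<open>Commutation relations between steps\<close>

lemma link_sym: "link e a b = link e b a"
  by (simp add: link_def insert_commute)

lemma link_link: "link (link e a b) c d = (e \<union> {(a, b), (b, a)} \<union> {(c, d), (d, c)})\<^sup>*"
  unfolding link_def
  by (metis rtrancl_Un_rtrancl rtrancl_idemp)

lemma rtrancl_eq_subI: "R \<subseteq> S\<^sup>* \<Longrightarrow> S \<subseteq> R\<^sup>* \<Longrightarrow> R\<^sup>* = S\<^sup>*"
  by (metis rtrancl_subset_rtrancl subset_antisym)

lemma link_commute: "link (link e a b) c d = link (link e c d) a b"
  unfolding link_link by (simp add: Un_ac)

lemma link_triangle: "link (link e a b) b c = link (link e a b) a c"
proof -
  have 1: "(b, c) \<in> {(a, b), (b, a), (a, c), (c, a)}\<^sup>*" "(c, b) \<in> {(a, b), (b, a), (a, c), (c, a)}\<^sup>*"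
    "(a, c) \<in> {(a, b), (b, a), (b, c), (c, b)}\<^sup>*" "(c, a) \<in> {(a, b), (b, a), (b, c), (c, b)}\<^sup>*"
    by (meson converse_rtrancl_into_rtrancl insertI1 insertI2 r_into_rtrancl)+
  have m: "\<And>R S p. p \<in> R\<^sup>* \<Longrightarrow> R \<subseteq> S \<Longrightarrow> p \<in> S\<^sup>*"
    using rtrancl_mono by blast
  show ?thesis
    unfolding link_link
    by (rule rtrancl_eq_subI; auto intro!: m[OF 1(1)] m[OF 1(2)] m[OF 1(3)] m[OF 1(4)])
qed

lemma transpose_conj:
  "tr b u \<circ> tr (tr b u a) x
   = tr a x \<circ> tr b u" if "x \<noteq> b" "x \<noteq> u"
  using that by (auto simp: fun_eq_iff Transposition.transpose_def)

text \<open>Conjugation by \<open>(b u)\<close> may move the end \<open>a\<close> of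
  \<open>(a x)\<close>. The classes do not notice this, because \<open>a\<close> and its image are
  joined by the step \<open>(b u)\<close> anyway.\<close>

lemma step_commute:
  assumes "x \<noteq> b" "x \<noteq> u"
  shows "step (step s b u) (tr b u a) x = step (step s a x) b u"
proof -
  have "link (link e b u) (tr b u a) x = link (link e a x) b u" for e
    using link_triangle[of e b u x] link_commute[of e b u] 
    by (auto simp: Transposition.transpose_def)
  then show ?thesis
    using transpose_conj[OF assms, of a]
    by (auto simp: step_def comp_assoc)
qed

lemma step_sym: "step s a b = step s b a"
  by (simp add: step_def transpose_commute link_sym)

text \<open>The transpositions summed in \<open>jm x A\<close> are permuted among themselves under
  conjugation by a transposition of points of \<open>A\<close>.\<close>

lemma jm_commute:
  assumes "x \<notin> A" "u \<in> A" "B \<subseteq> A"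
  shows "jm x A (jm u B f) = jm u B (jm x A f)"
proof
  fix s
  have "jm u B (jm x A f) s = (\<Sum>b\<in>B. \<Sum>a\<in>A. f (step (step s b u) a x))"
    by (simp add: jm_def)
  also have "\<dots> = (\<Sum>b\<in>B. \<Sum>a\<in>A. f (step (step s b u) (tr b u a) x))"
  proof (rule sum.cong[OF refl])
    fix b assume "b \<in> B"
    then have "bij_betw (tr b u) A A"
      using assms by (intro permutes_imp_bij permutes_swap_id) auto
    then show "(\<Sum>a\<in>A. f (step (step s b u) a x)) = 
      (\<Sum>a\<in>A. f (step (step s b u) (tr b u a) x))"
      by (rule sum.reindex_bij_betw[symmetric])
  qed
  also have "\<dots> = (\<Sum>b\<in>B. \<Sum>a\<in>A. f (step (step s a x) b u))"
    using assms by (intro sum.cong refl arg_cong[where f=f] step_commute) auto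
  also have "\<dots> = jm x A (jm u B f) s"
    by (simp add: jm_def sum.swap[of _ A])
  finally show "jm x A (jm u B f) s = jm u B (jm x A f) s" ..
qed

lemma jm_plus: "jm x A (\<lambda>s. f s + g s) = (\<lambda>s. jm x A f s + jm x A g s)"
  by (simp add: jm_def sum.distrib fun_eq_iff)

lemma jm_insert:
  assumes "finite A" "b \<notin> A"
  shows "jm x (insert b A) f s = jm x {b} f s + jm x A f s"
  using assms by (simp add: jm_def)

lemma jm_zero [simp]: "jm x A (\<lambda>s. 0) = (\<lambda>s. 0)"
  by (simp add: jm_def fun_eq_iff)

lemma jm_sum: "jm x A (\<lambda>s. \<Sum>i\<in>I. f i s) = (\<lambda>s. \<Sum>i\<in>I. jm x A (f i) s)"
  by (auto simp add: jm_def fun_eq_iff intro: sum.swap)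

lemma jm_mono: "(\<And>s. f s \<le> g s) \<Longrightarrow> jm x A f s \<le> jm x A g s"
  by (simp add: jm_def sum_mono)

lemma jm_cmult: "jm x A (\<lambda>s. c * f s) = (\<lambda>s. c * jm x A f s)"
  by (simp add: jm_def sum_distrib_left fun_eq_iff)

lemma hsym_sum: "hsym xs r (\<lambda>s. \<Sum>i\<in>I. f i s) = (\<lambda>s. \<Sum>i\<in>I. hsym xs r (f i) s)"
  by (induct xs r "\<lambda>s. \<Sum>i\<in>I. f i s" rule: hsym.induct) (auto simp: jm_sum sum.distrib)

lemma hsym_plus: "hsym xs r (\<lambda>s. f s + g s) = (\<lambda>s. hsym xs r f s + hsym xs r g s)"
  by (induct xs r "\<lambda>s. f s + g s" rule: hsym.induct) (auto simp: jm_plus)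

lemma jm_hsym_commute:
  assumes "x \<notin> A" "distinct xs" "set xs \<subseteq> A"
  shows "jm x A (hsym xs r f) = hsym xs r (jm x A f)"
  using assms
proof (induct xs r f rule: hsym.induct)
  case (4 y xs r f)
  then have "jm x A (jm y (set xs) (hsym (y # xs) r f)) = jm y (set xs) (jm x A (hsym (y # xs) r f))"
    by (intro jm_commute) auto
  with 4 show ?case
    by (simp add: jm_plus)
qed auto

text \<open>With \<open>A\<close>, \<open>B\<close> the operators of the two largest colours this is
  \<open>(1 - z B) (1 - z A) X = h\<close>; the product \<open>B A\<close> turns out to be symmetric in the two colours
  (\<open>jm_braid\<close>), which makes the whole construction independent of the order of the points.\<close>

lemma hsym_rec2:
  "hsym (a # b # xs) (Suc (Suc r)) f s + jm b (set xs) (jm a (insert b (set xs)) (hsym (a # b # xs) r f)) s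
   = hsym xs (Suc (Suc r)) f s + jm b (set xs) (hsym (a # b # xs) (Suc r) f) s
     + jm a (insert b (set xs)) (hsym (a # b # xs) (Suc r) f) s"
proof -
  have "jm b (set xs) (hsym (a # b # xs) (Suc r) f) s 
    = jm b (set xs) (hsym (b # xs) (Suc r) f) s + jm b (set xs) (jm a (insert b (set xs)) (hsym (a # b # xs) r f)) s"
    unfolding hsym.simps(4)[of a] jm_plus by simp
  then show ?thesis
    unfolding hsym.simps(4)[of a "b # xs" "Suc r"] hsym.simps(4)[of b xs "Suc r"] by simp
qed

section \<open>Independence of the order of the colours\<close>

lemma jm_singleton_sym: "jm a {b} g s = jm b {a} g s"
  by (simp add: jm_def step_sym[of s a b])

text \<open>A 3-cycle is a product of two transpositions in three ways. The identity is chosen to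
  exchange the roles of \<open>a\<close> and \<open>b\<close> in words where the larger of them
  picks the smaller one as its partner.\<close>

lemma step_triangle:
  assumes "c \<noteq> a" "c \<noteq> b"
  shows "step (step s b a) c b = step (step s c a) a b"
proof -
  have "step (step s b a) (tr b a a) c = step (step s a c) b a"
    using assms by (intro step_commute) auto
  moreover have "step (step s b a) c b = step (step s b a) b c" "step (step s c a) a b = step (step s a c) b a"
    by (rule step_sym, metis step_sym)
  ultimately show ?thesis by simp
qed

text \<open>Once the operators are commuted, the words on the left split by whether the step of
  colour \<open>a\<close> picks \<open>b\<close>. Those that do correspond by
  \<open>step_triangle\<close> to words in which \<open>b\<close> picks \<open>a\<close>; the others
  are the same words on both sides.\<close>

lemma jm_braid:
  assumes "a \<noteq> b" "a \<notin> S" "b \<notin> S" "finite S"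
  shows "jm b S (jm a (insert b S) g) s = jm a S (jm b (insert a S) g) s"
proof -
  have "jm b S (jm a (insert b S) g) s = jm a (insert b S) (jm b S g) s"
    using assms by (subst jm_commute) auto
  also have "\<dots> = jm a {b} (jm b S g) s + jm a S (jm b S g) s"
    by (rule jm_insert[OF assms(4,3)])
  also have "jm a {b} (jm b S g) s = jm a S (jm b {a} g) s"
  proof -
    have "g (step (step s b a) c b) = g (step (step s c a) a b)" if "c \<in> S" for c
      using that assms by (intro arg_cong[where f=g] step_triangle) auto
    then show ?thesis
      by (simp add: jm_def)
  qed
  also have "jm a S (jm b {a} g) s + jm a S (jm b S g) s = jm a S (jm b (insert a S) g) s"
    using assms by (simp add: jm_def sum.distrib)
  finally show ?thesis .
qed

text \<open>\<open>hsym_rec2\<close> gives level \<open>r + 2\<close> from the levels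
  \<open>r\<close> and \<open>r + 1\<close>. Its coefficients are symmetric in the two colours: the
  product by \<open>jm_braid\<close>, the sum because \<open>(a b)\<close> belongs to both
  Jucys--Murphy elements, depending on which of the two is the larger colour.\<close>

lemma hsym_swap:
  assumes "distinct (a # b # xs)"
  shows "hsym (a # b # xs) r f = hsym (b # a # xs) r f"
proof (induct r rule: induct_nat_012)
  case 1
  show ?case
    using assms jm_singleton_sym[of a b f]
      jm_insert[of "set xs" b a f] jm_insert[of "set xs" a b f] by (simp add: fun_eq_iff)
next
  case (ge2 r)
  let ?X = "hsym (a # b # xs)" and ?Y = "hsym (b # a # xs)" and ?S = "set xs"
  show ?case
  proof
    fix t
    have ins: "jm a (insert b ?S) g t = jm a {b} g t + jm a ?S g t" "jm b (insert a ?S) g t = jm b {a} g t + jm b ?S g t" for g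
      using assms by (auto intro!: jm_insert)
    note hsym_rec2[of a b xs r f t, unfolded ins(1)[of "?X (Suc r) f"]]
    moreover note hsym_rec2[of b a xs r f t, unfolded ins(2)[of "?Y (Suc r) f"]]
    moreover have "jm b ?S (jm a (insert b ?S) (?X r f)) t = jm a ?S (jm b (insert a ?S) (?Y r f)) t"
      unfolding ge2(1) using assms by (intro jm_braid) auto
    ultimately show "?X (Suc (Suc r)) f t = ?Y (Suc (Suc r)) f t"
      unfolding ge2(2) jm_singleton_sym[of a b] by linarith
  qed
qed simp

lemma hsym_move_front:
  "distinct xs \<Longrightarrow> x \<in> set xs \<Longrightarrow> hsym xs r f = hsym (x # remove1 x xs) r f"
proof (induct xs arbitrary: r f)
  case (Cons y xs)
  show ?case
  proof (cases "x = y")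
    case False
    then have x: "x \<in> set xs" using Cons by auto
    then have eq: "hsym xs = hsym (x # remove1 x xs)"
      using Cons.hyps[OF _ x] Cons.prems(1) by (auto simp: fun_eq_iff)
    have set: "set xs = set (x # remove1 x xs)"
      using x Cons.prems by auto
    have "hsym (y # xs) r f = hsym (y # x # remove1 x xs) r f"
    proof (induct r)
      case (Suc r)
      then show ?case
        unfolding hsym.simps eq set by simp
    qed simp
    also have "\<dots> = hsym (x # y # remove1 x xs) r f"
      using Cons.prems x False by (intro hsym_swap) auto
    finally show ?thesis using False by simp
  qed simp
qed simp

lemma hsym_perm:
  "distinct xs \<Longrightarrow> distinct ys \<Longrightarrow> set xs = set ys \<Longrightarrow> hsym xs r f = hsym ys r f"
proof (induct xs arbitrary: ys r)
  case (Cons x xs)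
  then have x: "x \<in> set ys" by auto
  have s: "set xs = set (remove1 x ys)"
    using Cons.prems by auto
  have eq: "hsym xs r f = hsym (remove1 x ys) r f" for r
    using Cons.prems s by (intro Cons.hyps) auto
  have "hsym (x # xs) r f = hsym (x # remove1 x ys) r f"
  proof (induct r)
    case (Suc r)
    then show ?case
      unfolding hsym.simps eq s by simp
  qed simp
  then show ?case
    using hsym_move_front[OF Cons.prems(2) x] by simp
qed simp

definition hsym_set :: "nat set \<Rightarrow> nat \<Rightarrow> (state \<Rightarrow> nat) \<Rightarrow> state \<Rightarrow> nat" where
  "hsym_set S = hsym (sorted_list_of_set S)"

lemma hsym_set_eq_hsym: "distinct xs \<Longrightarrow> hsym_set (set xs) r f = hsym xs r f"
  unfolding hsym_set_def by (intro hsym_perm) auto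

lemma hsym_set_0 [simp]: "hsym_set S 0 f = f"
  by (simp add: hsym_set_def)

lemma hsym_set_empty [simp]: "hsym_set {} (Suc r) f = (\<lambda>s. 0)"
  by (simp add: hsym_set_def)

lemma hsym_set_Suc:
  assumes "finite S" "d \<in> S"
  shows "hsym_set S (Suc r) f s = hsym_set (S - {d}) (Suc r) f s + (\<Sum>a\<in>S - {d}. hsym_set S r f (step s a d))"
proof -
  let ?xs = "d # sorted_list_of_set (S - {d})"
  have S: "S = set ?xs" using assms by auto
  have "hsym_set S r f = hsym ?xs r f" for r
    by (subst S, rule hsym_set_eq_hsym) (use assms in auto)
  then show ?thesis
    using assms by (simp add: hsym_set_def jm_def)
qed

section \<open>Transitive walks and the cut-and-join recursion\<close>

text \<open>A bisimulation principle. It is specialised in three ways: to relabelling the points by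
  \<open>\<tau>\<close>, to replacing the final test along an invariant of the walk, and to showing
  that a sum vanishes.\<close>

lemma hsym_sim:
  assumes R: "\<And>s s' a b. R s s' \<Longrightarrow> a \<in> S \<Longrightarrow> b \<in> S \<Longrightarrow> a \<noteq> b \<Longrightarrow> R (step s a b) (step s' (\<tau> a) (\<tau> b))"
    and fg: "\<And>s s'. R s s' \<Longrightarrow> f s = g s'"
    and inj: "inj_on \<tau> S"
  shows "R s s' \<Longrightarrow> set xs \<subseteq> S \<Longrightarrow> distinct xs \<Longrightarrow> hsym xs r f s = hsym (map \<tau> xs) r g s'"
proof (induct xs arbitrary: s s' r)
  case Nil
  then show ?case by (cases r) (auto simp: fg)
next
  case (Cons x xs)
  show ?case
    using Cons.prems(1)
  proof (induct r arbitrary: s s')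
    case 0
    then show ?case by (simp add: fg)
  next
    case (Suc r)
    have sub: "set xs \<subseteq> S" "x \<in> S" "x \<notin> set xs" using Cons.prems by auto
    have "(\<Sum>a\<in>set xs. hsym (x # xs) r f (step s a x)) = (\<Sum>a\<in>set xs. hsym (map \<tau> (x # xs)) r g (step s' (\<tau> a) (\<tau> x)))"
      using sub by (intro sum.cong refl Suc.hyps R Suc.prems) auto
    also have "\<dots> = (\<Sum>a\<in>set (map \<tau> xs). hsym (map \<tau> (x # xs)) r g (step s' a (\<tau> x)))"
      using inj_on_subset[OF inj sub(1)] by (simp add: sum.reindex)
    finally show ?case
      using Cons.hyps[OF Suc.prems, of "Suc r"] Cons.prems by (simp add: jm_def)
  qed
qed

lemma hsym_set_sim:
  assumes R: "\<And>s s' a b. R s s' \<Longrightarrow> a \<in> S \<Longrightarrow> b \<in> S \<Longrightarrow> a \<noteq> b \<Longrightarrow> R (step s a b) (step s' (\<tau> a) (\<tau> b))"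
    and fg: "\<And>s s'. R s s' \<Longrightarrow> f s = g s'"
    and inj: "inj_on \<tau> S" and "finite S" "R s s'"
  shows "hsym_set S r f s = hsym_set (\<tau> ` S) r g s'"
proof -
  have "hsym_set S r f s = hsym (map \<tau> (sorted_list_of_set S)) r g s'"
    unfolding hsym_set_def by (rule hsym_sim[where R = R and S = S]) (use assms in auto)
  also have "\<dots> = hsym_set (\<tau> ` S) r g s'"
    using hsym_set_eq_hsym[of "map \<tau> (sorted_list_of_set S)"] inj \<open>finite S\<close>
    by (simp add: distinct_map)
  finally show ?thesis .
qed

lemma hsym_set_cong_rel:
  assumes "\<And>s s' a b. R s s' \<Longrightarrow> a \<in> S \<Longrightarrow> b \<in> S \<Longrightarrow> a \<noteq> b \<Longrightarrow> R (step s a b) (step s' a b)"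
    and "\<And>s s'. R s s' \<Longrightarrow> f s = g s'"
    and "finite S" "R s s'"
  shows "hsym_set S r f s = hsym_set S r g s'"
  using hsym_set_sim[of R S "\<lambda>x. x" f g s s' r] assms by simp

lemma hsym_set_zero [simp]: "hsym_set S r (\<lambda>s. 0) s = 0"
proof -
  have "hsym xs r (\<lambda>s. 0) = (\<lambda>s. 0)" for xs
    by (induct xs r "\<lambda>s::state. 0::nat" rule: hsym.induct) auto
  then show ?thesis by (simp add: hsym_set_def)
qed

lemma hsym_set_eq_0:
  assumes "\<And>s a b. P s \<Longrightarrow> a \<in> S \<Longrightarrow> b \<in> S \<Longrightarrow> a \<noteq> b \<Longrightarrow> P (step s a b)"
    and "\<And>s. P s \<Longrightarrow> f s = 0" and "finite S" "P s"
  shows "hsym_set S r f s = 0"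
  using hsym_set_cong_rel[of "\<lambda>s s'. s = s' \<and> P s" S f "\<lambda>s. 0" s s r] assms by simp

definition conn :: "nat set \<Rightarrow> (nat \<times> nat) set \<Rightarrow> bool" where
  "conn S e \<longleftrightarrow> (\<forall>x\<in>S. \<forall>y\<in>S. (x, y) \<in> e)"

text \<open>Only the restriction of the permutation to \<open>S\<close> matters, so that \<open>nwalks S1\<close> and \<open>nwalks S2\<close> can be
  evaluated at one permutation that preserves both sets.\<close>

definition at_id :: "nat set \<Rightarrow> ((nat \<times> nat) set \<Rightarrow> bool) \<Rightarrow> state \<Rightarrow> nat" where
  "at_id S Q s = of_bool ((\<forall>x\<in>S. fst s x = x) \<and> Q (snd s))"

text \<open>The relation starts at \<open>Id\<close>: a walk from \<open>\<sigma>\<close> to the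
  identity on \<open>S\<close> writes \<open>\<sigma>\<close> on \<open>S\<close> as a product of
  its own transpositions, so the cycles of \<open>\<sigma>\<close> lie inside the classes at the
  end.\<close>

definition nwalks :: "nat set \<Rightarrow> nat \<Rightarrow> (nat \<Rightarrow> nat) \<Rightarrow> nat" where
  "nwalks S r \<sigma> = hsym_set S r (at_id S (conn S)) (\<sigma>, Id)"

section \<open>Equivalence relations and connectedness\<close>

definition eqv :: "(nat \<times> nat) set \<Rightarrow> bool" where
  "eqv e \<longleftrightarrow> equiv UNIV e"

lemma eqv_Id [simp]: "eqv Id"
  by (auto simp: eqv_def equiv_def refl_on_def sym_def trans_def)

lemma eqv_refl: "eqv e \<Longrightarrow> (x, x) \<in> e"
  by (auto simp: eqv_def equiv_def refl_on_def)

lemma eqv_sym: "eqv e \<Longrightarrow> (x, y) \<in> e \<Longrightarrow> (y, x) \<in> e"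
  by (auto simp: eqv_def equiv_def sym_def)

lemma eqv_trans: "eqv e \<Longrightarrow> (x, y) \<in> e \<Longrightarrow> (y, z) \<in> e \<Longrightarrow> (x, z) \<in> e"
  unfolding eqv_def equiv_def trans_def by blast

lemma eqv_link: 
  assumes "eqv e" shows "eqv (link e a b)"
proof -
  have "sym (e \<union> {(a, b), (b, a)})"
    using assms by (auto simp: eqv_def equiv_def sym_def)
  then show ?thesis
    unfolding eqv_def link_def equiv_def
    by (simp add: sym_rtrancl trans_rtrancl refl_rtrancl)
qed

lemma in_link_iff:
  assumes "eqv e"
  shows "(x, y) \<in> link e a b \<longleftrightarrow> (x, y) \<in> e \<or> (x, a) \<in> e \<and> (b, y) \<in> e \<or> (x, b) \<in> e \<and> (a, y) \<in> e"
    (is "_ \<longleftrightarrow> ?R y")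
proof
  assume "(x, y) \<in> link e a b"
  then show "?R y"
    unfolding link_def
  proof (induct rule: rtrancl_induct)
    case base
    then show ?case using eqv_refl[OF assms] by simp
  next
    case (step y z)
    then show ?case
      using eqv_refl[OF assms] eqv_sym[OF assms] eqv_trans[OF assms] by blast
  qed
next
  have 1: "e \<subseteq> link e a b" "(a, b) \<in> link e a b" "(b, a) \<in> link e a b"
    by (auto simp: link_def)
  have "trans (link e a b)" by (simp add: link_def trans_rtrancl)
  then show "?R y \<Longrightarrow> (x, y) \<in> link e a b"
    using 1 unfolding trans_def by blast
qed

lemma snd_step [simp]: "snd (step s a b) = link (snd s) a b"
  and fst_step: "fst (step s a b) = fst s \<circ> tr a b"
  by (auto simp: step_def)

definition separated :: "nat set \<Rightarrow> nat set \<Rightarrow> (nat \<times> nat) set \<Rightarrow> bool" where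
  "separated S1 S2 e \<longleftrightarrow> (\<forall>x\<in>S1. \<forall>y\<in>S2. (x, y) \<notin> e)"

text \<open>A relation becomes connected after joining \<open>a\<close> and \<open>d\<close> if it was connected before or had exactly
  two classes, one around each of the two points.\<close>

lemma conn_link_split:
  assumes "eqv e" "a \<in> S" "d \<in> S" "a \<noteq> d" "finite S"
  shows "at_id S (\<lambda>e. conn S (link e a d)) (\<sigma>, e) = at_id S (conn S) (\<sigma>, e) +
    (\<Sum>S1 | d \<in> S1 \<and> S1 \<subseteq> S - {a}. at_id S (\<lambda>e. conn S1 e \<and> conn (S - S1) e \<and> separated S1 (S - S1) e) (\<sigma>, e))"
proof (cases "\<forall>x\<in>S. \<sigma> x = x")
  case fx: True
  let ?P = "\<lambda>S1. conn S1 e \<and> conn (S - S1) e \<and> separated S1 (S - S1) e"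
  let ?A = "{S1. d \<in> S1 \<and> S1 \<subseteq> S - {a}}"
  note r = eqv_refl[OF assms(1)] and s = eqv_sym[OF assms(1)] and t = eqv_trans[OF assms(1)]
  \<comment> \<open>The class of \<open>d\<close> is the only candidate for \<open>S1\<close>, so at
    most one term of the sum is nonzero.\<close>
  let ?C = "{x\<in>S. (d, x) \<in> e}"
  have fin: "finite ?A" using assms by simp
  have uniq: "S1 = ?C" if "S1 \<in> ?A" "?P S1" for S1
    using that unfolding conn_def separated_def by auto
  show ?thesis
  proof (cases "conn S e")
    case True
    then have np: "\<not> ?P S1" if "S1 \<in> ?A" for S1
      using that assms unfolding conn_def separated_def by blast
    have "conn S (link e a d)"
      using True assms by (auto simp: conn_def in_link_iff)
    moreover have "(\<Sum>S1\<in>?A. at_id S (\<lambda>e. conn S1 e \<and> conn (S - S1) e \<and> separated S1 (S - S1) e) (\<sigma>, e)) = 0"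
      using np by (intro sum.neutral) (auto simp: at_id_def)
    ultimately show ?thesis using True by (simp add: at_id_def)
  next
    case nc: False
    show ?thesis
    proof (cases "conn S (link e a d)")
      case True
      have "?C \<in> ?A"
      proof -
        have "(d, a) \<notin> e"
        proof
          assume da: "(d, a) \<in> e"
          have "conn S e"
            unfolding conn_def
          proof (intro ballI)
            fix x y assume "x \<in> S" "y \<in> S"
            then have "(x, y) \<in> link e a d" using True by (auto simp: conn_def)
            then show "(x, y) \<in> e"
              using da s[OF da] t in_link_iff[OF assms(1)] by meson
          qed
          then show False using nc by simp
        qed
        then show ?thesis using assms r by auto
      qed
      moreover have "?P ?C"
      proof -
        have "(a, x) \<in> e" if "x \<in> S - ?C" for x
        proof -
          have "(d, x) \<in> link e a d" using that True assms by (auto simp: conn_def)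
          then show ?thesis using that unfolding in_link_iff[OF assms(1)] by auto
        qed
        then show ?thesis
          unfolding conn_def separated_def using s t by blast
      qed
      ultimately have "S1 \<in> ?A \<Longrightarrow> ?P S1 \<longleftrightarrow> S1 = ?C" for S1
        using uniq by blast
      then have "(\<Sum>S1\<in>?A. of_bool (?P S1)) = (\<Sum>S1\<in>?A. of_bool (S1 = ?C))"
        by (intro sum.cong) auto
      also have "\<dots> = (1::nat)"
        using fin \<open>?C \<in> ?A\<close> by (simp add: of_bool_def sum.delta)
      finally show ?thesis using fx nc True by (simp add: at_id_def)
    next
      case False
      have "\<not> ?P S1" if S1: "S1 \<in> ?A" for S1
      proof
        assume P: "?P S1"
        have "conn S (link e a d)"
          unfolding conn_def
        proof (intro ballI)
          fix x y assume "x \<in> S" "y \<in> S"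
          then have "x \<in> S1 \<and> (x, d) \<in> e \<or> x \<in> S - S1 \<and> (x, a) \<in> e"
               "y \<in> S1 \<and> (d, y) \<in> e \<or> y \<in> S - S1 \<and> (a, y) \<in> e"
            using P S1 assms unfolding conn_def by blast+
          then show "(x, y) \<in> link e a d"
            using t unfolding in_link_iff[OF assms(1)] by blast
        qed
        then show False using False by simp
      qed
      then have "(\<Sum>S1\<in>?A. at_id S (\<lambda>e. conn S1 e \<and> conn (S - S1) e \<and> separated S1 (S - S1) e) (\<sigma>, e)) = 0"
        by (intro sum.neutral) (auto simp: at_id_def)
      then show ?thesis using nc False by (simp add: at_id_def)
    qed
  qed
next
  case False
  then have "at_id S Q (\<sigma>, e) = 0" for Q by (auto simp: at_id_def)
  then show ?thesis by simp
qed

lemma transpose_in: "a \<in> S \<Longrightarrow> b \<in> S \<Longrightarrow> x \<in> S \<Longrightarrow> tr a b x \<in> S"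
  by (auto simp: Transposition.transpose_def)

lemma hsym_set_at_id_conn_cong:
  assumes "finite F" "F \<subseteq> S" "eqv e" "eqv e'" 
    "\<And>x. x \<in> S \<Longrightarrow> \<sigma> x = \<sigma>' x" "\<And>x y. x \<in> S \<Longrightarrow> y \<in> S \<Longrightarrow> (x, y) \<in> e \<longleftrightarrow> (x, y) \<in> e'"
  shows "hsym_set F r (at_id S (conn S)) (\<sigma>, e) = hsym_set F r (at_id S (conn S)) (\<sigma>', e')"
proof -
  let ?R = "\<lambda>s s'::state. (\<forall>x\<in>S. fst s x = fst s' x) \<and> eqv (snd s) \<and> eqv (snd s') \<and>
    (\<forall>x\<in>S. \<forall>y\<in>S. (x, y) \<in> snd s \<longleftrightarrow> (x, y) \<in> snd s')"
  show ?thesis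
  proof (rule hsym_set_cong_rel[where R = ?R])
    fix s s' :: state and a b
    assume R: "?R s s'" "a \<in> F" "b \<in> F"
    then have "a \<in> S" "b \<in> S" using assms by auto
    then show "?R (step s a b) (step s' a b)"
      using R by (auto simp: eqv_link in_link_iff fst_step transpose_in)
  next
    fix s s' :: state assume "?R s s'"
    then show "at_id S (conn S) s = at_id S (conn S) s'"
      by (simp add: at_id_def conn_def)
  qed (use assms in auto)
qed

text \<open>Monotone walks on disjoint sets of colours can be interleaved in exactly one way.\<close>

lemma hsym_set_split_step:
  assumes S: "S1 \<inter> S2 = {}" "finite F" "F \<subseteq> S1 \<union> S2" "x \<in> F \<inter> S1"
    and e: "eqv e" "separated S1 S2 e"
    and D0: "\<And>s. eqv (snd s) \<Longrightarrow> \<not> separated S1 S2 (snd s) \<Longrightarrow> D s = 0"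
    and IH1: "hsym_set (F - {x}) (Suc r) D (\<sigma>, e) =
        (\<Sum>r1\<le>Suc r. hsym_set ((F - {x}) \<inter> S1) r1 (at_id S1 (conn S1)) (\<sigma>, e) * hsym_set ((F - {x}) \<inter> S2) (Suc r - r1) (at_id S2 (conn S2)) (\<sigma>, e))"
    and IH2: "\<And>\<sigma> e. eqv e \<Longrightarrow> separated S1 S2 e \<Longrightarrow> hsym_set F r D (\<sigma>, e) =
        (\<Sum>r1\<le>r. hsym_set (F \<inter> S1) r1 (at_id S1 (conn S1)) (\<sigma>, e) * hsym_set (F \<inter> S2) (r - r1) (at_id S2 (conn S2)) (\<sigma>, e))"
  shows "hsym_set F (Suc r) D (\<sigma>, e) =
        (\<Sum>r1\<le>Suc r. hsym_set (F \<inter> S1) r1 (at_id S1 (conn S1)) (\<sigma>, e) * hsym_set (F \<inter> S2) (Suc r - r1) (at_id S2 (conn S2)) (\<sigma>, e))"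
proof -
  let ?h1 = "\<lambda>F r. hsym_set F r (at_id S1 (conn S1))" and ?h2 = "\<lambda>F r. hsym_set F r (at_id S2 (conn S2))"
  have F: "(F - {x}) \<inter> S1 = F \<inter> S1 - {x}" "(F - {x}) \<inter> S2 = F \<inter> S2"
    using S by auto
  \<comment> \<open>A step from \<open>x\<close> into \<open>S2\<close> joins the two sides for
    good, and \<open>D\<close> vanishes on every state that can follow.\<close>
  have cross: "hsym_set F r D (step (\<sigma>, e) a x) = 0" if "a \<in> F \<inter> S2" for a
  proof (rule hsym_set_eq_0[where P = "\<lambda>s::state. eqv (snd s) \<and> (x, a) \<in> snd s"])
    fix s :: state and b c assume "eqv (snd s) \<and> (x, a) \<in> snd s"
    then show "eqv (snd (step s b c)) \<and> (x, a) \<in> snd (step s b c)"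
      by (auto simp: eqv_link in_link_iff)
  next
    fix s :: state assume "eqv (snd s) \<and> (x, a) \<in> snd s"
    then show "D s = 0" using S that by (intro D0) (auto simp: separated_def)
  qed (use S e in \<open>auto simp: eqv_link in_link_iff eqv_refl\<close>)
  \<comment> \<open>A step inside \<open>S1\<close> changes neither the permutation nor the relation
    on \<open>S2\<close>, so the second factor is carried along unchanged.\<close>
  have same: "hsym_set F r D (step (\<sigma>, e) a x) = 
     (\<Sum>r1\<le>r. ?h1 (F \<inter> S1) r1 (step (\<sigma>, e) a x) * ?h2 (F \<inter> S2) (r - r1) (\<sigma>, e))" if "a \<in> F \<inter> S1 - {x}" for a
  proof -
    have noc: "(z, y) \<notin> e" "(y, z) \<notin> e" if "z \<in> S1" "y \<in> S2" for y z
      using that e eqv_sym[OF e(1)] unfolding separated_def by blast+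
    have st: "step (\<sigma>, e) a x = (\<sigma> \<circ> tr a x, link e a x)"
      by (simp add: step_def)
    have s: "separated S1 S2 (link e a x)"
      using that S noc unfolding separated_def in_link_iff[OF e(1)] by blast
    have "?h2 (F \<inter> S2) r2 (step (\<sigma>, e) a x) = ?h2 (F \<inter> S2) r2 (\<sigma>, e)" for r2
      unfolding st
    proof (rule hsym_set_at_id_conn_cong)
      fix y assume "y \<in> S2"
      then have "y \<noteq> a" "y \<noteq> x" using that S by auto
      then show "(\<sigma> \<circ> tr a x) y = \<sigma> y" by simp
    next
      fix y z assume "y \<in> S2" "z \<in> S2"
      then show "(y, z) \<in> link e a x \<longleftrightarrow> (y, z) \<in> e"
        using that S noc unfolding in_link_iff[OF e(1)] by blast
    qed (use S e in \<open>auto simp: eqv_link\<close>)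
    then show ?thesis
      unfolding st by (subst IH2) (auto simp: e eqv_link s)
  qed
  have "(\<Sum>a\<in>F - {x}. hsym_set F r D (step (\<sigma>, e) a x)) = 
      (\<Sum>a\<in>F \<inter> S1 - {x}. hsym_set F r D (step (\<sigma>, e) a x)) + (\<Sum>a\<in>F \<inter> S2. hsym_set F r D (step (\<sigma>, e) a x))"
    using S by (subst sum.union_disjoint[symmetric]) (auto intro!: sum.cong)
  also have "(\<Sum>a\<in>F \<inter> S2. hsym_set F r D (step (\<sigma>, e) a x)) = 0"
    using cross by simp
  also have "(\<Sum>a\<in>F \<inter> S1 - {x}. hsym_set F r D (step (\<sigma>, e) a x)) =
     (\<Sum>r1\<le>r. (\<Sum>a\<in>F \<inter> S1 - {x}. ?h1 (F \<inter> S1) r1 (step (\<sigma>, e) a x)) * ?h2 (F \<inter> S2) (r - r1) (\<sigma>, e))"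
    using same by (simp add: sum_distrib_right sum.swap[of _ "{..r}"])
  finally have *: "hsym_set F (Suc r) D (\<sigma>, e) = hsym_set (F - {x}) (Suc r) D (\<sigma>, e) +
     (\<Sum>r1\<le>r. (\<Sum>a\<in>F \<inter> S1 - {x}. ?h1 (F \<inter> S1) r1 (step (\<sigma>, e) a x)) * ?h2 (F \<inter> S2) (r - r1) (\<sigma>, e))"
    using S by (subst hsym_set_Suc[of F x]) auto
  have "(\<Sum>r1\<le>Suc r. ?h1 (F \<inter> S1) r1 (\<sigma>, e) * ?h2 (F \<inter> S2) (Suc r - r1) (\<sigma>, e))
    = ?h1 (F \<inter> S1) 0 (\<sigma>, e) * ?h2 (F \<inter> S2) (Suc r) (\<sigma>, e) +
      (\<Sum>r1\<le>r. ?h1 (F \<inter> S1) (Suc r1) (\<sigma>, e) * ?h2 (F \<inter> S2) (r - r1) (\<sigma>, e))"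
    by (subst sum.atMost_Suc_shift) simp
  also have "\<dots> = ?h1 (F \<inter> S1 - {x}) 0 (\<sigma>, e) * ?h2 (F \<inter> S2) (Suc r) (\<sigma>, e) +
      (\<Sum>r1\<le>r. (?h1 (F \<inter> S1 - {x}) (Suc r1) (\<sigma>, e) + (\<Sum>a\<in>F \<inter> S1 - {x}. ?h1 (F \<inter> S1) r1 (step (\<sigma>, e) a x)))
         * ?h2 (F \<inter> S2) (r - r1) (\<sigma>, e))"
    using S by (subst hsym_set_Suc[of "F \<inter> S1" x]) auto
  also have "\<dots> = (\<Sum>r1\<le>Suc r. ?h1 (F \<inter> S1 - {x}) r1 (\<sigma>, e) * ?h2 (F \<inter> S2) (Suc r - r1) (\<sigma>, e))
     + (\<Sum>r1\<le>r. (\<Sum>a\<in>F \<inter> S1 - {x}. ?h1 (F \<inter> S1) r1 (step (\<sigma>, e) a x)) * ?h2 (F \<inter> S2) (r - r1) (\<sigma>, e))"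
    unfolding sum.atMost_Suc_shift[of _ r] by (simp add: sum.distrib ring_distribs)
  finally show ?thesis
    using * IH1 unfolding F by simp
qed

lemma sum_atMost_swap: "(\<Sum>i\<le>r. g i (r - i)) = (\<Sum>i\<le>(r::nat). g (r - i) i)"
  by (rule sum.reindex_bij_witness[of _ "\<lambda>i. r - i" "\<lambda>i. r - i"]) auto

text \<open>The set \<open>F\<close> of available colours varies independently of \<open>S1\<close>
  and \<open>S2\<close>: colours are removed in the induction, while all of \<open>S1\<close> and
  all of \<open>S2\<close> must still become connected. Removing a colour of either side is the same
  argument with the sides exchanged.\<close>

lemma hsym_set_split:
  assumes S: "S1 \<inter> S2 = {}" 
    and D1: "\<And>s. eqv (snd s) \<Longrightarrow> \<not> separated S1 S2 (snd s) \<Longrightarrow> D s = 0"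
    and D2: "\<And>s. eqv (snd s) \<Longrightarrow> separated S1 S2 (snd s) \<Longrightarrow> D s = at_id S1 (conn S1) s * at_id S2 (conn S2) s"
  shows "finite F \<Longrightarrow> F \<subseteq> S1 \<union> S2 \<Longrightarrow> eqv e \<Longrightarrow> separated S1 S2 e \<Longrightarrow> hsym_set F r D (\<sigma>, e) =
        (\<Sum>r1\<le>r. hsym_set (F \<inter> S1) r1 (at_id S1 (conn S1)) (\<sigma>, e) * hsym_set (F \<inter> S2) (r - r1) (at_id S2 (conn S2)) (\<sigma>, e))"
proof (induct "card F" arbitrary: F r \<sigma> e)
  case 0
  then have [simp]: "F = {}" by simp
  have "hsym_set {} r1 f s * hsym_set {} (Suc r - r1) g s = 0" if "r1 \<le> Suc r" for r1 r f g s
    using that by (cases r1) auto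
  then have "(\<Sum>r1\<le>Suc r. hsym_set {} r1 (at_id S1 (conn S1)) (\<sigma>, e) * hsym_set {} (Suc r - r1) (at_id S2 (conn S2)) (\<sigma>, e)) = 0" for r
    by (intro sum.neutral) auto
  then show ?case
    using 0 D2[of "(\<sigma>, e)"] by (cases r) (auto simp del: sum.atMost_Suc)
next
  case (Suc n F)
  note IH = Suc.hyps(1)
  show ?case
    using Suc.prems(3,4)
  proof (induct r arbitrary: \<sigma> e)
    case 0
    then show ?case using D2[of "(\<sigma>, e)"] by simp
  next
    case (Suc r)
    obtain x where x: "x \<in> F" using \<open>Suc n = card F\<close> by fastforce
    have IH1: "hsym_set (F - {x}) (Suc r) D (\<sigma>, e) =
        (\<Sum>r1\<le>Suc r. hsym_set ((F - {x}) \<inter> S1) r1 (at_id S1 (conn S1)) (\<sigma>, e) * hsym_set ((F - {x}) \<inter> S2) (Suc r - r1) (at_id S2 (conn S2)) (\<sigma>, e))"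
      using Suc.prems x \<open>Suc n = card F\<close> \<open>finite F\<close> \<open>F \<subseteq> S1 \<union> S2\<close>
      by (intro IH) auto
    have sepc: "eqv e \<Longrightarrow> separated S2 S1 e \<longleftrightarrow> separated S1 S2 e" for e
      unfolding separated_def using eqv_sym by blast
    show ?case
    proof (cases "x \<in> S1")
      case True
      show ?thesis
        by (rule hsym_set_split_step[OF S _ _ _ _ _ D1 IH1 Suc.hyps])
           (use True x Suc.prems \<open>finite F\<close> \<open>F \<subseteq> S1 \<union> S2\<close> in auto)
    next
      case False
      then have x2: "x \<in> S2" using x \<open>F \<subseteq> S1 \<union> S2\<close> by auto
      have "hsym_set F (Suc r) D (\<sigma>, e) =
        (\<Sum>r1\<le>Suc r. hsym_set (F \<inter> S2) r1 (at_id S2 (conn S2)) (\<sigma>, e) * hsym_set (F \<inter> S1) (Suc r - r1) (at_id S1 (conn S1)) (\<sigma>, e))"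
      proof (rule hsym_set_split_step[where x = x])
        show "hsym_set (F - {x}) (Suc r) D (\<sigma>, e) =
        (\<Sum>r1\<le>Suc r. hsym_set ((F - {x}) \<inter> S2) r1 (at_id S2 (conn S2)) (\<sigma>, e) * hsym_set ((F - {x}) \<inter> S1) (Suc r - r1) (at_id S1 (conn S1)) (\<sigma>, e))"
          unfolding IH1 by (subst sum_atMost_swap) (simp only: mult.commute)
      next
        fix \<sigma> e assume "eqv e" "separated S2 S1 e"
        then show "hsym_set F r D (\<sigma>, e) =
          (\<Sum>r1\<le>r. hsym_set (F \<inter> S2) r1 (at_id S2 (conn S2)) (\<sigma>, e) * hsym_set (F \<inter> S1) (r - r1) (at_id S1 (conn S1)) (\<sigma>, e))"
          using sum_atMost_swap[of "\<lambda>i j. hsym_set (F \<inter> S1) i (at_id S1 (conn S1)) (\<sigma>, e) * hsym_set (F \<inter> S2) j (at_id S2 (conn S2)) (\<sigma>, e)" r]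
          by (subst Suc.hyps) (auto simp: sepc mult.commute)
      qed (use S x x2 Suc.prems D1 sepc \<open>finite F\<close> \<open>F \<subseteq> S1 \<union> S2\<close> in auto)
      then show ?thesis
        by (subst sum_atMost_swap) (simp only: mult.commute)
    qed
  qed
qed

lemma hsym_set_plus: "hsym_set S r (\<lambda>s. f s + g s) s = hsym_set S r f s + hsym_set S r g s"
  by (simp add: hsym_set_def hsym_plus)

lemma hsym_set_sum: "hsym_set S r (\<lambda>s. \<Sum>i\<in>I. f i s) s = (\<Sum>i\<in>I. hsym_set S r (f i) s)"
  by (simp add: hsym_set_def hsym_sum)

text \<open>Words start with the largest colour, so the last step of a walk is the first one here,
  and \<open>d\<close> is declared to be the largest colour. What remains after it is either
  connected by itself, or has two classes containing \<open>d\<close> and \<open>a\<close> and is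
  then an interleaving of two independent walks.\<close>

lemma nwalks_Suc:
  assumes "finite S" "d \<in> S" "S \<noteq> {d}"
  shows "nwalks S (Suc r) \<sigma> = (\<Sum>a\<in>S - {d}. nwalks S r (\<sigma> \<circ> tr a d) +
     (\<Sum>S1 | d \<in> S1 \<and> S1 \<subseteq> S - {a}. \<Sum>r1\<le>r. 
        nwalks S1 r1 (\<sigma> \<circ> tr a d) * nwalks (S - S1) (r - r1) (\<sigma> \<circ> tr a d)))"
proof -
  \<comment> \<open>Without the colour \<open>d\<close>, the largest one, no step touches the point
    \<open>d\<close>, which therefore stays isolated.\<close>
  have 1: "hsym_set (S - {d}) (Suc r) (at_id S (conn S)) (\<sigma>, Id) = 0"
  proof (rule hsym_set_eq_0[where P = "\<lambda>s::state. eqv (snd s) \<and> (\<forall>y. (d, y) \<in> snd s \<longrightarrow> y = d)"])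
    fix s :: state and a b
    assume *: "eqv (snd s) \<and> (\<forall>y. (d, y) \<in> snd s \<longrightarrow> y = d)" "a \<in> S - {d}" "b \<in> S - {d}"
    then show "eqv (snd (step s a b)) \<and> (\<forall>y. (d, y) \<in> snd (step s a b) \<longrightarrow> y = d)"
      by (auto simp: eqv_link in_link_iff)
  next
    fix s :: state
    assume *: "eqv (snd s) \<and> (\<forall>y. (d, y) \<in> snd s \<longrightarrow> y = d)"
    obtain z where "z \<in> S" "z \<noteq> d" using assms by auto
    then show "at_id S (conn S) s = 0" using * assms by (auto simp: at_id_def conn_def)
  qed (use assms in auto)
  have 2: "hsym_set S r (at_id S (conn S)) (step (\<sigma>, Id) a d) =
      nwalks S r (\<sigma> \<circ> tr a d) +
     (\<Sum>S1 | d \<in> S1 \<and> S1 \<subseteq> S - {a}. \<Sum>r1\<le>r. 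
        nwalks S1 r1 (\<sigma> \<circ> tr a d) * nwalks (S - S1) (r - r1) (\<sigma> \<circ> tr a d))"
    if a: "a \<in> S - {d}" for a
  proof -
    define \<rho> where "\<rho> = \<sigma> \<circ> tr a d"
    \<comment> \<open>The edge of the removed step is moved from the initial relation into the final
      test, where \<open>conn_link_split\<close> takes it apart.\<close>
    have "hsym_set S r (at_id S (conn S)) (step (\<sigma>, Id) a d) = hsym_set S r (at_id S (\<lambda>e. conn S (link e a d))) (\<rho>, Id)"
      by (rule hsym_set_cong_rel[where R = "\<lambda>s s'::state. fst s = fst s' \<and> snd s = link (snd s') a d"])
         (use assms in \<open>auto simp: step_def at_id_def link_commute \<rho>_def\<close>)
    also have "\<dots> = hsym_set S r (\<lambda>s. at_id S (conn S) s +
       (\<Sum>S1 | d \<in> S1 \<and> S1 \<subseteq> S - {a}. at_id S (\<lambda>e. conn S1 e \<and> conn (S - S1) e \<and> separated S1 (S - S1) e) s)) (\<rho>, Id)"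
    proof (rule hsym_set_cong_rel[where R = "\<lambda>s s'::state. s = s' \<and> eqv (snd s)"])
      fix s s' :: state assume "s = s' \<and> eqv (snd s)"
      then show "at_id S (\<lambda>e. conn S (link e a d)) s = at_id S (conn S) s' +
       (\<Sum>S1 | d \<in> S1 \<and> S1 \<subseteq> S - {a}. at_id S (\<lambda>e. conn S1 e \<and> conn (S - S1) e \<and> separated S1 (S - S1) e) s')"
        using conn_link_split[of "snd s" a S d "fst s"] a assms by auto
    qed (use assms in \<open>auto simp: eqv_link\<close>)
    also have "\<dots> = nwalks S r \<rho> + (\<Sum>S1 | d \<in> S1 \<and> S1 \<subseteq> S - {a}. 
       hsym_set S r (at_id S (\<lambda>e. conn S1 e \<and> conn (S - S1) e \<and> separated S1 (S - S1) e)) (\<rho>, Id))"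
      by (simp add: hsym_set_plus hsym_set_sum nwalks_def)
    also have "hsym_set S r (at_id S (\<lambda>e. conn S1 e \<and> conn (S - S1) e \<and> separated S1 (S - S1) e)) (\<rho>, Id)
      = (\<Sum>r1\<le>r. nwalks S1 r1 \<rho> * nwalks (S - S1) (r - r1) \<rho>)" if "S1 \<in> {S1. d \<in> S1 \<and> S1 \<subseteq> S - {a}}" for S1
    proof -
      have S: "S \<inter> S1 = S1" "S \<inter> (S - S1) = S - S1" "S1 \<union> (S - S1) = S" using that by auto
      have d: "at_id S (\<lambda>e. conn S1 e \<and> conn (S - S1) e \<and> separated S1 (S - S1) e) s
        = (if separated S1 (S - S1) (snd s) then at_id S1 (conn S1) s * at_id (S - S1) (conn (S - S1)) s else 0)" for s
        using S by (auto simp: at_id_def)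
      show ?thesis
        unfolding nwalks_def
        by (subst hsym_set_split[of S1 "S - S1"]) (use S assms d in \<open>auto simp: separated_def\<close>)
    qed
    then have "(\<Sum>S1 | d \<in> S1 \<and> S1 \<subseteq> S - {a}. 
       hsym_set S r (at_id S (\<lambda>e. conn S1 e \<and> conn (S - S1) e \<and> separated S1 (S - S1) e)) (\<rho>, Id)) =
       (\<Sum>S1 | d \<in> S1 \<and> S1 \<subseteq> S - {a}. \<Sum>r1\<le>r. nwalks S1 r1 \<rho> * nwalks (S - S1) (r - r1) \<rho>)"
      by (intro sum.cong) auto
    finally show ?thesis unfolding \<rho>_def .
  qed
  show ?thesis
    unfolding nwalks_def[of S "Suc r"] using assms 1 2 by (subst hsym_set_Suc[of S d]) auto
qed

section \<open>Cycles\<close>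

lemma comp_tr_tr [simp]: "(\<sigma> \<circ> tr a d) \<circ> tr a d = \<sigma>"
  by (simp add: comp_assoc)

lemma orbit_closed_subset:
  assumes "f x \<in> A" "\<And>y. y \<in> A \<Longrightarrow> f y \<in> A"
  shows "orb f x \<subseteq> A"
proof
  fix y assume "y \<in> orb f x" then show "y \<in> A" by induct (use assms in auto)
qed

lemma orbit_eq_or_disjoint:
  assumes "permutation f" 
  shows "y \<in> orb f x \<longleftrightarrow> orb f y = orb f x"
proof
  assume y: "y \<in> orb f x"
  then have "x \<in> orb f y" by (rule orbit_swap[OF permutation_self_in_orbit[OF assms]])
  then show "orb f y = orb f x" using y by (auto intro: orbit_trans)
next
  assume "orb f y = orb f x"
  then show "y \<in> orb f x" using permutation_self_in_orbit[OF assms, of y] by simp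
qed

lemma orbit_sym:
  assumes "permutation f" shows "y \<in> orb f x \<Longrightarrow> x \<in> orb f y"
  using permutation_self_in_orbit[OF assms] by (rule orbit_swap)

lemma permutation_comp_tr: "permutation f \<Longrightarrow> permutation (f \<circ> tr a d)"
  by (intro permutation_compose permutation_swap_id)

lemma merge_sub:
  assumes "permutation \<tau>" "d \<notin> orb \<tau> a"
  shows "orb \<tau> a \<subseteq> orb (\<tau> \<circ> tr a d) d"
proof -
  let ?\<rho> = "\<tau> \<circ> tr a d"
  have "y \<in> orb \<tau> a \<and> y \<in> orb ?\<rho> d" if "y \<in> orb \<tau> a" for y
    using that
  proof induct
    case base
    have "?\<rho> d = \<tau> a" by simp
    then show ?case using orbit.base[of \<tau> a] orbit.base[of ?\<rho> d] by metis
  next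
    case (step y)
    have "\<tau> y \<in> orb ?\<rho> d"
    proof (cases "y = a")
      case True
      have "?\<rho> d = \<tau> a" by simp
      then show ?thesis using True orbit.base[of ?\<rho> d] by metis
    next
      case False
      moreover have "y \<noteq> d" using step assms by blast
      ultimately have "?\<rho> y = \<tau> y" by simp
      then show ?thesis using step orbit.step[of y ?\<rho> d] by metis
    qed
    then show ?case using step orbit.step[of y \<tau> a] by blast
  qed
  then show ?thesis by blast
qed

lemma orbit_merge:
  assumes p: "permutation \<tau>" and a: "a \<notin> orb \<tau> d"
  defines "\<rho> \<equiv> \<tau> \<circ> tr a d"
  shows "orb \<rho> d = orb \<tau> a \<union> orb \<tau> d" "orb \<rho> a = orb \<tau> a \<union> orb \<tau> d"
    "x \<notin> orb \<tau> a \<Longrightarrow> x \<notin> orb \<tau> d \<Longrightarrow> orb \<rho> x = orb \<tau> x"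
proof -
  note self = permutation_self_in_orbit[OF p]
  have d: "d \<notin> orb \<tau> a" using a orbit_sym[OF p, of d a] by auto
  have \<rho>: "permutation \<rho>" unfolding \<rho>_def using p by (rule permutation_comp_tr)
  have 1: "orb \<tau> a \<subseteq> orb \<rho> d" unfolding \<rho>_def by (rule merge_sub[OF p d])
  have 2: "orb \<tau> d \<subseteq> orb \<rho> a" unfolding \<rho>_def using merge_sub[OF p a] by (simp only: transpose_commute[of a d])
  have "a \<in> orb \<rho> d" using 1 self by auto
  then have eq: "orb \<rho> a = orb \<rho> d" using orbit_eq_or_disjoint[OF \<rho>, of a d] by simp
  have "orb \<rho> d \<subseteq> orb \<tau> a \<union> orb \<tau> d"
  proof (rule orbit_closed_subset)
    show "\<rho> d \<in> orb \<tau> a \<union> orb \<tau> d" by (simp add: \<rho>_def orbit.base)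
  next
    fix y assume "y \<in> orb \<tau> a \<union> orb \<tau> d"
    then show "\<rho> y \<in> orb \<tau> a \<union> orb \<tau> d"
      using orbit.base[of \<tau> a] orbit.base[of \<tau> d] orbit.step[of y \<tau> a] orbit.step[of y \<tau> d]
      unfolding \<rho>_def by (auto simp: Transposition.transpose_def)
  qed
  then show "orb \<rho> d = orb \<tau> a \<union> orb \<tau> d" "orb \<rho> a = orb \<tau> a \<union> orb \<tau> d"
    using 1 2 eq by auto
  show "orb \<rho> x = orb \<tau> x" if "x \<notin> orb \<tau> a" "x \<notin> orb \<tau> d"
  proof (rule orbit_cong0[of x "orb \<tau> x"])
    have "y \<noteq> a \<and> y \<noteq> d" if "y \<in> orb \<tau> x" for y
      using orbit_sym[OF p that] \<open>x \<notin> orb \<tau> a\<close> \<open>x \<notin> orb \<tau> d\<close> by auto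
    then show "\<rho> y = \<tau> y" if "y \<in> orb \<tau> x" for y using that by (auto simp: \<rho>_def)
    then show "\<rho> \<in> orb \<tau> x \<rightarrow> orb \<tau> x" using orbit.step[of _ \<tau> x] by simp
    show "x \<in> orb \<tau> x" by (rule self)
  qed
qed

lemma orbit_enum:
  fixes d :: nat
  assumes "permutation \<tau>"
  defines "k \<equiv> card (orb \<tau> d)"
  shows "inj_on (\<lambda>i. (\<tau> ^^ i) d) {0..<k}" "orb \<tau> d = (\<lambda>i. (\<tau> ^^ i) d) ` {0..<k}" "(\<tau> ^^ k) d = d" "0 < k"
proof -
  note self = permutation_self_in_orbit[OF assms(1), of d]
  let ?n = "funpow_dist1 \<tau> d d"
  have 1: "orb \<tau> d = (\<lambda>i. (\<tau> ^^ i) d) ` {0..<?n}"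
    by (rule orbit_conv_funpow_dist1[OF self])
  have 2: "inj_on (\<lambda>i. (\<tau> ^^ i) d) {0..<?n}"
    by (rule inj_on_funpow_dist1[OF self])
  have k: "k = ?n" unfolding k_def 1 using card_image[OF 2] by simp
  show "inj_on (\<lambda>i. (\<tau> ^^ i) d) {0..<k}" "orb \<tau> d = (\<lambda>i. (\<tau> ^^ i) d) ` {0..<k}" "(\<tau> ^^ k) d = d" "0 < k"
    unfolding k using 1 2 funpow_dist1_prop[OF self] by auto
qed

lemma orbit_split:
  assumes p: "permutation \<tau>" and j: "0 < j" "j < card (orb \<tau> d)"
  defines "a \<equiv> (\<tau> ^^ j) d"
  defines "\<rho> \<equiv> \<tau> \<circ> tr a d"
  shows "a \<notin> orb \<rho> d" "card (orb \<rho> a) = j" "card (orb \<rho> d) = card (orb \<tau> d) - j"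
    "orb \<tau> d = orb \<rho> a \<union> orb \<rho> d"
proof -
  let ?k = "card (orb \<tau> d)"
  note en = orbit_enum[OF p, of d]
  have inj: "(\<tau> ^^ i) d = (\<tau> ^^ l) d \<longleftrightarrow> i = l" if "i < ?k" "l < ?k" for i l
    using that inj_on_eq_iff[OF en(1)] by auto
  have pr: "permutation \<rho>" unfolding \<rho>_def using p by (rule permutation_comp_tr)
  have ad: "(\<tau> ^^ i) d \<noteq> a" "(\<tau> ^^ i) d \<noteq> d" if "0 < i" "i < j" for i
    using that j inj[of i j] inj[of i 0] unfolding a_def by auto
  have \<rho>a: "\<rho> a = \<tau> d" by (simp add: \<rho>_def)
  \<comment> \<open>The cycle is cut behind \<open>d\<close> and behind \<open>a\<close>: the new
    cycle of \<open>a\<close> consists of the points after \<open>d\<close> up to and including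
    \<open>a\<close>.\<close>
  have o: "orb \<rho> a = (\<lambda>i. (\<tau> ^^ i) d) ` {1..j}"
  proof (rule subset_antisym)
    show "orb \<rho> a \<subseteq> (\<lambda>i. (\<tau> ^^ i) d) ` {1..j}"
    proof (rule orbit_closed_subset)
      show m: "\<rho> a \<in> (\<lambda>i. (\<tau> ^^ i) d) ` {1..j}"
        using j \<rho>a by (intro image_eqI[where x = 1]) auto
      fix y assume "y \<in> (\<lambda>i. (\<tau> ^^ i) d) ` {1..j}"
      then obtain i where i: "y = (\<tau> ^^ i) d" "1 \<le> i" "i \<le> j" by auto
      show "\<rho> y \<in> (\<lambda>i. (\<tau> ^^ i) d) ` {1..j}"
      proof (cases "i = j")
        case True
        then show ?thesis using m i by (simp add: a_def)
      next
        case False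
        then have "\<rho> y = (\<tau> ^^ Suc i) d" using ad[of i] i by (simp add: \<rho>_def)
        then show ?thesis using i False by (intro image_eqI[where x = "Suc i"]) auto
      qed
    qed
    have "1 \<le> i \<Longrightarrow> i \<le> j \<Longrightarrow> (\<tau> ^^ i) d \<in> orb \<rho> a" for i
    proof (induct i rule: dec_induct)
      case base
      then show ?case using orbit.base[of \<rho> a] \<rho>a by simp
    next
      case (step n)
      then have "\<rho> ((\<tau> ^^ n) d) = (\<tau> ^^ Suc n) d" using ad[of n] by (simp add: \<rho>_def)
      then show ?case using step orbit.step[of "(\<tau> ^^ n) d" \<rho> a] by simp
    qed
    then show "(\<lambda>i. (\<tau> ^^ i) d) ` {1..j} \<subseteq> orb \<rho> a" by auto
  qed
  have "inj_on (\<lambda>i. (\<tau> ^^ i) d) {1..j}"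
    by (rule inj_on_subset[OF en(1)]) (use j in auto)
  then show ca: "card (orb \<rho> a) = j" unfolding o by (simp add: card_image)
  have "d \<notin> orb \<rho> a"
  proof
    assume "d \<in> orb \<rho> a"
    then obtain i where "d = (\<tau> ^^ i) d" "1 \<le> i" "i \<le> j" unfolding o by auto
    then show False using inj[of i 0] j en(4) by auto
  qed
  then show a: "a \<notin> orb \<rho> d" using orbit_sym[OF pr, of a d] by auto
  have "\<rho> \<circ> tr a d = \<tau>" by (simp add: \<rho>_def)
  then show u: "orb \<tau> d = orb \<rho> a \<union> orb \<rho> d" 
    using orbit_merge(1)[OF pr a] by simp
  have "orb \<rho> a \<inter> orb \<rho> d = {}"
    proof (rule ccontr)
    assume "orb \<rho> a \<inter> orb \<rho> d \<noteq> {}"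
    then obtain z where "z \<in> orb \<rho> a" "z \<in> orb \<rho> d" by auto
    then have "a \<in> orb \<rho> d" using orbit_sym[OF pr, of z a] orbit_trans[of a \<rho> z d] by simp
    then show False using a by simp
  qed
  then have "card (orb \<tau> d) = card (orb \<rho> a) + card (orb \<rho> d)"
    unfolding u by (intro card_Un_disjoint finite_orbit permutation_self_in_orbit[OF pr])
  then show "card (orb \<rho> d) = card (orb \<tau> d) - j" using ca by simp
qed

lemma orbit_split_ex:
  assumes p: "permutation \<tau>" and "a \<in> orb \<tau> d" "a \<noteq> d"
  shows "a \<notin> orb (\<tau> \<circ> tr a d) d"
proof -
  obtain j where "a = (\<tau> ^^ j) d" "j < card (orb \<tau> d)" 
    using orbit_enum(2)[OF p, of d, THEN equalityD1, THEN subsetD, OF assms(2)] by auto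
  moreover then have "0 < j" using assms(3) by (cases j) auto
  ultimately show ?thesis using orbit_split(1)[OF p] by simp
qed

section \<open>The number of cycles\<close>

definition ncycles :: "nat set \<Rightarrow> (nat \<Rightarrow> nat) \<Rightarrow> nat" where
  "ncycles S \<sigma> = card (orb \<sigma> ` S)"

lemma ncycles_merge:
  assumes p: "permutation \<tau>" and a: "a \<notin> orb \<tau> d" and S: "finite S" "a \<in> S" "d \<in> S"
  shows "ncycles S \<tau> = Suc (ncycles S (\<tau> \<circ> tr a d))"
proof -
  define \<rho> where "\<rho> = \<tau> \<circ> tr a d"
  note self = permutation_self_in_orbit[OF p]
  have \<rho>: "permutation \<rho>" unfolding \<rho>_def by (rule permutation_comp_tr[OF p])
  note m = orbit_merge[OF p a, folded \<rho>_def]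
  define U where "U = orb \<tau> a \<union> orb \<tau> d"
  define B where "B = {x\<in>S. x \<notin> U}"
  have eqI: "orb \<tau> x = orb \<tau> y" if "x \<in> orb \<tau> y" for x y
    using that orbit_eq_or_disjoint[OF p] by simp
  have U: "orb \<rho> x = U" if "x \<in> U" for x
    using that orbit_eq_or_disjoint[OF \<rho>, of x d] m(1) unfolding U_def by simp
  have V: "orb \<rho> x = orb \<tau> x" if "x \<in> B" for x
    using that m(3)[of x] unfolding B_def U_def by simp
  have aU: "a \<in> U" "d \<in> U" unfolding U_def using self by simp_all
  have "orb \<rho> ` S = orb \<rho> ` (S \<inter> U) \<union> orb \<rho> ` B"
    unfolding B_def by blast
  also have "orb \<rho> ` (S \<inter> U) = {U}"
    using U aU S by (intro equalityI subsetI) auto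
  also have "orb \<rho> ` B = orb \<tau> ` B"
    using V by (intro image_cong) auto
  finally have 1: "orb \<rho> ` S = insert U (orb \<tau> ` B)" by simp
  have "orb \<tau> ` S = orb \<tau> ` (S \<inter> U) \<union> orb \<tau> ` B"
    unfolding B_def by blast
  also have "orb \<tau> ` (S \<inter> U) = {orb \<tau> a, orb \<tau> d}"
  proof (rule subset_antisym)
    show "orb \<tau> ` (S \<inter> U) \<subseteq> {orb \<tau> a, orb \<tau> d}"
      unfolding U_def using eqI by blast
    show "{orb \<tau> a, orb \<tau> d} \<subseteq> orb \<tau> ` (S \<inter> U)"
      using aU S by blast
  qed
  finally have 2: "orb \<tau> ` S = insert (orb \<tau> a) (insert (orb \<tau> d) (orb \<tau> ` B))" by simp
  have n: "x \<notin> U" if "x \<in> B" for x using that unfolding B_def by simp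
  have 3: "orb \<tau> a \<notin> orb \<tau> ` B" "orb \<tau> d \<notin> orb \<tau> ` B" "U \<notin> orb \<tau> ` B"
    using n self unfolding U_def by blast+
  have "orb \<tau> a \<noteq> orb \<tau> d" using a self by blast
  moreover have "finite B" unfolding B_def using S by simp
  ultimately show ?thesis
    unfolding ncycles_def \<rho>_def[symmetric] 1 2 using 3 by simp
qed

lemma ncycles_split:
  assumes "permutation \<tau>" "a \<in> orb \<tau> d" "a \<noteq> d" "finite S" "a \<in> S" "d \<in> S"
  shows "ncycles S (\<tau> \<circ> tr a d) = Suc (ncycles S \<tau>)"
  using ncycles_merge[OF permutation_comp_tr[OF assms(1)] orbit_split_ex[OF assms(1-3)] assms(4-6)] by simp

lemma orbit_stable: "\<sigma> ` S \<subseteq> S \<Longrightarrow> x \<in> S \<Longrightarrow> orb \<sigma> x \<subseteq> S"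
  by (rule orbit_closed_subset) auto

lemma ncycles_Un:
  assumes "finite S1" "finite S2" "\<sigma> ` S1 \<subseteq> S1" "\<sigma> ` S2 \<subseteq> S2" "S1 \<inter> S2 = {}"
  shows "ncycles (S1 \<union> S2) \<sigma> = ncycles S1 \<sigma> + ncycles S2 \<sigma>"
proof -
  have "orb \<sigma> x \<noteq> orb \<sigma> y" if "x \<in> S1" "y \<in> S2" for x y
    using orbit_stable[OF assms(3) that(1)] orbit_stable[OF assms(4) that(2)] orbit_nonempty[of \<sigma> x] assms(5) by auto
  then have "orb \<sigma> ` S1 \<inter> orb \<sigma> ` S2 = {}" by auto
  then show ?thesis
    unfolding ncycles_def image_Un using assms by (intro card_Un_disjoint) auto
qed

lemma ncycles_pos: "finite S \<Longrightarrow> S \<noteq> {} \<Longrightarrow> 0 < ncycles S \<sigma>"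
  by (simp add: ncycles_def card_gt_0_iff)

text \<open>Steps inside \<open>S\<close> do not change the image of \<open>S\<close>, and at the
  end \<open>S\<close> is mapped to itself. This removes all splits along sets that are not unions
  of cycles.\<close>

lemma nwalks_not_stable:
  assumes "finite S" "\<not> \<sigma> ` S \<subseteq> S"
  shows "nwalks S r \<sigma> = 0"
  unfolding nwalks_def
proof (rule hsym_set_eq_0[where P = "\<lambda>s::state. \<not> fst s ` S \<subseteq> S"])
  fix s :: state and a b
  assume "\<not> fst s ` S \<subseteq> S" "a \<in> S" "b \<in> S"
  moreover from this have "tr a b ` S = S" by (intro permutes_image permutes_swap_id)
  then have "fst (step s a b) ` S = fst s ` S" by (simp only: fst_step image_comp[symmetric])
  ultimately show "\<not> fst (step s a b) ` S \<subseteq> S" by simp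
next
  fix s :: state assume "\<not> fst s ` S \<subseteq> S"
  then have "\<not> (\<forall>x\<in>S. fst s x = x)" by force
  then show "at_id S (conn S) s = 0" by (simp add: at_id_def)
qed (use assms in auto)

lemma nwalks_0: "nwalks S 0 \<sigma> = of_bool ((\<forall>x\<in>S. \<sigma> x = x) \<and> (\<forall>x\<in>S. \<forall>y\<in>S. x = y))"
  by (simp add: nwalks_def at_id_def conn_def)

lemma nwalks_singleton_Suc: "nwalks {d} (Suc r) \<sigma> = 0"
  unfolding nwalks_def using hsym_set_Suc[of "{d}" d] by simp

text \<open>The Riemann--Hurwitz bound: the genus is nonnegative.\<close>

lemma nwalks_nonzero_bound:
  assumes "finite S" "S \<noteq> {}" "permutation \<sigma>" "nwalks S r \<sigma> \<noteq> 0"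
  shows "card S + ncycles S \<sigma> \<le> r + 2"
  using assms
proof (induct r arbitrary: S \<sigma> rule: less_induct)
  case (less r)
  obtain d where d: "d \<in> S" using less by auto
  show ?case
  proof (cases "S = {d}")
    case True
    then show ?thesis by (simp add: ncycles_def)
  next
    case False
    have "r \<noteq> 0"
    proof
      assume "r = 0"
      then have "\<forall>x\<in>S. \<forall>y\<in>S. x = y"
        using less.prems(4) by (simp add: nwalks_0)
      then show False using False d by blast
    qed
    then obtain q where r: "r = Suc q" by (cases r) auto
    define \<rho> where "\<rho> a = \<sigma> \<circ> tr a d" for a
    from less.prems(4)[unfolded r nwalks_Suc[OF less.prems(1) d False], folded \<rho>_def] obtain a where a: "a \<in> S - {d}" and 
      nz: "nwalks S q (\<rho> a) + (\<Sum>S1 | d \<in> S1 \<and> S1 \<subseteq> S - {a}. \<Sum>r1\<le>q. nwalks S1 r1 (\<rho> a) * nwalks (S - S1) (q - r1) (\<rho> a)) \<noteq> 0"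
      by (rule sum.not_neutral_contains_not_neutral)
    have p: "permutation (\<rho> a)" unfolding \<rho>_def using less.prems by (intro permutation_comp_tr)
    show ?thesis
    proof (cases "nwalks S q (\<rho> a) = 0")
      case False
      then have "card S + ncycles S (\<rho> a) \<le> q + 2"
        using False by (intro less.hyps[OF _ less.prems(1,2) p]) (simp_all add: r)
      moreover have "ncycles S \<sigma> \<le> Suc (ncycles S (\<rho> a))"
      proof (cases "a \<in> orb \<sigma> d")
        case True
        then show ?thesis using ncycles_split[of \<sigma> a d S] less.prems a d by (simp add: \<rho>_def)
      next
        case False
        then show ?thesis using ncycles_merge[of \<sigma> a d S] less.prems a d by (simp add: \<rho>_def)
      qed
      ultimately show ?thesis using r by simp
    next
      case True
      with nz have "(\<Sum>S1 | d \<in> S1 \<and> S1 \<subseteq> S - {a}. \<Sum>r1\<le>q. nwalks S1 r1 (\<rho> a) * nwalks (S - S1) (q - r1) (\<rho> a)) \<noteq> 0"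
        by simp
      then obtain S1 where "S1 \<in> {S1. d \<in> S1 \<and> S1 \<subseteq> S - {a}}" and
        nz1: "(\<Sum>r1\<le>q. nwalks S1 r1 (\<rho> a) * nwalks (S - S1) (q - r1) (\<rho> a)) \<noteq> 0"
        by (rule sum.not_neutral_contains_not_neutral)
      then have S1: "d \<in> S1" "S1 \<subseteq> S - {a}" by auto
      from nz1 obtain r1 where "r1 \<in> {..q}" "nwalks S1 r1 (\<rho> a) * nwalks (S - S1) (q - r1) (\<rho> a) \<noteq> 0"
        by (rule sum.not_neutral_contains_not_neutral)
      then obtain r1 where r1: "r1 \<le> q" "nwalks S1 r1 (\<rho> a) \<noteq> 0" "nwalks (S - S1) (q - r1) (\<rho> a) \<noteq> 0"
        by auto
      have fin: "finite S1" "finite (S - S1)" using S1 less.prems finite_subset[of S1 S] by auto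
      have a2: "a \<in> S - S1" using S1 a by auto
      have st: "\<rho> a ` S1 \<subseteq> S1" "\<rho> a ` (S - S1) \<subseteq> S - S1"
        using nwalks_not_stable[OF fin(1)] nwalks_not_stable[OF fin(2)] r1 by metis+
      have b1: "card S1 + ncycles S1 (\<rho> a) \<le> r1 + 2"
        by (rule less.hyps) (use r r1 S1 fin p in auto)
      have b2: "card (S - S1) + ncycles (S - S1) (\<rho> a) \<le> q - r1 + 2"
        by (rule less.hyps) (use r r1 S1 fin p a2 in auto)
      have "S1 \<union> (S - S1) = S" using S1 by auto
      then have c: "card S = card S1 + card (S - S1)" "ncycles S (\<rho> a) = ncycles S1 (\<rho> a) + ncycles (S - S1) (\<rho> a)"
        using card_Un_disjoint[of S1 "S - S1"] ncycles_Un[of S1 "S - S1" "\<rho> a"] fin st by auto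
      \<comment> \<open>The two bounds add up to \<open>q + 4\<close>. As \<open>d\<close> and
        \<open>a\<close> lie in different stable parts, \<open>\<rho> a\<close> has one cycle more
        than \<open>\<sigma>\<close>, and together with \<open>r = Suc q\<close> this leaves
        \<open>r + 2\<close>.\<close>
      have "a \<notin> orb (\<rho> a) d"
        using orbit_stable[OF st(1) S1(1)] a2 by auto
      then have "ncycles S (\<rho> a) = Suc (ncycles S \<sigma>)"
        using ncycles_merge[OF p, of a d S] less.prems a d comp_tr_tr[of \<sigma> a d] unfolding \<rho>_def by simp
      then show ?thesis using b1 b2 c r1 r by simp
    qed
  qed
qed

lemma nwalks_rename:
  assumes "finite S" "inj_on \<tau> S" "\<sigma> ` S \<subseteq> S" "\<And>x. x \<in> S \<Longrightarrow> \<sigma>' (\<tau> x) = \<tau> (\<sigma> x)"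
  shows "nwalks (\<tau> ` S) r \<sigma>' = nwalks S r \<sigma>"
proof -
  let ?R = "\<lambda>s s'::state. (\<forall>x\<in>S. fst s x \<in> S \<and> fst s' (\<tau> x) = \<tau> (fst s x)) \<and> eqv (snd s) \<and> eqv (snd s') \<and>
    (\<forall>x\<in>S. \<forall>y\<in>S. (\<tau> x, \<tau> y) \<in> snd s' \<longleftrightarrow> (x, y) \<in> snd s)"
  have "hsym_set S r (at_id S (conn S)) (\<sigma>, Id) = hsym_set (\<tau> ` S) r (at_id (\<tau> ` S) (conn (\<tau> ` S))) (\<sigma>', Id)"
  proof (rule hsym_set_sim[where R = ?R])
    fix s s' :: state and a b
    assume R: "?R s s'" and ab: "a \<in> S" "b \<in> S"
    have t: "tr (\<tau> a) (\<tau> b) (\<tau> x) = \<tau> (tr a b x)" if "x \<in> S" for x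
      using that ab inj_on_eq_iff[OF assms(2)] by (auto simp: Transposition.transpose_def)
    show "?R (step s a b) (step s' (\<tau> a) (\<tau> b))"
      using R ab by (auto simp: fst_step t transpose_in eqv_link in_link_iff)
  next
    fix s s' :: state assume R: "?R s s'"
    have "fst s' (\<tau> x) = \<tau> x \<longleftrightarrow> fst s x = x" if "x \<in> S" for x
      using that R inj_on_eq_iff[OF assms(2)] by auto
    then show "at_id S (conn S) s = at_id (\<tau> ` S) (conn (\<tau> ` S)) s'"
      using R by (simp add: at_id_def conn_def)
  next
    have "\<tau> x = \<tau> y \<longleftrightarrow> x = y" if "x \<in> S" "y \<in> S" for x y
      using that inj_on_eq_iff[OF assms(2)] by auto
    then show "?R (\<sigma>, Id) (\<sigma>', Id)" using assms by auto
  qed (use assms in auto)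
  then show ?thesis by (simp add: nwalks_def)
qed

section \<open>Marked cycles in a background of fixed points\<close>

text \<open>The background is a concrete block of \<open>m\<close> numbers above \<open>V\<close>,
  and \<open>\<sigma>\<close> is replaced by the identity outside \<open>V\<close>, so that the
  count is a function of \<open>V\<close>, \<open>\<sigma>\<close> on \<open>V\<close>,
  \<open>m\<close> and \<open>r\<close> alone; \<open>nwalks_eq_nwalks_bg\<close> then allows any
  other background. The inserted 0 gives \<open>Max\<close> a meaning for empty
  \<open>V\<close>.\<close>

definition nwalks_bg :: "nat set \<Rightarrow> (nat \<Rightarrow> nat) \<Rightarrow> nat \<Rightarrow> nat \<Rightarrow> nat" where
  "nwalks_bg V \<sigma> m r = (if \<sigma> ` V \<subseteq> V then 
     nwalks (V \<union> {Suc (Max (insert 0 V))..<Suc (Max (insert 0 V)) + m}) r (\<lambda>x. if x \<in> V then \<sigma> x else x) else 0)"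

lemma nwalks_bg_not_stable: "\<not> \<sigma> ` V \<subseteq> V \<Longrightarrow> nwalks_bg V \<sigma> m r = 0"
  by (simp add: nwalks_bg_def)

lemma nwalks_eq_nwalks_bg:
  assumes V: "finite V" "finite U" "V \<inter> U = {}" "\<And>u. u \<in> U \<Longrightarrow> \<sigma> u = u" "\<And>x. x \<in> V \<Longrightarrow> \<sigma> x \<notin> U"
  shows "nwalks (V \<union> U) r \<sigma> = nwalks_bg V \<sigma> (card U) r"
proof (cases "\<sigma> ` V \<subseteq> V")
  case False
  then have "\<not> \<sigma> ` (V \<union> U) \<subseteq> V \<union> U" using V by blast
  then show ?thesis using False nwalks_not_stable[of "V \<union> U"] V by (simp add: nwalks_bg_not_stable)
next
  case True
  define W where "W = {Suc (Max (insert 0 V))..<Suc (Max (insert 0 V)) + card U}"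
  have W: "x \<notin> W" if "x \<in> V" for x
  proof -
    have "x \<le> Max (insert 0 V)" using V that by (intro Max_ge) auto
    then show ?thesis by (simp add: W_def)
  qed
  have "card U = card W" "finite W" by (simp_all add: W_def)
  then obtain h where h: "bij_betw h U W"
    using finite_same_card_bij[OF V(2)] by blast
  define \<tau> where "\<tau> x = (if x \<in> V then x else h x)" for x
  have hW: "h z \<in> W" if "z \<in> U" for z using h that by (rule bij_betwE[THEN bspec])
  have \<tau>V: "\<tau> x = x" if "x \<in> V" for x using that by (simp add: \<tau>_def)
  have \<tau>U: "\<tau> x = h x" if "x \<in> U" for x
  proof -
    have "x \<notin> V" using that V(3) by blast
    then show ?thesis by (simp add: \<tau>_def)
  qed
  have "inj_on \<tau> (V \<union> U)"
  proof (rule inj_on_Un[THEN iffD2], intro conjI)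
    show "inj_on \<tau> V" by (rule inj_onI) (simp add: \<tau>V)
    show "inj_on \<tau> U" using bij_betw_imp_inj_on[OF h] \<tau>U by (simp add: inj_on_def)
    have "\<tau> ` (V - U) \<subseteq> V" using \<tau>V by auto
    moreover have "\<tau> ` (U - V) \<subseteq> W" using \<tau>U hW by auto
    ultimately show "\<tau> ` (V - U) \<inter> \<tau> ` (U - V) = {}" using W by blast
  qed
  moreover have "\<tau> ` (V \<union> U) = V \<union> W"
  proof -
    have "\<tau> ` V = V" using \<tau>V by simp
    moreover have "\<tau> ` U = h ` U" using \<tau>U by simp
    ultimately show ?thesis using h by (simp add: image_Un bij_betw_def)
  qed
  moreover have "(\<lambda>x. if x \<in> V then \<sigma> x else x) (\<tau> x) = \<tau> (\<sigma> x)" if "x \<in> V \<union> U" for x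
  proof (cases "x \<in> V")
    case False
    then have x: "x \<in> U" using that by simp
    moreover have "h x \<notin> V" using W hW[OF x] by blast
    ultimately show ?thesis using \<tau>U[OF x] V(4)[OF x] by simp
  next
    case xV: True
    then have "\<sigma> x \<in> V" using True by blast
    then show ?thesis using xV \<tau>V by simp
  qed
  moreover have "\<sigma> ` (V \<union> U) \<subseteq> V \<union> U" using True V by auto
  ultimately have "nwalks (V \<union> W) r (\<lambda>x. if x \<in> V then \<sigma> x else x) = nwalks (V \<union> U) r \<sigma>"
    using nwalks_rename[of "V \<union> U" \<tau> \<sigma> "\<lambda>x. if x \<in> V then \<sigma> x else x" r] V by simp
  then show ?thesis using True by (simp add: nwalks_bg_def W_def)
qed

lemma ex_fresh:
  assumes "finite (A :: nat set)"
  obtains U where "finite U" "card U = m" "U \<inter> A = {}"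
proof -
  let ?b = "Suc (Max (insert 0 A))"
  have b: "x < ?b" if "x \<in> A" for x
    using assms that by (intro le_imp_less_Suc Max_ge) auto
  then have "x \<notin> {?b..<?b + m}" if "x \<in> A" for x using b[OF that] by simp
  then have "{?b..<?b + m} \<inter> A = {}" by blast
  then show ?thesis using that[of "{?b..<?b + m}"] by simp
qed

lemma ex_background:
  fixes \<sigma> :: "nat \<Rightarrow> nat"
  assumes "permutation \<sigma>" "finite V"
  shows "\<exists>U. finite U \<and> card U = m \<and> V \<inter> U = {} \<and> (\<forall>u\<in>U. \<sigma> u = u)"
proof -
  have "finite {x. \<sigma> x \<noteq> x}" using assms permutation by auto
  then obtain U where "finite U" "card U = m" "U \<inter> ({x. \<sigma> x \<noteq> x} \<union> V) = {}"
    using ex_fresh[of "{x. \<sigma> x \<noteq> x} \<union> V" m] assms by auto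
  then show ?thesis by (intro exI[of _ U]) blast
qed

text \<open>Every background point counts once as a point and once as a cycle, whence
  \<open>2 * m\<close>.\<close>

lemma nwalks_bg_nonzero_bound:
  assumes "finite V" "V \<noteq> {}" "permutation \<sigma>" "nwalks_bg V \<sigma> m r \<noteq> 0"
  shows "card V + 2 * m + ncycles V \<sigma> \<le> r + 2"
proof -
  have st: "\<sigma> ` V \<subseteq> V" using assms(4) nwalks_bg_not_stable[of \<sigma> V m r] by argo
  obtain U where U: "finite U" "card U = m" "V \<inter> U = {}" "\<forall>u\<in>U. \<sigma> u = u"
    using ex_background[OF assms(3,1), of m] by (elim exE conjE)
  have "nwalks (V \<union> U) r \<sigma> = nwalks_bg V \<sigma> (card U) r"
    by (rule nwalks_eq_nwalks_bg[OF assms(1) U(1,3)]) (use U(3,4) st in auto)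
  then have "card (V \<union> U) + ncycles (V \<union> U) \<sigma> \<le> r + 2"
    by (intro nwalks_nonzero_bound) (use U(1,2) assms in simp_all)
  moreover have "ncycles (V \<union> U) \<sigma> = ncycles V \<sigma> + ncycles U \<sigma>"
    by (rule ncycles_Un[OF assms(1) U(1) st _ U(3)]) (use U(4) in auto)
  moreover have "ncycles U \<sigma> = card U"
  proof -
    have "orb \<sigma> x = {x}" if "x \<in> U" for x using U(4) that by (simp add: orbit_eq_singleton_iff)
    then have "orb \<sigma> ` U = (\<lambda>x. {x}) ` U" by (intro image_cong) auto
    then show ?thesis unfolding ncycles_def by (simp add: card_image)
  qed
  moreover have "card (V \<union> U) = card V + card U"
    using U(3) by (rule card_Un_disjoint[OF assms(1) U(1)])
  ultimately show ?thesis using U(2) by linarith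
qed

lemma sum_Pow_card:
  assumes "finite U"
  shows "(\<Sum>A\<in>Pow U. f (card A)) = (\<Sum>j\<le>card U. (card U choose j) * (f j :: nat))"
proof -
  have "(\<Sum>A\<in>Pow U. f (card A)) = (\<Sum>j\<le>card U. \<Sum>A\<in>{A\<in>Pow U. card A = j}. f (card A))"
    by (rule sum.group[symmetric]) (use assms in \<open>auto intro: card_mono\<close>)
  also have "\<dots> = (\<Sum>j\<le>card U. (card U choose j) * f j)"
  proof (rule sum.cong[OF refl])
    fix j
    have "(\<Sum>A\<in>{A\<in>Pow U. card A = j}. f (card A)) = card {A. A \<subseteq> U \<and> card A = j} * f j"
      by simp
    then show "(\<Sum>A\<in>{A\<in>Pow U. card A = j}. f (card A)) = (card U choose j) * f j"
      using n_subsets[OF assms] by simp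
  qed
  finally show ?thesis .
qed

lemma stable_comp_tr: "\<sigma> ` V \<subseteq> V \<Longrightarrow> a \<in> V \<Longrightarrow> d \<in> V \<Longrightarrow> (\<sigma> \<circ> tr a d) ` V \<subseteq> V"
  by (auto simp: transpose_in image_subset_iff)

text \<open>The partner of \<open>d\<close> is a background point or a marked one. In the first case
  it is inserted into the cycle of \<open>d\<close> and becomes marked, and all \<open>m\<close>
  choices count the same. In a split the background is distributed as well, which produces the
  binomial coefficients.\<close>

lemma nwalks_bg_Suc:
  assumes p: "permutation \<sigma>" and V: "finite V" "d \<in> V" "\<sigma> ` V \<subseteq> V" and u: "u \<notin> V" "\<sigma> u = u"
  defines "\<rho> \<equiv> \<lambda>a. \<sigma> \<circ> tr a d"
  shows "nwalks_bg V \<sigma> m (Suc r) = m * nwalks_bg (insert u V) (\<rho> u) (m - 1) r + 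
    (\<Sum>a\<in>V - {d}. nwalks_bg V (\<rho> a) m r + (\<Sum>V1 | d \<in> V1 \<and> V1 \<subseteq> V - {a}. \<Sum>r1\<le>r. \<Sum>j\<le>m.
       (m choose j) * (nwalks_bg V1 (\<rho> a) j r1 * nwalks_bg (V - V1) (\<rho> a) (m - j) (r - r1))))"
proof -
  obtain U0 where U0: "finite U0" "card U0 = m - 1" "insert u V \<inter> U0 = {}" "\<forall>u\<in>U0. \<sigma> u = u"
    using ex_background[OF p finite.insertI[OF V(1)], of "m - 1" u] by (elim exE conjE)
  \<comment> \<open>For positive \<open>m\<close> the background is made to contain the given
    \<open>u\<close>, so that marking \<open>u\<close> leaves \<open>U0\<close> with
    \<open>m - 1\<close> points.\<close>
  define U where "U = (if m = 0 then {} else insert u U0)"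
  have U: "finite U" "card U = m" "V \<inter> U = {}" "\<And>x. x \<in> U \<Longrightarrow> \<sigma> x = x" "m \<noteq> 0 \<Longrightarrow> u \<in> U"
    using U0 u by (auto simp: U_def split: if_splits)
  define S where "S = V \<union> U"
  have S: "finite S" "d \<in> S" using U V by (auto simp: S_def)
  have lhs: "nwalks S k \<sigma> = nwalks_bg V \<sigma> m k" for k
  proof -
    have "\<sigma> x \<notin> U" if "x \<in> V" for x using that U(3) V(3) by blast
    then show ?thesis
      unfolding S_def U(2)[symmetric] by (intro nwalks_eq_nwalks_bg[OF V(1) U(1,3,4)])
  qed
  have dU: "d \<notin> U" using U V by auto
  have inj: "\<sigma> x = \<sigma> y \<longleftrightarrow> x = y" for x y
    using permutation_bijective[OF p] by (simp add: bij_def inj_eq)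
  show ?thesis
  proof (cases "S = {d}")
    case True
    then have "V = {d}" "U = {}" using V U dU by (auto simp: S_def)
    then show ?thesis using lhs[of "Suc r", symmetric] True U by (simp add: nwalks_singleton_Suc)
  next
    case False
    let ?sp = "\<lambda>a. \<Sum>S1 | d \<in> S1 \<and> S1 \<subseteq> S - {a}. \<Sum>r1\<le>r. nwalks S1 r1 (\<rho> a) * nwalks (S - S1) (r - r1) (\<rho> a)"
    have "nwalks_bg V \<sigma> m (Suc r) = (\<Sum>a\<in>S - {d}. nwalks S r (\<rho> a) + ?sp a)"
      unfolding lhs[symmetric] nwalks_Suc[OF S False] \<rho>_def ..
    also have "S - {d} = (V - {d}) \<union> U" using dU by (auto simp: S_def)
    also have "(\<Sum>a\<in>(V - {d}) \<union> U. nwalks S r (\<rho> a) + ?sp a) = 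
       (\<Sum>a\<in>U. nwalks S r (\<rho> a) + ?sp a) + (\<Sum>a\<in>V - {d}. nwalks S r (\<rho> a) + ?sp a)"
      using U V by (subst sum.union_disjoint) auto
    also have "(\<Sum>a\<in>U. nwalks S r (\<rho> a) + ?sp a) = m * nwalks_bg (insert u V) (\<rho> u) (m - 1) r"
    proof (cases "m = 0")
      case True
      then show ?thesis using U by simp
    next
      case m: False
      have "?sp a = 0" if a: "a \<in> U" for a
      proof (intro sum.neutral ballI)
        fix S1 r1 assume S1: "S1 \<in> {S1. d \<in> S1 \<and> S1 \<subseteq> S - {a}}"
        \<comment> \<open>The fixed point \<open>a\<close> has just been inserted behind
          \<open>d\<close>, so no set that contains \<open>d\<close> but not \<open>a\<close> is
          stable.\<close>
        have "\<rho> a d = a" using U(4)[OF a] by (simp add: \<rho>_def)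
        then have "\<not> \<rho> a ` S1 \<subseteq> S1" using S1 by blast
        moreover have "finite S1" using S1 S by (auto intro: finite_subset)
        ultimately show "nwalks S1 r1 (\<rho> a) * nwalks (S - S1) (r - r1) (\<rho> a) = 0"
          using nwalks_not_stable by simp
      qed
      \<comment> \<open>Conjugation by the swap of the background points \<open>a\<close> and
        \<open>u\<close> turns \<open>\<rho> a\<close> into \<open>\<rho> u\<close>.\<close>
      moreover have "nwalks S r (\<rho> a) = nwalks S r (\<rho> u)" if a: "a \<in> U" for a
      proof -
        have uU: "u \<in> U" using U m by simp
        have "tr a u ` S = S" using a uU by (intro permutes_image permutes_swap_id) (auto simp: S_def)
        moreover have "\<rho> u (tr a u x) = tr a u (\<rho> a x)" if "x \<in> S" for x
          using U(4)[OF a] U(4)[OF uU] dU a uU inj[of x a] inj[of x u] inj[of d a] inj[of d u]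
          by (auto simp: \<rho>_def Transposition.transpose_def)
        moreover have "\<rho> a ` S \<subseteq> S"
          unfolding \<rho>_def using V U a by (intro stable_comp_tr) (auto simp: S_def)
        moreover have "inj_on (tr a u) S" by (rule inj_on_subset[OF inj_transpose]) simp
        ultimately show ?thesis
          using nwalks_rename[OF S(1), of "tr a u" "\<rho> a" "\<rho> u" r] by simp
      qed
      moreover have "nwalks S r (\<rho> u) = nwalks_bg (insert u V) (\<rho> u) (m - 1) r"
      proof -
        have s: "S = insert u V \<union> U0" using m by (auto simp: S_def U_def)
        have x: "\<rho> u x = x" if "x \<in> U0" for x
        proof -
          have "x \<noteq> u" "x \<noteq> d" using that U0(3) V(2) by auto
          then show ?thesis using bspec[OF U0(4) that] by (simp add: \<rho>_def)
        qed
        have "\<rho> u ` insert u V \<subseteq> insert u V"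
          unfolding \<rho>_def using V u by (intro stable_comp_tr) auto
        then show ?thesis
          unfolding s U0(2)[symmetric] using U0(3) x
          by (intro nwalks_eq_nwalks_bg[OF finite.insertI[OF V(1)] U0(1)]) (blast | simp)+
      qed
      ultimately show ?thesis using U by simp
    qed
    also have "(\<Sum>a\<in>V - {d}. nwalks S r (\<rho> a) + ?sp a) = 
      (\<Sum>a\<in>V - {d}. nwalks_bg V (\<rho> a) m r + (\<Sum>V1 | d \<in> V1 \<and> V1 \<subseteq> V - {a}. \<Sum>r1\<le>r. \<Sum>j\<le>m.
       (m choose j) * (nwalks_bg V1 (\<rho> a) j r1 * nwalks_bg (V - V1) (\<rho> a) (m - j) (r - r1))))"
    proof (rule sum.cong[OF refl])
      fix a assume a: "a \<in> V - {d}"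
      have st: "\<rho> a ` V \<subseteq> V" unfolding \<rho>_def using V a by (intro stable_comp_tr) auto
      have fx: "\<rho> a x = x" if "x \<in> U" for x
      proof -
        have "x \<noteq> a" "x \<noteq> d" using that a U V by auto
        then show ?thesis using U(4)[OF that] by (simp add: \<rho>_def)
      qed
      have mb: "nwalks (V1 \<union> U1) k (\<rho> a) = nwalks_bg V1 (\<rho> a) (card U1) k" if "V1 \<subseteq> V" "U1 \<subseteq> U" for V1 U1 k
      proof (rule nwalks_eq_nwalks_bg)
        show "finite V1" "finite U1" using that V U finite_subset by auto
        show "V1 \<inter> U1 = {}" using that U by auto
        show "\<And>u. u \<in> U1 \<Longrightarrow> \<rho> a u = u" using that fx by auto
        show "\<And>x. x \<in> V1 \<Longrightarrow> \<rho> a x \<notin> U1" using that st U(3) by blast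
      qed
      have "?sp a = (\<Sum>(V1, U1)\<in>{V1. d \<in> V1 \<and> V1 \<subseteq> V - {a}} \<times> Pow U. \<Sum>r1\<le>r. 
        nwalks (V1 \<union> U1) r1 (\<rho> a) * nwalks ((V - V1) \<union> (U - U1)) (r - r1) (\<rho> a))"
      proof (rule sum.reindex_bij_witness[where i = "\<lambda>(V1, U1). V1 \<union> U1" and j = "\<lambda>S1. (S1 \<inter> V, S1 \<inter> U)"])
        fix S1 assume "S1 \<in> {S1. d \<in> S1 \<and> S1 \<subseteq> S - {a}}"
        then have "S1 \<inter> V \<union> S1 \<inter> U = S1" "(V - S1 \<inter> V) \<union> (U - S1 \<inter> U) = S - S1"
          unfolding S_def by blast+
        then show "(case (S1 \<inter> V, S1 \<inter> U) of (V1, U1) \<Rightarrow> \<Sum>r1\<le>r. 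
          nwalks (V1 \<union> U1) r1 (\<rho> a) * nwalks ((V - V1) \<union> (U - U1)) (r - r1) (\<rho> a)) = 
          (\<Sum>r1\<le>r. nwalks S1 r1 (\<rho> a) * nwalks (S - S1) (r - r1) (\<rho> a))" by simp
      qed (use a V U in \<open>auto simp: S_def\<close>)
      also have "\<dots> = (\<Sum>V1 | d \<in> V1 \<and> V1 \<subseteq> V - {a}. \<Sum>U1\<in>Pow U. \<Sum>r1\<le>r. 
        nwalks (V1 \<union> U1) r1 (\<rho> a) * nwalks ((V - V1) \<union> (U - U1)) (r - r1) (\<rho> a))"
        by (rule sum.cartesian_product[symmetric])
      also have "\<dots> = (\<Sum>V1 | d \<in> V1 \<and> V1 \<subseteq> V - {a}. \<Sum>r1\<le>r. \<Sum>U1\<in>Pow U. 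
        nwalks_bg V1 (\<rho> a) (card U1) r1 * nwalks_bg (V - V1) (\<rho> a) (m - card U1) (r - r1))"
      proof (rule sum.cong[OF refl])
        fix V1 assume "V1 \<in> {V1. d \<in> V1 \<and> V1 \<subseteq> V - {a}}"
        then have v: "V1 \<subseteq> V" by auto
        have "(\<Sum>U1\<in>Pow U. \<Sum>r1\<le>r. nwalks (V1 \<union> U1) r1 (\<rho> a) * nwalks ((V - V1) \<union> (U - U1)) (r - r1) (\<rho> a))
          = (\<Sum>U1\<in>Pow U. \<Sum>r1\<le>r. nwalks_bg V1 (\<rho> a) (card U1) r1 * nwalks_bg (V - V1) (\<rho> a) (m - card U1) (r - r1))"
        proof (rule sum.cong[OF refl], rule sum.cong[OF refl])
          fix U1 r1 assume "U1 \<in> Pow U"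
          then have "U1 \<subseteq> U" "card (U - U1) = m - card U1" 
            using U finite_subset[of U1 U] by (auto simp: card_Diff_subset)
          then show "nwalks (V1 \<union> U1) r1 (\<rho> a) * nwalks ((V - V1) \<union> (U - U1)) (r - r1) (\<rho> a) =
            nwalks_bg V1 (\<rho> a) (card U1) r1 * nwalks_bg (V - V1) (\<rho> a) (m - card U1) (r - r1)"
            using mb[OF v, of U1] mb[of "V - V1" "U - U1"] by simp
        qed
        then show "(\<Sum>U1\<in>Pow U. \<Sum>r1\<le>r. nwalks (V1 \<union> U1) r1 (\<rho> a) * nwalks ((V - V1) \<union> (U - U1)) (r - r1) (\<rho> a))
          = (\<Sum>r1\<le>r. \<Sum>U1\<in>Pow U. nwalks_bg V1 (\<rho> a) (card U1) r1 * nwalks_bg (V - V1) (\<rho> a) (m - card U1) (r - r1))"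
          by (subst sum.swap) simp
      qed
      also have "\<dots> = (\<Sum>V1 | d \<in> V1 \<and> V1 \<subseteq> V - {a}. \<Sum>r1\<le>r. \<Sum>j\<le>m.
       (m choose j) * (nwalks_bg V1 (\<rho> a) j r1 * nwalks_bg (V - V1) (\<rho> a) (m - j) (r - r1)))"
        using sum_Pow_card[OF U(1), of "\<lambda>j. nwalks_bg V1 (\<rho> a) j r1 * nwalks_bg (V - V1) (\<rho> a) (m - j) (r - r1)" for V1 r1] U(2)
        by simp
      finally show "nwalks S r (\<rho> a) + ?sp a = nwalks_bg V (\<rho> a) m r + (\<Sum>V1 | d \<in> V1 \<and> V1 \<subseteq> V - {a}. \<Sum>r1\<le>r. \<Sum>j\<le>m.
       (m choose j) * (nwalks_bg V1 (\<rho> a) j r1 * nwalks_bg (V - V1) (\<rho> a) (m - j) (r - r1)))"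
        using mb[of V U r] U by (simp add: S_def)
    qed
    finally show ?thesis .
  qed
qed

text \<open>Exponential normalisation over the \<open>m\<close> unmarked fixed points. With \<open>n\<close> marked cycles on \<open>V\<close>,
  \<open>L\<close> is \<open>2 g - 1 + n\<close>; the truncated subtraction is harmless for nonempty \<open>V\<close>.\<close>

definition gcount :: "nat set \<Rightarrow> (nat \<Rightarrow> nat) \<Rightarrow> nat \<Rightarrow> nat \<Rightarrow> real" where
  "gcount V \<sigma> L m = real (nwalks_bg V \<sigma> m (L + card V + 2 * m - 1)) / fact m"

section \<open>Vanishing and recursion of the normalised counts\<close>

lemma gcount_nonneg: "0 \<le> gcount V \<sigma> L m"
  by (simp add: gcount_def)

lemma gcount_not_stable: "\<not> \<sigma> ` V \<subseteq> V \<Longrightarrow> gcount V \<sigma> L m = 0"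
  by (simp add: gcount_def nwalks_bg_not_stable)

lemma gcount_eq_0:
  assumes "finite V" "V \<noteq> {}" "permutation \<sigma>" "Suc L < ncycles V \<sigma>"
  shows "gcount V \<sigma> L m = 0"
proof (rule ccontr)
  assume "gcount V \<sigma> L m \<noteq> 0"
  then have "nwalks_bg V \<sigma> m (L + card V + 2 * m - 1) \<noteq> 0" by (auto simp: gcount_def)
  from nwalks_bg_nonzero_bound[OF assms(1-3) this] assms(4) card_gt_0_iff[of V] assms(1,2)
  show False by simp
qed

text \<open>Passes from the length \<open>r1\<close> to the parameter \<open>L1\<close>. The lengths
  that are missed violate \<open>nwalks_bg_nonzero_bound\<close> for one of the parts, since a
  nonempty set has at least one cycle.\<close>

lemma sum_genus:
  assumes p: "permutation \<rho>" and V: "finite V1" "finite V2" "V1 \<noteq> {}" "V2 \<noteq> {}" 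
    and r: "r + 2 = L + card V1 + card V2 + 2 * m" and j: "j \<le> m"
  shows "(\<Sum>r1\<le>r. real (nwalks_bg V1 \<rho> j r1) * real (nwalks_bg V2 \<rho> (m - j) (r - r1)))
    = (\<Sum>L1\<le>L. real (nwalks_bg V1 \<rho> j (L1 + card V1 + 2 * j - 1)) * 
         real (nwalks_bg V2 \<rho> (m - j) (L - L1 + card V2 + 2 * (m - j) - 1)))"
proof -
  let ?f = "\<lambda>L1. L1 + card V1 + 2 * j - 1"
  have c: "0 < card V1" "0 < card V2" using V by (auto simp: card_gt_0_iff)
  have z: "real (nwalks_bg V1 \<rho> j r1) * real (nwalks_bg V2 \<rho> (m - j) (r - r1)) = 0" 
    if "r1 \<le> r" "r1 \<notin> ?f ` {..L}" for r1
  proof (rule ccontr)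
    assume "real (nwalks_bg V1 \<rho> j r1) * real (nwalks_bg V2 \<rho> (m - j) (r - r1)) \<noteq> 0"
    then have "card V1 + 2 * j + ncycles V1 \<rho> \<le> r1 + 2" "card V2 + 2 * (m - j) + ncycles V2 \<rho> \<le> r - r1 + 2"
      using nwalks_bg_nonzero_bound[OF V(1,3) p, of j r1] nwalks_bg_nonzero_bound[OF V(2,4) p, of "m - j" "r - r1"] by auto
    moreover have "0 < ncycles V1 \<rho>" "0 < ncycles V2 \<rho>" using ncycles_pos[OF V(1,3)] ncycles_pos[OF V(2,4)] by auto
    ultimately have "r1 = ?f (r1 + 1 - card V1 - 2 * j)" "r1 + 1 - card V1 - 2 * j \<le> L"
      using r j c that by auto
    then show False using that by blast
  qed
  have "(\<Sum>r1\<le>r. real (nwalks_bg V1 \<rho> j r1) * real (nwalks_bg V2 \<rho> (m - j) (r - r1)))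
    = (\<Sum>r1\<in>?f ` {..L}. real (nwalks_bg V1 \<rho> j r1) * real (nwalks_bg V2 \<rho> (m - j) (r - r1)))"
    using r j c z by (intro sum.mono_neutral_right) auto
  also have "\<dots> = (\<Sum>L1\<le>L. real (nwalks_bg V1 \<rho> j (?f L1)) * real (nwalks_bg V2 \<rho> (m - j) (r - ?f L1)))"
    by (subst sum.reindex) (use c in \<open>auto simp: inj_on_def\<close>)
  also have "\<dots> = (\<Sum>L1\<le>L. real (nwalks_bg V1 \<rho> j (L1 + card V1 + 2 * j - 1)) * 
         real (nwalks_bg V2 \<rho> (m - j) (L - L1 + card V2 + 2 * (m - j) - 1)))"
  proof (rule sum.cong[OF refl])
    fix L1 assume "L1 \<in> {..L}"
    then have "r - ?f L1 = L - L1 + card V2 + 2 * (m - j) - 1" using r j c by auto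
    then show "real (nwalks_bg V1 \<rho> j (?f L1)) * real (nwalks_bg V2 \<rho> (m - j) (r - ?f L1)) =
      real (nwalks_bg V1 \<rho> j (L1 + card V1 + 2 * j - 1)) * real (nwalks_bg V2 \<rho> (m - j) (L - L1 + card V2 + 2 * (m - j) - 1))"
      by simp
  qed
  finally show ?thesis .
qed

text \<open>The advantage of \<open>L\<close> over the genus: swallowing a background point keeps
  \<open>L\<close>, a marked partner without a split lowers it by 1, and a split distributes it
  additively. Cuts and joins of marked cycles thus obey one formula. The constant is the empty walk
  on a single point.\<close>

lemma gcount_rec:
  assumes p: "permutation \<sigma>" and V: "finite V" "d \<in> V" "\<sigma> ` V \<subseteq> V" and u: "u \<notin> V" "\<sigma> u = u"
  shows "gcount V \<sigma> L m = of_bool (L = 0 \<and> card V = 1 \<and> m = 0) 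
    + (if m = 0 then 0 else gcount (insert u V) (\<sigma> \<circ> tr u d) L (m - 1)) + 
    (\<Sum>a\<in>V - {d}. (if L = 0 then 0 else gcount V (\<sigma> \<circ> tr a d) (L - 1) m) + 
      (\<Sum>V1 | d \<in> V1 \<and> V1 \<subseteq> V - {a}. \<Sum>L1\<le>L. \<Sum>j\<le>m.
        gcount V1 (\<sigma> \<circ> tr a d) L1 j * gcount (V - V1) (\<sigma> \<circ> tr a d) (L - L1) (m - j)))"
proof -
  define \<rho> where "\<rho> a = \<sigma> \<circ> tr a d" for a
  have p\<rho>: "permutation (\<rho> a)" for a unfolding \<rho>_def by (rule permutation_comp_tr[OF p])
  have c: "0 < card V" using V by (auto simp: card_gt_0_iff)
  show ?thesis
  proof (cases "L + card V + 2 * m - 1")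
    case 0
    then have *: "L = 0" "card V = 1" "m = 0" using c by auto
    then have "V = {d}" using V by (metis card_1_singletonE singletonD)
    then have "nwalks_bg V \<sigma> 0 0 = 1"
      using nwalks_eq_nwalks_bg[of V "{}" \<sigma> 0] V by (simp add: nwalks_0)
    then show ?thesis using * \<open>V = {d}\<close> by (simp add: gcount_def)
  next
    case (Suc r)
    have nb: "\<not> (L = 0 \<and> card V = 1 \<and> m = 0)" using Suc by auto
    have r: "r + 2 = L + card V + 2 * m" using Suc by simp
    have 1: "real (m * nwalks_bg (insert u V) (\<rho> u) (m - 1) r) / fact m = 
       (if m = 0 then 0 else gcount (insert u V) (\<rho> u) L (m - 1))"
    proof (cases m)
      case (Suc k)
      have "r = L + card (insert u V) + 2 * (m - 1) - 1" using r Suc u V by simp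
      then have g: "gcount (insert u V) (\<rho> u) L (m - 1) = real (nwalks_bg (insert u V) (\<rho> u) k r) / fact k"
        using Suc by (simp add: gcount_def)
      have "real (Suc k * x) / fact (Suc k) = real x / fact k" for x
      proof -
        have "real (Suc k * x) / fact (Suc k) = real (Suc k) * real x / (real (Suc k) * fact k)"
          by (simp only: of_nat_mult fact_Suc)
        also have "\<dots> = real x / fact k" by (rule mult_divide_mult_cancel_left) simp
        finally show ?thesis .
      qed
      then show ?thesis using Suc g by simp
    qed simp
    have 2: "real (nwalks_bg V (\<rho> a) m r) / fact m = (if L = 0 then 0 else gcount V (\<rho> a) (L - 1) m)" for a
    proof (cases "L = 0")
      case True
      \<comment> \<open>For \<open>L = 0\<close> the remaining word is one step shorter than a
        single cycle would require.\<close>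
      have "nwalks_bg V (\<rho> a) m r = 0"
      proof (rule ccontr)
        assume "nwalks_bg V (\<rho> a) m r \<noteq> 0"
        then have "card V + 2 * m + ncycles V (\<rho> a) \<le> r + 2"
          using nwalks_bg_nonzero_bound[of V "\<rho> a" m r] V p\<rho> by auto
        moreover have "0 < ncycles V (\<rho> a)" using V by (intro ncycles_pos) auto
        ultimately show False using r True by simp
      qed
      then show ?thesis using True by simp
    next
      case False
      then have "r = L - 1 + card V + 2 * m - 1" using r by simp
      then show ?thesis using False by (simp add: gcount_def)
    qed
    have 3: "real (\<Sum>r1\<le>r. \<Sum>j\<le>m. (m choose j) * (nwalks_bg V1 (\<rho> a) j r1 * nwalks_bg (V - V1) (\<rho> a) (m - j) (r - r1))) / fact m
       = (\<Sum>L1\<le>L. \<Sum>j\<le>m. gcount V1 (\<rho> a) L1 j * gcount (V - V1) (\<rho> a) (L - L1) (m - j))"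
      if a: "a \<in> V - {d}" and V1: "d \<in> V1" "V1 \<subseteq> V - {a}" for a V1
    proof -
      have f: "finite V1" "finite (V - V1)" "V1 \<noteq> {}" "V - V1 \<noteq> {}"
        using a V1 V finite_subset[of V1 V] by auto
      have cv: "card V = card V1 + card (V - V1)"
      proof -
        have "V1 \<union> (V - V1) = V" using V1 by blast
        then show ?thesis using card_Un_disjoint[OF f(1,2)] by simp
      qed
      have "real (\<Sum>r1\<le>r. \<Sum>j\<le>m. (m choose j) * (nwalks_bg V1 (\<rho> a) j r1 * nwalks_bg (V - V1) (\<rho> a) (m - j) (r - r1))) / fact m
        = (\<Sum>j\<le>m. (\<Sum>r1\<le>r. real (nwalks_bg V1 (\<rho> a) j r1) * real (nwalks_bg (V - V1) (\<rho> a) (m - j) (r - r1))) / (fact j * fact (m - j)))"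
        unfolding of_nat_sum
        by (subst sum.swap) (simp add: sum_divide_distrib sum_distrib_left binomial_fact field_simps)
      also have "\<dots> = (\<Sum>j\<le>m. (\<Sum>L1\<le>L. real (nwalks_bg V1 (\<rho> a) j (L1 + card V1 + 2 * j - 1)) * 
         real (nwalks_bg (V - V1) (\<rho> a) (m - j) (L - L1 + card (V - V1) + 2 * (m - j) - 1))) / (fact j * fact (m - j)))"
        using sum_genus[OF p\<rho> f, of r L m] r cv by (intro sum.cong refl) simp
      also have "\<dots> = (\<Sum>j\<le>m. \<Sum>L1\<le>L. gcount V1 (\<rho> a) L1 j * gcount (V - V1) (\<rho> a) (L - L1) (m - j))"
        by (simp add: gcount_def sum_divide_distrib)
      finally show ?thesis by (subst sum.swap)
    qed
    have "gcount V \<sigma> L m = real (nwalks_bg V \<sigma> m (Suc r)) / fact m" unfolding gcount_def Suc ..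
    also have "\<dots> = (if m = 0 then 0 else gcount (insert u V) (\<rho> u) L (m - 1)) + 
      (\<Sum>a\<in>V - {d}. (if L = 0 then 0 else gcount V (\<rho> a) (L - 1) m) + 
      (\<Sum>V1 | d \<in> V1 \<and> V1 \<subseteq> V - {a}. \<Sum>L1\<le>L. \<Sum>j\<le>m. gcount V1 (\<rho> a) L1 j * gcount (V - V1) (\<rho> a) (L - L1) (m - j)))"
      unfolding nwalks_bg_Suc[OF p V u, folded \<rho>_def] of_nat_add add_divide_distrib 1 of_nat_sum[where A = "V - {d}"]
        sum_divide_distrib[where A = "V - {d}"] 2 of_nat_sum[where A = "Collect _"]
        sum_divide_distrib[where A = "Collect _"]
      by (intro arg_cong2[where f = "(+)"] refl sum.cong 3) auto
    finally have *: "gcount V \<sigma> L m = \<dots>" .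
    have "of_bool (L = 0 \<and> card V = 1 \<and> m = 0) = (0::real)" using nb by simp
    then show ?thesis using * unfolding \<rho>_def by (simp only: add_0)
  qed
qed

section \<open>The genus 0 solution\<close>

text \<open>Coefficients of \<open>sqrt (1 - 4 z)\<close>.\<close>

definition sqrt_coeff :: "nat \<Rightarrow> real" where
  "sqrt_coeff n = ((1/2) gchoose n) * (-4) ^ n"

lemma sqrt_coeff_Suc: "sqrt_coeff (Suc n) = sqrt_coeff n * (4 * real n - 2) / (real n + 1)"
proof -
  define x where "x = (1/2 :: real) gchoose n"
  define y where "y = (1/2 :: real) gchoose (Suc n)"
  have "y * (real n + 1) = x * (1/2 - real n)"
    using gbinomial_mult_1[of "1/2 :: real" n] by (simp add: x_def y_def algebra_simps)
  moreover have "sqrt_coeff (Suc n) * (real n + 1) = (y * (real n + 1)) * (- 4) * (-4) ^ n"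
    by (simp add: sqrt_coeff_def y_def)
  ultimately have "sqrt_coeff (Suc n) * (real n + 1) = x * (1/2 - real n) * (- 4) * (-4) ^ n" by simp
  also have "\<dots> = sqrt_coeff n * (4 * real n - 2)"
    unfolding sqrt_coeff_def x_def[symmetric] by (simp add: algebra_simps)
  finally have "sqrt_coeff (Suc n) * (real n + 1) = sqrt_coeff n * (4 * real n - 2)" .
  then show ?thesis by (simp add: eq_divide_eq)
qed

lemma sqrt_coeff_0 [simp]: "sqrt_coeff 0 = 1" by (simp add: sqrt_coeff_def)
lemma sqrt_coeff_1 [simp]: "sqrt_coeff (Suc 0) = -2" by (simp add: sqrt_coeff_Suc)

lemma sqrt_coeff_nonpos: "sqrt_coeff (Suc n) \<le> 0"
proof (induct n)
  case (Suc n)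
  have "sqrt_coeff (Suc n) * (4 * real (Suc n) - 2) \<le> 0"
    using Suc by (intro mult_nonpos_nonneg) auto
  then show ?case unfolding sqrt_coeff_Suc[of "Suc n"] by (intro divide_nonpos_pos) auto
qed simp

lemma sqrt_coeff_conv: "(\<Sum>i\<le>n. sqrt_coeff i * sqrt_coeff (n - i)) = (if n = 0 then 1 else if n = 1 then -4 else 0)"
proof -
  have "(\<Sum>i\<le>n. sqrt_coeff i * sqrt_coeff (n - i)) = (\<Sum>i\<le>n. ((1/2) gchoose i) * ((1/2) gchoose (n - i))) * (-4) ^ n"
    unfolding sum_distrib_right sqrt_coeff_def
    by (intro sum.cong refl) (auto simp: power_add[symmetric])
  also have "(\<Sum>i\<le>n. ((1/2 :: real) gchoose i) * ((1/2) gchoose (n - i))) = 1 gchoose n"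
    using gbinomial_Vandermonde[of "1/2 :: real" "1/2" n] by (simp add: atLeast0AtMost)
  also have "(1 :: real) gchoose n = of_nat (1 choose n)"
    using binomial_gbinomial[of 1 n, where ?'a = real] by simp
  finally show ?thesis by (cases n) (auto simp: binomial_eq_0)
qed

lemma sqrt_coeff_sums: 
  assumes "\<bar>z\<bar> < 1/4" shows "(\<lambda>n. sqrt_coeff n * z ^ n) sums sqrt (1 - 4 * z)"
proof -
  have "\<bar>-4 * z\<bar> < 1" using assms by simp
  from gen_binomial_real[OF this, of "1/2"] show ?thesis
    using assms by (simp add: sqrt_coeff_def power_mult_distrib[symmetric] powr_half_sqrt mult.assoc)
qed

text \<open>The coefficients of the solution of \<open>A = x + (y/x) (A - x A\<^sub>1) + A\<^sup>2\<close> at \<open>y = u (1 - 2 u)\<^sup>2\<close>, for which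
  the discriminant of this quadratic equation has the double root \<open>x = u (1 - 2 u)\<close>.\<close>

definition crit :: "real \<Rightarrow> nat \<Rightarrow> real" where
  "crit u k = (u * sqrt_coeff (Suc k) - (1 - 2 * u) * sqrt_coeff k) / (2 * (1 - 2 * u) ^ (2 * k))"

text \<open>Consecutive values of \<open>sqrt_coeff\<close> grow by a factor below 4, and
  \<open>4 * u \<le> 1 - 2 * u\<close> says exactly that \<open>u \<le> 1/6\<close>.\<close>

lemma crit_nonneg:
  assumes "0 \<le> u" "u \<le> 1/6" shows "0 \<le> crit u (Suc k)"
proof -
  have "u * ((4 * real (Suc k) - 2) / (real (Suc k) + 1)) \<le> u * 4"
    using assms by (intro mult_left_mono) (auto simp: field_simps)
  then have "u * ((4 * real (Suc k) - 2) / (real (Suc k) + 1)) - (1 - 2 * u) \<le> 0"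
    using assms by linarith
  then have "0 \<le> sqrt_coeff (Suc k) * (u * ((4 * real (Suc k) - 2) / (real (Suc k) + 1)) - (1 - 2 * u))"
    using sqrt_coeff_nonpos[of k] by (rule mult_nonpos_nonpos[rotated])
  also have "\<dots> = u * sqrt_coeff (Suc (Suc k)) - (1 - 2 * u) * sqrt_coeff (Suc k)"
    unfolding sqrt_coeff_Suc[of "Suc k"] by (simp add: algebra_simps)
  finally show ?thesis
    unfolding crit_def using assms by (intro divide_nonneg_nonneg) auto
qed

text \<open>This is \<open>A\<^sub>1\<close>, the genus 0 series with one marked fixed point, to
  which \<open>critical_point_radius\<close> will be applied.\<close>

lemma crit_1: "crit u (Suc 0) = (1 - 3 * u) / (1 - 2 * u) ^ 2"
proof -
  have "crit u (Suc 0) = (2 * (1 - 3 * u)) / (2 * (1 - 2 * u) ^ 2)"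
    unfolding crit_def sqrt_coeff_Suc[of "Suc 0"] by simp
  also have "\<dots> = (1 - 3 * u) / (1 - 2 * u) ^ 2" by (rule mult_divide_mult_cancel_left) simp
  finally show ?thesis .
qed

lemma sum_conv_ends:
  "(\<Sum>i\<le>Suc k. f i * f (Suc k - i)) = 2 * f 0 * f (Suc k) + (\<Sum>i=1..k. f i * f (Suc k - i))" for f :: "nat \<Rightarrow> real"
proof -
  have "{..Suc k} = insert 0 (insert (Suc k) {1..k})" by auto
  then show ?thesis by simp
qed

text \<open>The equation for \<open>A\<close> read at \<open>x ^ (k + 1)\<close>. After completing
  the square it says that \<open>(u/z - v)\<^sup>2 (1 - 4 z)\<close> is a Laurent polynomial in
  \<open>z\<close>, with \<open>x = v\<^sup>2 z\<close>.\<close>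

lemma crit_rec:
  assumes "u \<noteq> 1/2"
  shows "crit u (Suc k) = of_bool (k = 0) + u * (1 - 2 * u)\<^sup>2 * crit u (Suc (Suc k)) + (\<Sum>i=1..k. crit u i * crit u (Suc k - i))"
proof -
  define v where "v = 1 - 2 * u"
  have v: "v \<noteq> 0" using assms by (simp add: v_def)
  \<comment> \<open>Apart from the polar term \<open>u / z\<close>, these are the coefficients of
    \<open>(u/z - v) * sqrt (1 - 4 z)\<close>.\<close>
  define b where "b k = u * sqrt_coeff (Suc k) - v * sqrt_coeff k" for k
  have ac_eq: "crit u k = b k / (2 * v ^ (2 * k))" for k by (simp add: crit_def b_def v_def)
  have b0: "b 0 = -1" by (simp add: b_def v_def)
  define n where "n = Suc k"
  have s1: "(\<Sum>i\<le>n. sqrt_coeff (Suc i) * sqrt_coeff (Suc (n - i))) = - 2 * sqrt_coeff (Suc (Suc n))"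
  proof -
    have "(\<Sum>i\<le>Suc (Suc n). sqrt_coeff i * sqrt_coeff (Suc (Suc n) - i)) = 0" by (subst sqrt_coeff_conv) simp
    then have "2 * sqrt_coeff (Suc (Suc n)) + (\<Sum>i=1..Suc n. sqrt_coeff i * sqrt_coeff (Suc (Suc n) - i)) = 0"
      by (subst (asm) sum_conv_ends) simp
    moreover have "(\<Sum>i=1..Suc n. sqrt_coeff i * sqrt_coeff (Suc (Suc n) - i)) = (\<Sum>i\<le>n. sqrt_coeff (Suc i) * sqrt_coeff (Suc (n - i)))"
      by (rule sum.reindex_bij_witness[of _ Suc "\<lambda>i. i - 1"]) (auto simp: Suc_diff_le)
    ultimately show ?thesis by simp
  qed
  have s2: "(\<Sum>i\<le>n. sqrt_coeff (Suc i) * sqrt_coeff (n - i)) = - sqrt_coeff (Suc n)"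
  proof -
    have "(\<Sum>i\<le>Suc n. sqrt_coeff i * sqrt_coeff (Suc n - i)) = 0" by (subst sqrt_coeff_conv) (simp add: n_def)
    then show ?thesis by (subst (asm) sum.atMost_Suc_shift) simp
  qed
  have s3: "(\<Sum>i\<le>n. sqrt_coeff i * sqrt_coeff (Suc (n - i))) = - sqrt_coeff (Suc n)"
    using s2 sum_atMost_swap[of "\<lambda>i j. sqrt_coeff i * sqrt_coeff (Suc j)" n] 
    by (simp add: mult.commute)
  have "(\<Sum>i\<le>n. b i * b (n - i)) = u\<^sup>2 * (\<Sum>i\<le>n. sqrt_coeff (Suc i) * sqrt_coeff (Suc (n - i))) 
     - u * v * (\<Sum>i\<le>n. sqrt_coeff (Suc i) * sqrt_coeff (n - i)) - u * v * (\<Sum>i\<le>n. sqrt_coeff i * sqrt_coeff (Suc (n - i)))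
     + v\<^sup>2 * (\<Sum>i\<le>n. sqrt_coeff i * sqrt_coeff (n - i))"
    unfolding b_def sum_distrib_left sum_subtractf[symmetric] sum.distrib[symmetric]
    by (intro sum.cong refl) (simp add: algebra_simps power2_eq_square)
  also have "\<dots> = - 2 * u * b (Suc n) - 4 * v\<^sup>2 * of_bool (k = 0)"
    unfolding s1 s2 s3 sqrt_coeff_conv by (simp add: n_def b_def algebra_simps power2_eq_square)
  finally have "(\<Sum>i\<le>n. b i * b (n - i)) = - 2 * u * b (Suc n) - 4 * v\<^sup>2 * of_bool (k = 0)" .
  \<comment> \<open>The two end terms, with \<open>b 0 = -1\<close>, are the part linear in
    \<open>A\<close> after completing the square.\<close>
  then have 1: "(\<Sum>i=1..k. b i * b (Suc k - i)) = 2 * b (Suc k) - 2 * u * b (Suc (Suc k)) - 4 * v\<^sup>2 * of_bool (k = 0)"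
    unfolding n_def by (subst (asm) sum_conv_ends) (simp add: b0)
  have "(\<Sum>i=1..k. crit u i * crit u (Suc k - i)) = (\<Sum>i=1..k. b i * b (Suc k - i)) / (4 * v ^ (2 * Suc k))"
    unfolding sum_divide_distrib
  proof (rule sum.cong[OF refl])
    fix i assume "i \<in> {1..k}"
    then have "v ^ (2 * i) * v ^ (2 * (Suc k - i)) = v ^ (2 * Suc k)"
      unfolding power_add[symmetric] by (intro arg_cong[where f = "power v"]) auto
    then show "crit u i * crit u (Suc k - i) = b i * b (Suc k - i) / (4 * v ^ (2 * Suc k))"
      unfolding ac_eq times_divide_times_eq by (simp only: mult_ac)
  qed
  also have "\<dots> = crit u (Suc k) - u * v\<^sup>2 * crit u (Suc (Suc k)) - of_bool (k = 0)"
    unfolding 1 ac_eq using v by (cases "k = 0") (simp_all add: field_simps power2_eq_square power_add)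
  finally show ?thesis unfolding v_def by simp
qed

text \<open>The quadratic formula for \<open>A\<close>, in the variable
  \<open>z = x / (1 - 2 u)\<^sup>2\<close> that moves the branch point to 1/4. The square root of
  the discriminant is \<open>sqrt (1 - 4 z) * (1 - 2 u - u/z)\<close>.\<close>

lemma crit_sums:
  assumes "0 < z" "z < 1/4" "u < 1/2"
  shows "(\<lambda>k. crit u (Suc k) * ((1 - 2 * u)\<^sup>2 * z) ^ Suc k) sums 
    ((1 - sqrt (1 - 4 * z) * ((1 - 2 * u) - u / z) - u / z) / 2)"
proof -
  define v where "v = 1 - 2 * u"
  have v: "v \<noteq> 0" using assms by (simp add: v_def)
  let ?S = "sqrt (1 - 4 * z)"
  have 0: "(\<lambda>n. sqrt_coeff n * z ^ n) sums ?S" using sqrt_coeff_sums assms by simp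
  then have "(\<lambda>n. sqrt_coeff (Suc n) * z ^ Suc n) sums (?S - 1)"
    by (subst sums_Suc_iff) simp
  then have "(\<lambda>n. sqrt_coeff (Suc n) * z ^ Suc n * (u / z)) sums ((?S - 1) * (u / z))"
    by (rule sums_mult2)
  moreover have "(\<lambda>n. v * (sqrt_coeff n * z ^ n)) sums (v * ?S)" using 0 by (rule sums_mult)
  ultimately have "(\<lambda>n. sqrt_coeff (Suc n) * z ^ Suc n * (u / z) - v * (sqrt_coeff n * z ^ n)) sums ((?S - 1) * (u / z) - v * ?S)"
    by (rule sums_diff)
  then have "(\<lambda>n. (u * sqrt_coeff (Suc n) - v * sqrt_coeff n) * z ^ n) sums ((?S - 1) * (u / z) - v * ?S)"
    using assms by (simp add: field_simps)
  then have "(\<lambda>n. (u * sqrt_coeff (Suc (Suc n)) - v * sqrt_coeff (Suc n)) * z ^ Suc n) sums ((?S - 1) * (u / z) - v * ?S + 1)"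
    by (subst sums_Suc_iff) (simp add: v_def)
  then have "(\<lambda>n. (u * sqrt_coeff (Suc (Suc n)) - v * sqrt_coeff (Suc n)) * z ^ Suc n / 2) sums (((?S - 1) * (u / z) - v * ?S + 1) / 2)"
    by (rule sums_divide)
  moreover have "(u * sqrt_coeff (Suc (Suc n)) - v * sqrt_coeff (Suc n)) * z ^ Suc n / 2 = crit u (Suc n) * (v\<^sup>2 * z) ^ Suc n" for n
  proof -
    have "(v\<^sup>2 * z) ^ Suc n = v ^ (2 * Suc n) * z ^ Suc n" by (simp only: power_mult_distrib power_mult)
    moreover have "crit u (Suc n) * v ^ (2 * Suc n) = (u * sqrt_coeff (Suc (Suc n)) - v * sqrt_coeff (Suc n)) / 2"
      unfolding crit_def v_def[symmetric] using v by simp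
    ultimately show ?thesis by (metis (no_types, lifting) mult.assoc mult.commute times_divide_eq_left)
  qed
  ultimately show ?thesis unfolding v_def by (simp add: algebra_simps)
qed

text \<open>At \<open>x = 1/t\<close> beyond the double root the linearised equation is a strict contraction.\<close>

lemma crit_weight:
  assumes u: "0 < u" "u < 1/6" and z: "u / (1 - 2 * u) < z" "z < 1/4"
  defines "t \<equiv> 1 / ((1 - 2 * u)\<^sup>2 * z)"
  shows "\<exists>S\<ge>0. u * (1 - 2 * u)\<^sup>2 * t + 2 * S < 1 \<and> (\<forall>k>0. crit u k \<le> S * t ^ k) \<and>
    (\<forall>n C. 0 \<le> C \<longrightarrow> (\<Sum>i=1..<n. crit u i * (C * t ^ (n - i))) \<le> S * (C * t ^ n))"
proof -
  define v where "v = 1 - 2 * u"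
  have v: "0 < v" using u by (simp add: v_def)
  have z0: "0 < z" using z u v unfolding v_def by (smt (verit) divide_pos_pos)
  define \<theta> where "\<theta> = v\<^sup>2 * z"
  have th: "0 < \<theta>" using v z0 by (simp add: \<theta>_def)
  have t_eq: "t = 1 / \<theta>" by (simp add: t_def \<theta>_def v_def)
  have t: "0 < t" "\<theta> * t = 1" using th unfolding t_eq by simp_all
  define s where "s = sqrt (1 - 4 * z)"
  define S where "S = (1 - s * (v - u / z) - u / z) / 2"
  have acn: "0 \<le> crit u i" if "0 < i" for i
    using crit_nonneg[of u "i - 1"] u that by simp
  \<comment> \<open>\<open>S\<close> is the value of \<open>A\<close> at
    \<open>x = \<theta>\<close>; as the coefficients are nonnegative, it bounds all partial
    sums.\<close>
  have part: "(\<Sum>i=1..<n. crit u i * \<theta> ^ i) \<le> S" for n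
  proof -
    have "(\<Sum>i=1..<n. crit u i * \<theta> ^ i) = (\<Sum>k<n - 1. crit u (Suc k) * \<theta> ^ Suc k)"
      by (rule sum.reindex_bij_witness[of _ Suc "\<lambda>i. i - 1"]) auto
    also have "\<dots> \<le> (\<Sum>k. crit u (Suc k) * \<theta> ^ Suc k)"
      using crit_sums[of z u] z0 z u th unfolding \<theta>_def v_def
      by (intro sum_le_suminf) (auto intro!: mult_nonneg_nonneg acn simp: sums_iff)
    also have "\<dots> = S"
      using crit_sums[of z u] z0 z u unfolding \<theta>_def v_def S_def s_def by (simp add: sums_iff)
    finally show ?thesis .
  qed
  have "0 \<le> S" using part[of 0] by simp
  moreover have "u * (1 - 2 * u)\<^sup>2 * t + 2 * S < 1"
  proof -
    have "u / z < v" using z z0 v unfolding v_def by (simp add: field_simps)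
    then have "0 < s * (v - u / z)" using z by (simp add: s_def)
    moreover have "u * (1 - 2 * u)\<^sup>2 * t = u / z" unfolding t_def using v by (simp add: v_def)
    moreover have "2 * S = 1 - s * (v - u / z) - u / z" by (simp only: S_def) simp
    ultimately show ?thesis by linarith
  qed
  moreover have "crit u k \<le> S * t ^ k" if "0 < k" for k
  proof -
    have "crit u k * \<theta> ^ k \<le> (\<Sum>i=1..<Suc k. crit u i * \<theta> ^ i)"
      using that acn th by (intro member_le_sum) (auto intro!: mult_nonneg_nonneg)
    then have "crit u k * \<theta> ^ k * t ^ k \<le> S * t ^ k"
      using part[of "Suc k"] t by (intro mult_right_mono) auto
    then show ?thesis using t by (simp add: mult.assoc power_mult_distrib[symmetric])
  qed
  moreover have "(\<Sum>i=1..<n. crit u i * (C * t ^ (n - i))) \<le> S * (C * t ^ n)" if "0 \<le> C" for n C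
  proof -
    have "(\<Sum>i=1..<n. crit u i * (C * t ^ (n - i))) = (\<Sum>i=1..<n. crit u i * \<theta> ^ i) * (C * t ^ n)"
      unfolding sum_distrib_right
    proof (rule sum.cong[OF refl])
      fix i assume "i \<in> {1..<n}"
      then have "t ^ n = t ^ i * t ^ (n - i)" by (simp add: power_add[symmetric])
      moreover have "\<theta> ^ i * t ^ i = 1" using t by (simp add: power_mult_distrib[symmetric])
      ultimately show "crit u i * (C * t ^ (n - i)) = crit u i * \<theta> ^ i * (C * t ^ n)"
        by (simp add: mult_ac)
    qed
    then show ?thesis using part[of n] that t by (simp add: mult_right_mono)
  qed
  ultimately show ?thesis by blast
qed

section \<open>Bounds in every genus\<close>

text \<open>A finite truncation, so that no convergence has to be known in advance. For fixed
  \<open>L\<close> the recursion either lowers \<open>N\<close> and adds a point to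
  \<open>V\<close>, or keeps \<open>N\<close> and shrinks \<open>V\<close>; the inductions below
  therefore run over \<open>N\<close> first and over \<open>card V\<close> inside.\<close>

definition gsum :: "real \<Rightarrow> nat \<Rightarrow> nat set \<Rightarrow> (nat \<Rightarrow> nat) \<Rightarrow> nat \<Rightarrow> real" where
  "gsum y N V \<sigma> L = (\<Sum>m\<le>N. gcount V \<sigma> L m * y ^ m)"

lemma gsum_nonneg: "0 \<le> y \<Longrightarrow> 0 \<le> gsum y N V \<sigma> L"
  by (auto simp: gsum_def gcount_nonneg intro!: sum_nonneg)

lemma gsum_not_stable: "\<not> \<sigma> ` V \<subseteq> V \<Longrightarrow> gsum y N V \<sigma> L = 0"
  by (simp add: gsum_def gcount_not_stable)

lemma gsum_eq_0: "finite V \<Longrightarrow> V \<noteq> {} \<Longrightarrow> permutation \<sigma> \<Longrightarrow> Suc L < ncycles V \<sigma> \<Longrightarrow> gsum y N V \<sigma> L = 0"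
  by (simp add: gsum_def gcount_eq_0)

lemma gsum_stable_ncycles:
  assumes "finite V" "V \<noteq> {}" "permutation \<sigma>" "gsum y N V \<sigma> L \<noteq> 0"
  shows "\<sigma> ` V \<subseteq> V \<and> ncycles V \<sigma> \<le> Suc L"
  using assms gsum_not_stable[of \<sigma> V y N L] gsum_eq_0[of V \<sigma> L y N] by linarith

lemma conv_le:
  fixes f g :: "nat \<Rightarrow> real"
  assumes "\<And>i. 0 \<le> f i" "\<And>i. 0 \<le> g i" "0 \<le> (y::real)"
  shows "(\<Sum>m\<le>N. (\<Sum>j\<le>m. f j * g (m - j)) * y ^ m) \<le> (\<Sum>m\<le>N. f m * y ^ m) * (\<Sum>m\<le>N. g m * y ^ m)"
proof -
  have "(\<Sum>m\<le>N. (\<Sum>j\<le>m. f j * g (m - j)) * y ^ m) = (\<Sum>m\<le>N. \<Sum>j\<le>m. (f j * y ^ j) * (g (m - j) * y ^ (m - j)))"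
    unfolding sum_distrib_right
  proof (intro sum.cong refl)
    fix m j :: nat assume "j \<in> {..m}"
    then have "y ^ m = y ^ j * y ^ (m - j)" by (simp add: power_add[symmetric])
    then show "f j * g (m - j) * y ^ m = (f j * y ^ j) * (g (m - j) * y ^ (m - j))" by simp
  qed
  also have "\<dots> = (\<Sum>(j, k)\<in>{(j, k). j + k \<le> N}. (f j * y ^ j) * (g k * y ^ k))"
    unfolding sum.Sigma[OF finite_atMost ballI[OF finite_atMost]]
    by (rule sum.reindex_bij_witness[of _ "\<lambda>(j, k). (j + k, j)" "\<lambda>(m, j). (j, m - j)"]) auto
  also have "\<dots> \<le> (\<Sum>(j, k)\<in>{..N} \<times> {..N}. (f j * y ^ j) * (g k * y ^ k))"
    using assms by (intro sum_mono2) auto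
  also have "\<dots> = (\<Sum>m\<le>N. f m * y ^ m) * (\<Sum>m\<le>N. g m * y ^ m)"
    by (simp add: sum_product sum.cartesian_product)
  finally show ?thesis .
qed

lemma sum_mult_swap:
  "(\<Sum>m\<le>N. (\<Sum>a\<in>A. f a m) * c m) = (\<Sum>a\<in>A. \<Sum>m\<le>(N::nat). f a m * (c m :: real))"
  unfolding sum_distrib_right by (rule sum.swap)

text \<open>Only an inequality: the product of two truncated sums also contains terms of degree
  above \<open>N\<close>, all nonnegative.\<close>

lemma gsum_rec:
  assumes p: "permutation \<sigma>" and V: "finite V" "d \<in> V" "\<sigma> ` V \<subseteq> V" and u: "u \<notin> V" "\<sigma> u = u" and y: "0 \<le> y"
  shows "gsum y N V \<sigma> L \<le> of_bool (L = 0 \<and> card V = 1)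
    + (if N = 0 then 0 else y * gsum y (N - 1) (insert u V) (\<sigma> \<circ> tr u d) L) + 
    ((\<Sum>a\<in>V - {d}. if L = 0 then 0 else gsum y N V (\<sigma> \<circ> tr a d) (L - 1)) + 
     (\<Sum>a\<in>V - {d}. \<Sum>V1 | d \<in> V1 \<and> V1 \<subseteq> V - {a}. \<Sum>L1\<le>L.
        gsum y N V1 (\<sigma> \<circ> tr a d) L1 * gsum y N (V - V1) (\<sigma> \<circ> tr a d) (L - L1)))"
proof -
  define \<rho> where "\<rho> a = \<sigma> \<circ> tr a d" for a
  have 0: "gsum y N V \<sigma> L = (\<Sum>m\<le>N. of_bool (L = 0 \<and> card V = 1 \<and> m = 0) * y ^ m)
     + (\<Sum>m\<le>N. (if m = 0 then 0 else gcount (insert u V) (\<rho> u) L (m - 1)) * y ^ m)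
     + ((\<Sum>m\<le>N. (\<Sum>a\<in>V - {d}. if L = 0 then 0 else gcount V (\<rho> a) (L - 1) m) * y ^ m)
     + (\<Sum>m\<le>N. (\<Sum>a\<in>V - {d}. \<Sum>V1 | d \<in> V1 \<and> V1 \<subseteq> V - {a}. \<Sum>L1\<le>L. \<Sum>j\<le>m.
        gcount V1 (\<rho> a) L1 j * gcount (V - V1) (\<rho> a) (L - L1) (m - j)) * y ^ m))"
    unfolding gsum_def sum.distrib[symmetric] distrib_right[symmetric] add.assoc[symmetric]
    by (intro sum.cong refl arg_cong2[where f = "(*)"])
      (simp only: gcount_rec[OF p V u, of L, folded \<rho>_def] add.assoc sum.distrib)
  have 1: "(\<Sum>m\<le>N. of_bool (L = 0 \<and> card V = 1 \<and> m = 0) * y ^ m) = of_bool (L = 0 \<and> card V = 1)"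
    by (subst sum.atMost_shift) auto
  have 2: "(\<Sum>m\<le>N. (if m = 0 then 0 else gcount (insert u V) (\<rho> u) L (m - 1)) * y ^ m)
    = (if N = 0 then 0 else y * gsum y (N - 1) (insert u V) (\<rho> u) L)"
  proof (cases N)
    case (Suc n)
    show ?thesis unfolding Suc
      by (subst sum.atMost_Suc_shift) (simp add: gsum_def sum_distrib_left mult_ac)
  qed simp
  have 3: "(\<Sum>m\<le>N. (\<Sum>a\<in>V - {d}. if L = 0 then 0 else gcount V (\<rho> a) (L - 1) m) * y ^ m) =
    (\<Sum>a\<in>V - {d}. if L = 0 then 0 else gsum y N V (\<rho> a) (L - 1))"
    unfolding gsum_def sum_mult_swap by (intro sum.cong) auto
  have 4: "(\<Sum>m\<le>N. (\<Sum>a\<in>V - {d}. \<Sum>V1 | d \<in> V1 \<and> V1 \<subseteq> V - {a}. \<Sum>L1\<le>L. \<Sum>j\<le>m.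
        gcount V1 (\<rho> a) L1 j * gcount (V - V1) (\<rho> a) (L - L1) (m - j)) * y ^ m)
     = (\<Sum>a\<in>V - {d}. \<Sum>V1 | d \<in> V1 \<and> V1 \<subseteq> V - {a}. \<Sum>L1\<le>L. 
        \<Sum>m\<le>N. (\<Sum>j\<le>m. gcount V1 (\<rho> a) L1 j * gcount (V - V1) (\<rho> a) (L - L1) (m - j)) * y ^ m)"
    unfolding sum_mult_swap ..
  moreover have "(\<Sum>a\<in>V - {d}. \<Sum>V1 | d \<in> V1 \<and> V1 \<subseteq> V - {a}. \<Sum>L1\<le>L. 
        \<Sum>m\<le>N. (\<Sum>j\<le>m. gcount V1 (\<rho> a) L1 j * gcount (V - V1) (\<rho> a) (L - L1) (m - j)) * y ^ m)
    \<le> (\<Sum>a\<in>V - {d}. \<Sum>V1 | d \<in> V1 \<and> V1 \<subseteq> V - {a}. \<Sum>L1\<le>L.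
        gsum y N V1 (\<rho> a) L1 * gsum y N (V - V1) (\<rho> a) (L - L1))"
    unfolding gsum_def by (intro sum_mono conv_le gcount_nonneg y)
  ultimately show ?thesis using 0 1 2 3 unfolding \<rho>_def[symmetric] by linarith
qed

section \<open>Cutting the cycle of a point\<close>

lemma stable_ncycles_1:
  assumes "permutation \<rho>" "finite V" "\<rho> ` V \<subseteq> V" "ncycles V \<rho> = 1" "d \<in> V"
  shows "V = orb \<rho> d"
proof
  obtain c where "orb \<rho> ` V = {c}" using assms(4) card_1_singletonE unfolding ncycles_def by blast
  then have "orb \<rho> x = orb \<rho> d" if "x \<in> V" for x
    using that assms(5) by (metis image_eqI singletonD)
  then show "V \<subseteq> orb \<rho> d" using permutation_self_in_orbit[OF assms(1)] by auto
  show "orb \<rho> d \<subseteq> V" using assms by (intro orbit_stable)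
qed

lemma sum_orbit:
  fixes f :: "nat \<Rightarrow> real"
  assumes p: "permutation \<sigma>"
  shows "(\<Sum>a\<in>orb \<sigma> d - {d}. f a) = (\<Sum>j=1..<card (orb \<sigma> d). f ((\<sigma> ^^ j) d))"
proof -
  define k where "k = card (orb \<sigma> d)"
  note en = orbit_enum[OF p, of d, folded k_def]
  have "{0..<k} = insert 0 {1..<k}" using en(4) by auto
  then have "orb \<sigma> d = insert d ((\<lambda>i. (\<sigma> ^^ i) d) ` {1..<k})"
    unfolding en(2) by simp
  moreover have "d \<notin> (\<lambda>i. (\<sigma> ^^ i) d) ` {1..<k}"
  proof
    assume "d \<in> (\<lambda>i. (\<sigma> ^^ i) d) ` {1..<k}"
    then obtain i where "(\<sigma> ^^ 0) d = (\<sigma> ^^ i) d" "i \<in> {1..<k}" by auto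
    then show False using inj_onD[OF en(1), of 0 i] by auto
  qed
  ultimately have "orb \<sigma> d - {d} = (\<lambda>i. (\<sigma> ^^ i) d) ` {1..<k}" by auto
  moreover have "inj_on (\<lambda>i. (\<sigma> ^^ i) d) {1..<k}"
    by (rule inj_on_subset[OF en(1)]) auto
  ultimately show ?thesis unfolding k_def[symmetric] by (simp add: sum.reindex)
qed

text \<open>The factor \<open>F\<close> lives on single cycles. This forces \<open>W\<close> to be
  the cycle of \<open>b a\<close>, so each \<open>a\<close> contributes at most one term, and none
  unless \<open>a\<close> lies on the cycle of \<open>d\<close> and the step cuts it. The sum over
  \<open>a\<close> becomes a sum over the positions \<open>j\<close> on that cycle. The points
  \<open>b a\<close> inside \<open>W\<close> and \<open>b' a\<close> outside are \<open>d\<close>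
  and \<open>a\<close> in either order, because \<open>F\<close> may belong to either side of the
  cut.\<close>

lemma cut_terms_le_aux:
  fixes \<alpha> c :: "nat \<Rightarrow> real" and \<sigma> :: "nat \<Rightarrow> nat" and d :: nat
  defines "\<rho> \<equiv> \<lambda>a. \<sigma> \<circ> tr a d" and "k \<equiv> card (orb \<sigma> d)"
  assumes p: "permutation \<sigma>" and V: "finite V" "d \<in> V" "\<sigma> ` V \<subseteq> V"
    and F0: "\<And>a W. W \<subset> V \<Longrightarrow> W \<noteq> {} \<Longrightarrow> a \<in> V - {d} \<Longrightarrow> F W a \<noteq> 0 \<Longrightarrow> \<rho> a ` W \<subseteq> W \<and> ncycles W (\<rho> a) = 1"
    and F: "\<And>a W. W \<subset> V \<Longrightarrow> W \<noteq> {} \<Longrightarrow> a \<in> V - {d} \<Longrightarrow> F W a \<le> \<alpha> (card W)"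
    and H: "\<And>a W. W \<subset> V \<Longrightarrow> W \<noteq> {} \<Longrightarrow> a \<in> V - {d} \<Longrightarrow> H W a \<le> c (card W)"
    and nn: "\<And>a W. 0 \<le> F W a" "\<And>a W. 0 \<le> H W a" "\<And>i. 0 < i \<Longrightarrow> 0 \<le> \<alpha> i" "\<And>i. 0 < i \<Longrightarrow> 0 \<le> c i"
    and pq: "\<And>a. {b a, b' a} = {a, d}"
    and card: "(\<Sum>j=1..<k. \<alpha> (card (orb (\<rho> ((\<sigma> ^^ j) d)) (b ((\<sigma> ^^ j) d)))) * c (card V - card (orb (\<rho> ((\<sigma> ^^ j) d)) (b ((\<sigma> ^^ j) d)))))
      = (\<Sum>j=1..<k. \<alpha> j * c (card V - j))"
  shows "(\<Sum>a\<in>V - {d}. \<Sum>W | b a \<in> W \<and> W \<subseteq> V - {b' a}. F W a * H (V - W) a)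
     \<le> (\<Sum>i=1..<card V. \<alpha> i * c (card V - i))"
proof -
  let ?f = "\<lambda>a. \<Sum>W | b a \<in> W \<and> W \<subseteq> V - {b' a}. F W a * H (V - W) a"
  let ?O = "\<lambda>a. orb (\<rho> a) (b a)"
  have p\<rho>: "permutation (\<rho> a)" for a unfolding \<rho>_def by (rule permutation_comp_tr[OF p])
  have oV: "orb \<sigma> d \<subseteq> V" using V by (intro orbit_stable) auto
  have kV: "k \<le> card V" unfolding k_def using oV V by (intro card_mono) auto
  have inV: "b a \<in> V" "b' a \<in> V" if "a \<in> V" for a using pq[of a] that V(2) by (auto simp: doubleton_eq_iff)
  have fin: "finite {W. b a \<in> W \<and> W \<subseteq> V - {b' a}}" for a
    using V by (auto intro: finite_subset[of _ "Pow V"])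
  have in_O: "b' a \<in> ?O a \<longleftrightarrow> a \<notin> orb \<sigma> d" if "a \<noteq> d" for a
  proof -
    have "b' a \<in> ?O a \<longleftrightarrow> a \<in> orb (\<rho> a) d"
      using pq[of a] orbit_sym[OF p\<rho>[of a], of a d] orbit_sym[OF p\<rho>[of a], of d a]
      by (auto simp: doubleton_eq_iff)
    moreover have "a \<in> orb \<sigma> d \<Longrightarrow> a \<notin> orb (\<rho> a) d"
      unfolding \<rho>_def using orbit_split_ex[OF p] that by blast
    moreover have "a \<notin> orb \<sigma> d \<Longrightarrow> a \<in> orb (\<rho> a) d"
      using orbit_merge(1)[OF p, of a d] permutation_self_in_orbit[OF p, of a] unfolding \<rho>_def by simp
    ultimately show ?thesis by blast
  qed
  have eq: "W = ?O a" if W: "b a \<in> W" "W \<subseteq> V - {b' a}" and a: "a \<in> V - {d}" and nz: "F W a \<noteq> 0" for W a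
  proof -
    have WV: "finite W" "W \<subset> V" "W \<noteq> {}" using W a V inV[of a] finite_subset[of W V] by auto
    have "\<rho> a ` W \<subseteq> W \<and> ncycles W (\<rho> a) = 1" by (rule F0[OF WV(2,3) a nz])
    then show ?thesis using WV(1) W(1) by (intro stable_ncycles_1[OF p\<rho>]) auto
  qed
  have "(\<Sum>a\<in>V - {d}. ?f a) = (\<Sum>a\<in>orb \<sigma> d - {d}. ?f a)"
  proof (rule sum.mono_neutral_right)
    show "\<forall>a\<in>V - {d} - (orb \<sigma> d - {d}). ?f a = 0"
    proof
      fix a assume a: "a \<in> V - {d} - (orb \<sigma> d - {d})"
      then have "b' a \<in> ?O a" using in_O[of a] by auto
      then have "F W a = 0" if "b a \<in> W" "W \<subseteq> V - {b' a}" for W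
        using eq[OF that] a that by auto
      then show "?f a = 0" by (intro sum.neutral) auto
    qed
  qed (use V oV in auto)
  also have "\<dots> \<le> (\<Sum>a\<in>orb \<sigma> d - {d}. \<alpha> (card (?O a)) * c (card V - card (?O a)))"
  proof (rule sum_mono)
    fix a assume a: "a \<in> orb \<sigma> d - {d}"
    then have aV: "a \<in> V - {d}" using oV by auto
    have n: "b' a \<notin> ?O a" using in_O[of a] a by auto
    have s: "?O a \<subseteq> V"
      unfolding \<rho>_def using V aV inV[of a] by (intro orbit_stable stable_comp_tr) auto
    have bO: "b a \<in> ?O a" by (rule permutation_self_in_orbit[OF p\<rho>])
    have fO: "finite (?O a)" using s V finite_subset by blast
    have ps: "?O a \<subset> V" "?O a \<noteq> {}" "V - ?O a \<subset> V" "V - ?O a \<noteq> {}"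
      using n s bO inV[of a] aV by auto
    have O: "?O a \<in> {W. b a \<in> W \<and> W \<subseteq> V - {b' a}}" using n s bO by auto
    have "?f a = (\<Sum>W\<in>{?O a}. F W a * H (V - W) a)"
      using O eq[of a] aV by (intro sum.mono_neutral_right fin) auto
    also have "\<dots> \<le> \<alpha> (card (?O a)) * c (card V - card (?O a))"
    proof -
      have "F (?O a) a \<le> \<alpha> (card (?O a))" by (rule F[OF ps(1,2) aV])
      moreover have "H (V - ?O a) a \<le> c (card (V - ?O a))" by (rule H[OF ps(3,4) aV])
      moreover have "card (V - ?O a) = card V - card (?O a)" using s fO by (intro card_Diff_subset)
      moreover have "0 \<le> \<alpha> (card (?O a))" using bO fO by (intro nn) (auto simp: card_gt_0_iff)
      ultimately show ?thesis using nn by (auto intro!: mult_mono)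
    qed
    finally show "?f a \<le> \<alpha> (card (?O a)) * c (card V - card (?O a))" .
  qed
  also have "\<dots> = (\<Sum>j=1..<k. \<alpha> j * c (card V - j))"
    unfolding sum_orbit[OF p] k_def[symmetric] card ..
  \<comment> \<open>The cycle of \<open>d\<close> may be a proper part of \<open>V\<close>; the
    terms added here are nonnegative and make the bound depend on \<open>card V\<close>
    only.\<close>
  also have "\<dots> \<le> (\<Sum>i=1..<card V. \<alpha> i * c (card V - i))"
    using kV by (intro sum_mono2) (auto intro!: mult_nonneg_nonneg nn)
  finally show ?thesis .
qed

lemma cut_terms_le:
  fixes \<alpha> c :: "nat \<Rightarrow> real"
  assumes p: "permutation \<sigma>" and V: "finite V" "d \<in> V" "\<sigma> ` V \<subseteq> V"
    and F0: "\<And>a W. W \<subset> V \<Longrightarrow> W \<noteq> {} \<Longrightarrow> a \<in> V - {d} \<Longrightarrow> F W a \<noteq> 0 \<Longrightarrow> (\<sigma> \<circ> tr a d) ` W \<subseteq> W \<and> ncycles W (\<sigma> \<circ> tr a d) = 1"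
    and F: "\<And>a W. W \<subset> V \<Longrightarrow> W \<noteq> {} \<Longrightarrow> a \<in> V - {d} \<Longrightarrow> F W a \<le> \<alpha> (card W)"
    and H: "\<And>a W. W \<subset> V \<Longrightarrow> W \<noteq> {} \<Longrightarrow> a \<in> V - {d} \<Longrightarrow> H W a \<le> c (card W)"
    and nn: "\<And>a W. 0 \<le> F W a" "\<And>a W. 0 \<le> H W a" "\<And>i. 0 < i \<Longrightarrow> 0 \<le> \<alpha> i" "\<And>i. 0 < i \<Longrightarrow> 0 \<le> c i"
  shows "(\<Sum>a\<in>V - {d}. \<Sum>V1 | d \<in> V1 \<and> V1 \<subseteq> V - {a}. F V1 a * H (V - V1) a)
     \<le> (\<Sum>i=1..<card V. \<alpha> i * c (card V - i))" (is ?A)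
    and "(\<Sum>a\<in>V - {d}. \<Sum>V1 | d \<in> V1 \<and> V1 \<subseteq> V - {a}. F (V - V1) a * H V1 a)
     \<le> (\<Sum>i=1..<card V. \<alpha> i * c (card V - i))" (is ?B)
proof -
  define k where "k = card (orb \<sigma> d)"
  have ca: "card (orb (\<sigma> \<circ> tr ((\<sigma> ^^ j) d) d) d) = k - j" "card (orb (\<sigma> \<circ> tr ((\<sigma> ^^ j) d) d) ((\<sigma> ^^ j) d)) = j"
    if "j \<in> {1..<k}" for j
    using orbit_split(2,3)[OF p, of j d] that unfolding k_def by auto
  note aux = cut_terms_le_aux[where F = F and H = H and \<alpha> = \<alpha> and c = c and V = V and d = d and \<sigma> = \<sigma>,
      OF p V F0 F H nn, folded k_def]
  show ?A
  proof (rule aux[where b = "\<lambda>a. d" and b' = "\<lambda>a. a"])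
    have "(\<Sum>j=1..<k. \<alpha> (card (orb (\<sigma> \<circ> tr ((\<sigma> ^^ j) d) d) d)) * c (card V - card (orb (\<sigma> \<circ> tr ((\<sigma> ^^ j) d) d) d)))
      = (\<Sum>j=1..<k. \<alpha> (k - j) * c (card V - (k - j)))"
      by (rule sum.cong[OF refl]) (simp only: ca)
    also have "\<dots> = (\<Sum>j=1..<k. \<alpha> j * c (card V - j))"
      by (rule sum.reindex_bij_witness[of _ "\<lambda>j. k - j" "\<lambda>j. k - j"]) auto
    finally show "(\<Sum>j=1..<k. \<alpha> (card (orb (\<sigma> \<circ> tr ((\<sigma> ^^ j) d) d) d)) * c (card V - card (orb (\<sigma> \<circ> tr ((\<sigma> ^^ j) d) d) d)))
      = (\<Sum>j=1..<k. \<alpha> j * c (card V - j))" .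
  qed auto
  have "(\<Sum>V1 | d \<in> V1 \<and> V1 \<subseteq> V - {a}. F (V - V1) a * H V1 a) = (\<Sum>W | a \<in> W \<and> W \<subseteq> V - {d}. F W a * H (V - W) a)"
    if "a \<in> V - {d}" for a
  proof (rule sum.reindex_bij_witness[of _ "\<lambda>W. V - W" "\<lambda>W. V - W"])
    fix W assume "W \<in> {V1. d \<in> V1 \<and> V1 \<subseteq> V - {a}}"
    then have "V - (V - W) = W" by blast
    then show "F (V - W) a * H (V - (V - W)) a = F (V - W) a * H W a" by simp
  qed (use that V(2) in auto)
  then show ?B
    using aux[where b = "\<lambda>a. a" and b' = "\<lambda>a. d"] ca by simp
qed

lemma ex_new:
  assumes "permutation \<sigma>" "finite V"
  obtains u :: nat where "u \<notin> V" "\<sigma> u = u"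
proof -
  obtain U where "finite U" "card U = 1" "V \<inter> U = {}" "\<forall>u\<in>U. \<sigma> u = u"
    using ex_background[OF assms, of 1] by (elim exE conjE)
  then show ?thesis using that by (metis IntI card_1_singletonE empty_iff singletonI)
qed

text \<open>\<open>crit u\<close> satisfies the recursion with equality by \<open>crit_rec\<close>,
  so the bound reproduces itself. For \<open>L = 0\<close> both factors of a split live on single
  cycles.\<close>

lemma gsum_0_bound:
  assumes u: "0 \<le> u" "u \<le> 1/6" 
  defines "y \<equiv> u * (1 - 2 * u)\<^sup>2"
  assumes "permutation \<sigma>" "finite V" "V \<noteq> {}"
  shows "gsum y N V \<sigma> 0 \<le> crit u (card V)"
  using assms(4-)
proof (induct N arbitrary: V \<sigma> rule: less_induct)
  case (less N)
  note IHN = less.hyps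
  have y: "0 \<le> y" using u by (simp add: y_def)
  show ?case using less.prems
  proof (induct "card V" arbitrary: V \<sigma> rule: less_induct)
    case (less V \<sigma>)
    obtain k where k: "card V = Suc k" using less.prems by (cases "card V") auto
    show ?case
    proof (cases "\<sigma> ` V \<subseteq> V")
      case False
      then show ?thesis using crit_nonneg[OF u, of k] by (simp add: k gsum_not_stable)
    next
      case True
      obtain d where d: "d \<in> V" using less.prems by auto
      obtain w where w: "w \<notin> V" "\<sigma> w = w" using ex_new[OF less.prems(1,2)] .
      define \<rho> where "\<rho> a = \<sigma> \<circ> tr a d" for a
      have p\<rho>: "permutation (\<rho> a)" for a unfolding \<rho>_def by (rule permutation_comp_tr[OF less.prems(1)])
      have "(if N = 0 then 0 else y * gsum y (N - 1) (insert w V) (\<rho> w) 0) \<le> y * crit u (Suc (Suc k))"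
      proof (cases "N = 0")
        case False
        have "gsum y (N - 1) (insert w V) (\<rho> w) 0 \<le> crit u (card (insert w V))"
          using False less.prems p\<rho> by (intro IHN) auto
        then show ?thesis using False y w k less.prems by (simp add: mult_left_mono)
      qed (use crit_nonneg[OF u] y in auto)
      moreover have "(\<Sum>a\<in>V - {d}. \<Sum>V1 | d \<in> V1 \<and> V1 \<subseteq> V - {a}. gsum y N V1 (\<rho> a) 0 * gsum y N (V - V1) (\<rho> a) 0)
        \<le> (\<Sum>i=1..<card V. crit u i * crit u (card V - i))"
      proof (rule cut_terms_le(1)[OF less.prems(1,2) d True])
        fix a W assume W: "W \<subset> V" "W \<noteq> {}" "a \<in> V - {d}"
        have fW: "finite W" using W less.prems finite_subset by blast
        show "gsum y N W (\<rho> a) 0 \<le> crit u (card W)"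
          using W p\<rho> fW less.prems by (intro less.hyps psubset_card_mono) auto
        then show "gsum y N W (\<rho> a) 0 \<le> crit u (card W)" .
        assume "gsum y N W (\<rho> a) 0 \<noteq> 0"
        then show "(\<sigma> \<circ> tr a d) ` W \<subseteq> W \<and> ncycles W (\<sigma> \<circ> tr a d) = 1"
          using gsum_stable_ncycles[OF fW W(2) p\<rho>, of y N a 0] ncycles_pos[OF fW W(2), of "\<rho> a"] unfolding \<rho>_def by simp
      next
        show "0 < i \<Longrightarrow> 0 \<le> crit u i" for i using crit_nonneg[OF u, of "i - 1"] by simp
        then show "0 < i \<Longrightarrow> 0 \<le> crit u i" for i .
      qed (use gsum_nonneg[OF y] in auto)
      moreover have "(\<Sum>i=1..<card V. crit u i * crit u (card V - i)) = (\<Sum>i=1..k. crit u i * crit u (Suc k - i))"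
        unfolding k by (intro sum.cong) auto
      moreover have "gsum y N V \<sigma> 0 \<le> of_bool (k = 0) + (if N = 0 then 0 else y * gsum y (N - 1) (insert w V) (\<rho> w) 0)
        + (\<Sum>a\<in>V - {d}. \<Sum>V1 | d \<in> V1 \<and> V1 \<subseteq> V - {a}. gsum y N V1 (\<rho> a) 0 * gsum y N (V - V1) (\<rho> a) 0)"
        using gsum_rec[OF less.prems(1,2) d True w y, of N 0, folded \<rho>_def] by (simp add: k)
      moreover have "crit u (Suc k) = of_bool (k = 0) + y * crit u (Suc (Suc k)) + (\<Sum>i=1..k. crit u i * crit u (Suc k - i))"
        unfolding y_def by (rule crit_rec) (use u in simp)
      ultimately show ?thesis unfolding k by linarith
    qed
  qed
qed

text \<open>Sets preserved by \<open>\<rho>\<close> are unions of cycles.\<close>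

lemma stable_sum_le:
  assumes V: "finite V" and p: "permutation \<rho>" and B: "0 \<le> (B::real)"
    and f: "\<And>W. W \<in> A \<Longrightarrow> W \<subseteq> V \<and> f W \<le> B" and f0: "\<And>W. W \<in> A \<Longrightarrow> f W \<noteq> 0 \<Longrightarrow> \<rho> ` W \<subseteq> W \<and> ncycles V \<rho> \<le> K"
  shows "sum f A \<le> 2 ^ K * B"
proof -
  define A' where "A' = {W\<in>A. f W \<noteq> 0}"
  have A: "finite A" using f V by (auto intro: finite_subset[of A "Pow V"])
  have "sum f A = sum f A'" unfolding A'_def using A by (intro sum.mono_neutral_right) auto
  also have "\<dots> \<le> card A' * B"
    using sum_bounded_above[of A' f B] f by (auto simp: A'_def)
  also have "real (card A') * B \<le> 2 ^ K * B"
  proof (cases "A' = {}")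
    case False
    then have K: "ncycles V \<rho> \<le> K" using f0 by (auto simp: A'_def)
    have eq: "W = {x\<in>V. orb \<rho> x \<in> orb \<rho> ` W}" if "W \<in> A'" for W
    proof
      show "W \<subseteq> {x\<in>V. orb \<rho> x \<in> orb \<rho> ` W}" using that f by (auto simp: A'_def)
      have st: "\<rho> ` W \<subseteq> W" using that f0 by (auto simp: A'_def)
      show "{x\<in>V. orb \<rho> x \<in> orb \<rho> ` W} \<subseteq> W"
      proof
        fix x assume "x \<in> {x\<in>V. orb \<rho> x \<in> orb \<rho> ` W}"
        then obtain w where "w \<in> W" "orb \<rho> x = orb \<rho> w" by auto
        then show "x \<in> W" using orbit_stable[OF st, of w] permutation_self_in_orbit[OF p, of x] by auto
      qed
    qed
    have "inj_on (\<lambda>W. orb \<rho> ` W) A'"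
    proof (rule inj_onI)
      fix W W' assume W: "W \<in> A'" "W' \<in> A'" "orb \<rho> ` W = orb \<rho> ` W'"
      have "W = {x\<in>V. orb \<rho> x \<in> orb \<rho> ` W}" by (rule eq[OF W(1)])
      also have "\<dots> = {x\<in>V. orb \<rho> x \<in> orb \<rho> ` W'}" unfolding W(3) ..
      also have "\<dots> = W'" by (rule eq[OF W(2), symmetric])
      finally show "W = W'" .
    qed
    moreover have "(\<lambda>W. orb \<rho> ` W) ` A' \<subseteq> Pow (orb \<rho> ` V)"
      using f by (auto simp: A'_def)
    ultimately have "card A' \<le> card (Pow (orb \<rho> ` V))"
      using V by (intro card_inj_on_le[of "\<lambda>W. orb \<rho> ` W"]) auto
    also have "\<dots> = 2 ^ ncycles V \<rho>" using V by (simp add: card_Pow ncycles_def)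
    also have "\<dots> \<le> 2 ^ K" using K by (intro power_increasing) auto
    finally have "real (card A') \<le> 2 ^ K" by (metis of_nat_le_iff of_nat_numeral of_nat_power)
    then show ?thesis using B by (rule mult_right_mono)
  qed (use B in simp)
  finally show ?thesis .
qed

text \<open>Trades a polynomial factor for a slightly larger base, by Bernoulli's
  inequality.\<close>

lemma of_nat_times_power_le:
  assumes "0 < t'" "t' < (t::real)"
  shows "real n * t' ^ n \<le> 1 / (t / t' - 1) * t ^ n"
proof -
  define x where "x = t / t' - 1"
  have x: "0 < x" using assms by (simp add: x_def)
  have "1 + real n * x \<le> (1 + x) ^ n" using x by (intro Bernoulli_inequality) auto
  then have "real n * x \<le> (t / t') ^ n" by (simp add: x_def)
  then have "real n \<le> (t / t') ^ n / x" using x by (simp only: pos_le_divide_eq)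
  then have "real n * t' ^ n \<le> (t / t') ^ n / x * t' ^ n" using assms by (intro mult_right_mono) auto
  also have "\<dots> = 1 / x * t ^ n" using assms by (simp add: power_divide)
  finally show ?thesis unfolding x_def .
qed

text \<open>The terms that contain \<open>L\<close> itself contract by
  \<open>y * t + 2 * S < 1\<close>. All others have smaller \<open>L\<close>, but come with up to
  \<open>card V\<close> choices of the partner \<open>a\<close>. They are estimated at a point
  \<open>z'\<close> closer to 1/4, that is with a smaller base \<open>t'\<close>, and the gain
  absorbs this factor. The induction therefore needs the claim for every \<open>z\<close> in the
  gap.\<close>

lemma gsum_bound:
  assumes u: "0 < u" "u < 1/6" 
  defines "v \<equiv> 1 - 2 * u" and "y \<equiv> u * (1 - 2 * u)\<^sup>2"
  shows "u / v < z \<Longrightarrow> z < 1/4 \<Longrightarrow> \<exists>C\<ge>0. \<forall>N V \<sigma>. permutation \<sigma> \<longrightarrow> finite V \<longrightarrow> V \<noteq> {} \<longrightarrow>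
    gsum y N V \<sigma> L \<le> C * (1 / (v\<^sup>2 * z)) ^ card V"
proof (induct L arbitrary: z rule: less_induct)
  case (less L)
  have v: "0 < v" "v \<le> 1" using u by (auto simp: v_def)
  have y: "0 \<le> y" using u by (simp add: y_def)
  have z: "0 < z" using less.prems u v by (smt (verit) divide_pos_pos)
  define t where "t = 1 / (v\<^sup>2 * z)"
  have t: "0 < t" using v z by (simp add: t_def)
  obtain S where S0: "0 \<le> S" and S1: "y * t + 2 * S < 1" and acS: "\<And>k. 0 < k \<Longrightarrow> crit u k \<le> S * t ^ k"
    and conv: "\<And>n C. 0 \<le> C \<Longrightarrow> (\<Sum>i=1..<n. crit u i * (C * t ^ (n - i))) \<le> S * (C * t ^ n)"
    using crit_weight[OF u less.prems[unfolded v_def]] unfolding t_def y_def v_def by blast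
  have acn: "0 \<le> crit u i" if "0 < i" for i
    using crit_nonneg[of u "i - 1"] u that by simp
  have G0: "gsum y N V \<sigma> 0 \<le> crit u (card V)" if "permutation \<sigma>" "finite V" "V \<noteq> {}" for N V \<sigma>
    unfolding y_def using u that by (intro gsum_0_bound) auto
  show ?case
  proof (cases "L = 0")
    case True
    have "gsum y N V \<sigma> 0 \<le> S * t ^ card V" if V: "permutation \<sigma>" "finite V" "V \<noteq> {}" for N V \<sigma>
    proof -
      have "crit u (card V) \<le> S * t ^ card V" using V by (intro acS) (simp add: card_gt_0_iff)
      then show ?thesis using G0[OF V, of N] by simp
    qed
    then show ?thesis unfolding True t_def[symmetric] using S0 by blast
  next
    case False
    define z' where "z' = (z + 1/4) / 2"
    have z': "z < z'" "z' < 1/4" using less.prems by (auto simp: z'_def)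
    define t' where "t' = 1 / (v\<^sup>2 * z')"
    have t': "0 < t'" "t' < t" unfolding t'_def t_def using v z z' by (auto simp: field_simps)
    have "\<exists>C\<ge>0. \<forall>N V \<sigma>. permutation \<sigma> \<longrightarrow> finite V \<longrightarrow> V \<noteq> {} \<longrightarrow> gsum y N V \<sigma> l \<le> C * t' ^ card V" if "l < L" for l
      unfolding t'_def using less.hyps[OF that, of z'] z' less.prems by simp
    then obtain Cf where Cf: "\<And>l. l < L \<Longrightarrow> 0 \<le> Cf l" 
       "\<And>l N V \<sigma>. l < L \<Longrightarrow> permutation \<sigma> \<Longrightarrow> finite V \<Longrightarrow> V \<noteq> {} \<Longrightarrow> gsum y N V \<sigma> l \<le> Cf l * t' ^ card V"
      by metis
    define C' where "C' = sum Cf {..<L}"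
    have C'0: "0 \<le> C'" unfolding C'_def using Cf by (intro sum_nonneg) auto
    have C': "gsum y N V \<sigma> l \<le> C' * t' ^ card V" if "l < L" "permutation \<sigma>" "finite V" "V \<noteq> {}" for l N V \<sigma>
    proof -
      have "Cf l \<le> C'" unfolding C'_def using that Cf by (intro member_le_sum) auto
      then have "Cf l * t' ^ card V \<le> C' * t' ^ card V" using t' by (intro mult_right_mono) auto
      then show ?thesis using Cf(2)[OF that, of N] by simp
    qed
    \<comment> \<open>The total contribution of smaller \<open>L\<close>. A split into parts with
      parameters \<open>L1\<close> and \<open>L - L1\<close> has at most
      \<open>Suc L1 + Suc (L - L1) = L + 2\<close> cycles, so at most \<open>2 ^ (L + 2)\<close>
      sets can occur.\<close>
    define E where "E = (C' + 2 ^ (L + 2) * (real L * C'\<^sup>2)) * (1 / (t / t' - 1))"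
    have E0: "0 \<le> E" unfolding E_def using C'0 t' by (intro mult_nonneg_nonneg add_nonneg_nonneg) auto
    define \<delta> where "\<delta> = 1 - (y * t + 2 * S)"
    have \<delta>: "0 < \<delta>" and phi: "y * t + 2 * S = 1 - \<delta>" using S1 by (simp_all add: \<delta>_def)
    \<comment> \<open>The solution of \<open>C = (y * t + 2 * S) * C + E\<close>.\<close>
    define C where "C = E / \<delta>"
    have C0: "0 \<le> C" using E0 \<delta> by (simp add: C_def)
    have CE: "C * (y * t + 2 * S) + E = C" unfolding phi C_def using \<delta> by (simp add: field_simps)
    have "gsum y N V \<sigma> L \<le> C * t ^ card V" if "permutation \<sigma>" "finite V" "V \<noteq> {}" for N V \<sigma>
      using that
    proof (induct N arbitrary: V \<sigma> rule: less_induct)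
      case (less N)
      note IHN = less.hyps
      show ?case using less.prems
      proof (induct "card V" arbitrary: V \<sigma> rule: less_induct)
        case (less V \<sigma>)
        define n where "n = card V"
        show ?case
        proof (cases "\<sigma> ` V \<subseteq> V")
          case False
          then show ?thesis using C0 t by (simp add: gsum_not_stable)
        next
          case True
          obtain d where d: "d \<in> V" using less.prems by auto
          obtain w where w: "w \<notin> V" "\<sigma> w = w" using ex_new[OF less.prems(1,2)] .
          define \<rho> where "\<rho> a = \<sigma> \<circ> tr a d" for a
          have p\<rho>: "permutation (\<rho> a)" for a unfolding \<rho>_def by (rule permutation_comp_tr[OF less.prems(1)])
          let ?G = "\<lambda>W a l. gsum y N W (\<rho> a) l"
          let ?P = "\<lambda>a. {V1. d \<in> V1 \<and> V1 \<subseteq> V - {a}}"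
          have cV: "card (V - {d}) \<le> n" unfolding n_def using less.prems by (intro card_mono) auto
          have 1: "(if N = 0 then 0 else y * gsum y (N - 1) (insert w V) (\<rho> w) L) \<le> C * (y * t) * t ^ n"
          proof (cases "N = 0")
            case False
            have "gsum y (N - 1) (insert w V) (\<rho> w) L \<le> C * t ^ card (insert w V)"
              using False less.prems p\<rho> by (intro IHN) auto
            then have "y * gsum y (N - 1) (insert w V) (\<rho> w) L \<le> y * (C * t ^ Suc n)"
              using y w less.prems by (intro mult_left_mono) (auto simp: n_def)
            then show ?thesis using False by (simp add: mult_ac)
          qed (use C0 t y in auto)
          have 2: "(\<Sum>a\<in>V - {d}. if L = 0 then 0 else ?G V a (L - 1)) \<le> real n * (C' * t' ^ n)"
          proof -
            have "(\<Sum>a\<in>V - {d}. if L = 0 then 0 else ?G V a (L - 1)) \<le> (\<Sum>a\<in>V - {d}. C' * t' ^ n)"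
              unfolding n_def using False less.prems p\<rho> by (intro sum_mono) (auto intro: C')
            also have "\<dots> = real (card (V - {d})) * (C' * t' ^ n)" by simp
            also have "\<dots> \<le> real n * (C' * t' ^ n)" 
              using cV C'0 t' by (intro mult_right_mono) auto
            finally show ?thesis .
          qed
          have prodbound: "?G V1 a L1 * ?G (V - V1) a (L - L1) \<le> C'\<^sup>2 * t' ^ n" 
            if "V1 \<in> ?P a" "a \<in> V - {d}" "L1 \<in> {1..<L}" for a V1 L1
          proof -
            have f: "finite V1" "V1 \<noteq> {}" "V1 \<subseteq> V" "V - V1 \<noteq> {}" 
              using that less.prems by (auto intro: finite_subset[of _ V])
            have "card V1 + card (V - V1) = n" unfolding n_def
              using f less.prems by (simp add: card_Diff_subset card_mono)
            then have e: "t' ^ n = t' ^ card V1 * t' ^ card (V - V1)" by (simp add: power_add[symmetric])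
            have "?G V1 a L1 * ?G (V - V1) a (L - L1) \<le> (C' * t' ^ card V1) * (C' * t' ^ card (V - V1))"
              using f that less.prems C'0 t' y
              by (intro mult_mono C' p\<rho> gsum_nonneg) auto
            then show ?thesis unfolding e by (simp add: power2_eq_square mult_ac)
          qed
          have 3: "(\<Sum>a\<in>V - {d}. \<Sum>V1\<in>?P a. \<Sum>L1\<in>{1..<L}. ?G V1 a L1 * ?G (V - V1) a (L - L1)) 
             \<le> real n * (2 ^ (L + 2) * (real L * (C'\<^sup>2 * t' ^ n)))"
          proof -
            have "(\<Sum>V1\<in>?P a. \<Sum>L1\<in>{1..<L}. ?G V1 a L1 * ?G (V - V1) a (L - L1)) \<le> 2 ^ (L + 2) * (real L * (C'\<^sup>2 * t' ^ n))"
              if a: "a \<in> V - {d}" for a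
            proof (rule stable_sum_le[OF less.prems(2) p\<rho>])
              show "0 \<le> real L * (C'\<^sup>2 * t' ^ n)" using t' by simp
              fix V1 assume V1: "V1 \<in> ?P a"
              have "(\<Sum>L1\<in>{1..<L}. ?G V1 a L1 * ?G (V - V1) a (L - L1)) \<le> (\<Sum>L1\<in>{1..<L}. C'\<^sup>2 * t' ^ n)"
                using prodbound[OF V1 a] by (intro sum_mono) auto
              also have "\<dots> \<le> real L * (C'\<^sup>2 * t' ^ n)" using t' by (simp add: mult_right_mono)
              finally show "V1 \<subseteq> V \<and> (\<Sum>L1\<in>{1..<L}. ?G V1 a L1 * ?G (V - V1) a (L - L1)) \<le> real L * (C'\<^sup>2 * t' ^ n)"
                using V1 by auto
              assume "(\<Sum>L1\<in>{1..<L}. ?G V1 a L1 * ?G (V - V1) a (L - L1)) \<noteq> 0"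
              then obtain L1 where L1: "L1 \<in> {1..<L}" "?G V1 a L1 * ?G (V - V1) a (L - L1) \<noteq> 0"
                by (rule sum.not_neutral_contains_not_neutral)
              have f: "finite V1" "V1 \<noteq> {}" "finite (V - V1)" "V - V1 \<noteq> {}" 
                using a V1 less.prems by (auto intro: finite_subset[of _ V])
              have s1: "\<rho> a ` V1 \<subseteq> V1 \<and> ncycles V1 (\<rho> a) \<le> Suc L1"
                using L1 by (intro gsum_stable_ncycles[OF f(1,2) p\<rho>, where N = N and y = y]) auto
              have s2: "\<rho> a ` (V - V1) \<subseteq> V - V1 \<and> ncycles (V - V1) (\<rho> a) \<le> Suc (L - L1)"
                using L1 by (intro gsum_stable_ncycles[OF f(3,4) p\<rho>, where N = N and y = y]) auto
              have "V1 \<union> (V - V1) = V" using V1 by auto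
              then have "ncycles V (\<rho> a) = ncycles V1 (\<rho> a) + ncycles (V - V1) (\<rho> a)"
                using ncycles_Un[OF f(1,3), of "\<rho> a"] s1 s2 by auto
              then show "\<rho> a ` V1 \<subseteq> V1 \<and> ncycles V (\<rho> a) \<le> L + 2" using s1 s2 L1(1) by auto
            qed
            then have "(\<Sum>a\<in>V - {d}. \<Sum>V1\<in>?P a. \<Sum>L1\<in>{1..<L}. ?G V1 a L1 * ?G (V - V1) a (L - L1))
               \<le> (\<Sum>a\<in>V - {d}. 2 ^ (L + 2) * (real L * (C'\<^sup>2 * t' ^ n)))"
              by (intro sum_mono) auto
            also have "\<dots> = real (card (V - {d})) * (2 ^ (L + 2) * (real L * (C'\<^sup>2 * t' ^ n)))" by simp
            also have "\<dots> \<le> real n * (2 ^ (L + 2) * (real L * (C'\<^sup>2 * t' ^ n)))"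
              using cV t' by (intro mult_right_mono) auto
            finally show ?thesis .
          qed
          have conv: "(\<Sum>i=1..<card V. crit u i * (C * t ^ (card V - i))) \<le> C * S * t ^ n"
            using conv[OF C0, of "card V"] by (simp add: n_def mult_ac)
          have F0: "(\<sigma> \<circ> tr a d) ` W \<subseteq> W \<and> ncycles W (\<sigma> \<circ> tr a d) = 1" 
            if "W \<subset> V" "W \<noteq> {}" "?G W a 0 \<noteq> 0" for a W
          proof -
            have fW: "finite W" using that less.prems finite_subset by blast
            show ?thesis using gsum_stable_ncycles[OF fW that(2) p\<rho> that(3)] ncycles_pos[OF fW that(2), of "\<rho> a"]
              unfolding \<rho>_def by simp
          qed
          have FW: "?G W a 0 \<le> crit u (card W)" "?G W a L \<le> C * t ^ card W" 
            if "W \<subset> V" "W \<noteq> {}" for a W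
          proof -
            have fW: "finite W" using that less.prems finite_subset by blast
            show "?G W a 0 \<le> crit u (card W)" using that fW p\<rho> by (intro G0)
            show "?G W a L \<le> C * t ^ card W"
              using that fW p\<rho> less.prems by (intro less.hyps psubset_card_mono) auto
          qed
          note split = cut_terms_le[where F = "\<lambda>W a. ?G W a 0" and H = "\<lambda>W a. ?G W a L" and \<alpha> = "crit u" 
             and c = "\<lambda>m. C * t ^ m", OF less.prems(1,2) d True]
          have 4: "(\<Sum>a\<in>V - {d}. \<Sum>V1\<in>?P a. ?G V1 a 0 * ?G (V - V1) a L) \<le> C * S * t ^ n"
            by (rule order_trans[OF split(1) conv]) (use F0 FW gsum_nonneg[OF y] acn C0 t in auto)
          have 5: "(\<Sum>a\<in>V - {d}. \<Sum>V1\<in>?P a. ?G (V - V1) a 0 * ?G V1 a L) \<le> C * S * t ^ n"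
            by (rule order_trans[OF split(2) conv]) (use F0 FW gsum_nonneg[OF y] acn C0 t in auto)
          \<comment> \<open>The two ends \<open>L1 = 0\<close> and \<open>L1 = L\<close> pair genus
            0 on one cycle with \<open>L\<close> on the rest: they are the linear part
            \<open>2 * S\<close>. The inner values involve only smaller parameters.\<close>
          have L: "{..L} = insert 0 (insert L {1..<L})" using False by auto
          have 6: "(\<Sum>a\<in>V - {d}. \<Sum>V1\<in>?P a. \<Sum>L1\<le>L. ?G V1 a L1 * ?G (V - V1) a (L - L1)) = 
            (\<Sum>a\<in>V - {d}. \<Sum>V1\<in>?P a. ?G V1 a 0 * ?G (V - V1) a L) +
            ((\<Sum>a\<in>V - {d}. \<Sum>V1\<in>?P a. ?G (V - V1) a 0 * ?G V1 a L) +
            (\<Sum>a\<in>V - {d}. \<Sum>V1\<in>?P a. \<Sum>L1\<in>{1..<L}. ?G V1 a L1 * ?G (V - V1) a (L - L1)))"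
            unfolding L using False by (simp add: sum.distrib mult.commute)
          have 7: "gsum y N V \<sigma> L \<le> C * (y * t) * t ^ n + (real n * (C' * t' ^ n) +
             (C * S * t ^ n + (C * S * t ^ n + real n * (2 ^ (L + 2) * (real L * (C'\<^sup>2 * t' ^ n))))))"
            using gsum_rec[OF less.prems(1,2) d True w y, of N L, folded \<rho>_def] 1 2 3 4 5 6 False by simp
          have "real n * (C' * t' ^ n) + real n * (2 ^ (L + 2) * (real L * (C'\<^sup>2 * t' ^ n))) = 
            (C' + 2 ^ (L + 2) * (real L * C'\<^sup>2)) * (real n * t' ^ n)"
            by (simp add: algebra_simps)
          also have "\<dots> \<le> (C' + 2 ^ (L + 2) * (real L * C'\<^sup>2)) * (1 / (t / t' - 1) * t ^ n)"
            using C'0 by (intro mult_left_mono of_nat_times_power_le t') auto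
          also have "\<dots> = E * t ^ n" by (simp add: E_def)
          finally have 8: "real n * (C' * t' ^ n) + real n * (2 ^ (L + 2) * (real L * (C'\<^sup>2 * t' ^ n))) \<le> E * t ^ n" .
          have "C * (y * t) * t ^ n + (C * S * t ^ n + C * S * t ^ n) + E * t ^ n = (C * (y * t + 2 * S) + E) * t ^ n"
            by (simp add: algebra_simps)
          also have "\<dots> = C * t ^ n" unfolding CE ..
          finally show ?thesis using 7 8 unfolding n_def by linarith
        qed
      qed
    qed
    then show ?thesis unfolding t_def using C0 by blast
  qed
qed

section \<open>Exactness in genus 0 and the critical point\<close>

lemma orbit_image_subset: "\<rho> ` orb \<rho> d \<subseteq> orb \<rho> d"
  by (auto intro: orbit.step)

text \<open>Among all splits the one along the two new cycles is kept and the others, being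
  nonnegative, are dropped. A lower estimate is enough, as the upper one is
  \<open>gsum_0_bound\<close>.\<close>

lemma gcount_0_lower:
  assumes p: "permutation \<sigma>" and d: "finite (orb \<sigma> d)" and w: "w \<notin> orb \<sigma> d" "\<sigma> w = w"
  defines "V \<equiv> orb \<sigma> d"
  shows "of_bool (card V = 1 \<and> m = 0) + ((if m = 0 then 0 else gcount (insert w V) (\<sigma> \<circ> tr w d) 0 (m - 1)) 
    + (\<Sum>a\<in>V - {d}. \<Sum>j\<le>m. gcount (orb (\<sigma> \<circ> tr a d) d) (\<sigma> \<circ> tr a d) 0 j * gcount (orb (\<sigma> \<circ> tr a d) a) (\<sigma> \<circ> tr a d) 0 (m - j)))
     \<le> gcount V \<sigma> 0 m"
proof -
  define \<rho> where "\<rho> a = \<sigma> \<circ> tr a d" for a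
  have p\<rho>: "permutation (\<rho> a)" for a unfolding \<rho>_def by (rule permutation_comp_tr[OF p])
  have V: "finite V" "d \<in> V" "\<sigma> ` V \<subseteq> V"
    unfolding V_def using d permutation_self_in_orbit[OF p] orbit_image_subset by auto
  have "(\<Sum>j\<le>m. gcount (orb (\<rho> a) d) (\<rho> a) 0 j * gcount (orb (\<rho> a) a) (\<rho> a) 0 (m - j)) \<le>
    (\<Sum>V1 | d \<in> V1 \<and> V1 \<subseteq> V - {a}. \<Sum>j\<le>m. gcount V1 (\<rho> a) 0 j * gcount (V - V1) (\<rho> a) 0 (m - j))" if a: "a \<in> V - {d}" for a
  proof -
    have an: "a \<notin> orb (\<rho> a) d" unfolding \<rho>_def using a orbit_split_ex[OF p] by (auto simp: V_def)
    have u: "V = orb (\<rho> a) a \<union> orb (\<rho> a) d"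
      using orbit_merge(1)[OF p\<rho> an] unfolding \<rho>_def V_def by simp
    have "orb (\<rho> a) a \<inter> orb (\<rho> a) d = {}"
    proof (rule ccontr)
      assume "orb (\<rho> a) a \<inter> orb (\<rho> a) d \<noteq> {}"
      then obtain x where "x \<in> orb (\<rho> a) a" "x \<in> orb (\<rho> a) d" by auto
      then have "a \<in> orb (\<rho> a) d" using orbit_sym[OF p\<rho>, of x a a] orbit_trans[of a "\<rho> a" x d] by simp
      then show False using an by simp
    qed
    then have e: "V - orb (\<rho> a) d = orb (\<rho> a) a" using u by auto
    have "finite {V1. d \<in> V1 \<and> V1 \<subseteq> V - {a}}" using V by (auto intro: finite_subset[of _ "Pow V"])
    then have "(\<Sum>j\<le>m. gcount (orb (\<rho> a) d) (\<rho> a) 0 j * gcount (V - orb (\<rho> a) d) (\<rho> a) 0 (m - j)) \<le>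
      (\<Sum>V1 | d \<in> V1 \<and> V1 \<subseteq> V - {a}. \<Sum>j\<le>m. gcount V1 (\<rho> a) 0 j * gcount (V - V1) (\<rho> a) 0 (m - j))"
      using u an permutation_self_in_orbit[OF p\<rho>, of d]
      by (intro member_le_sum) (auto intro!: sum_nonneg mult_nonneg_nonneg gcount_nonneg)
    then show ?thesis unfolding e .
  qed
  then have "(\<Sum>a\<in>V - {d}. \<Sum>j\<le>m. gcount (orb (\<rho> a) d) (\<rho> a) 0 j * gcount (orb (\<rho> a) a) (\<rho> a) 0 (m - j)) \<le>
    (\<Sum>a\<in>V - {d}. \<Sum>V1 | d \<in> V1 \<and> V1 \<subseteq> V - {a}. \<Sum>j\<le>m. gcount V1 (\<rho> a) 0 j * gcount (V - V1) (\<rho> a) 0 (m - j))"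
    by (intro sum_mono)
  then show ?thesis
    using gcount_rec[OF p V w[folded V_def], of 0 m, folded \<rho>_def] unfolding \<rho>_def[symmetric] by simp
qed

definition gser :: "real \<Rightarrow> nat set \<Rightarrow> (nat \<Rightarrow> nat) \<Rightarrow> real" where
  "gser y V \<sigma> = (\<Sum>m. gcount V \<sigma> 0 m * y ^ m)"

lemma gser_summable:
  assumes u: "0 \<le> u" "u \<le> 1/6" and V: "permutation \<sigma>" "finite V" "V \<noteq> {}"
  shows "summable (\<lambda>m. gcount V \<sigma> 0 m * (u * (1 - 2 * u)\<^sup>2) ^ m)"
    and "gser (u * (1 - 2 * u)\<^sup>2) V \<sigma> \<le> crit u (card V)"
    and "0 \<le> gser (u * (1 - 2 * u)\<^sup>2) V \<sigma>"
proof -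
  let ?y = "u * (1 - 2 * u)\<^sup>2"
  have nn: "0 \<le> gcount V \<sigma> 0 m * ?y ^ m" for m
    using u by (intro mult_nonneg_nonneg gcount_nonneg zero_le_power) auto
  have b: "(\<Sum>m\<le>N. gcount V \<sigma> 0 m * ?y ^ m) \<le> crit u (card V)" for N
    using gsum_0_bound[OF u V, of N] unfolding gsum_def .
  show s: "summable (\<lambda>m. gcount V \<sigma> 0 m * ?y ^ m)"
    by (rule bounded_imp_summable[OF nn b])
  have "(\<Sum>m<n. gcount V \<sigma> 0 m * ?y ^ m) \<le> crit u (card V)" for n
    using b[of n] nn[of n] by (simp add: lessThan_Suc_atMost[symmetric])
  then show "gser ?y V \<sigma> \<le> crit u (card V)"
    unfolding gser_def by (rule suminf_le_const[OF s])
  show "0 \<le> gser ?y V \<sigma>" unfolding gser_def by (rule suminf_nonneg[OF s nn])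
qed

lemma gser_0_lower:
  assumes u: "0 \<le> u" "u \<le> 1/6" and p: "permutation \<sigma>" and w: "w \<notin> orb \<sigma> d" "\<sigma> w = w"
  defines "V \<equiv> orb \<sigma> d" and "y \<equiv> u * (1 - 2 * u)\<^sup>2"
  shows "of_bool (card V = 1) + (y * gser y (insert w V) (\<sigma> \<circ> tr w d) 
    + (\<Sum>a\<in>V - {d}. gser y (orb (\<sigma> \<circ> tr a d) d) (\<sigma> \<circ> tr a d) * gser y (orb (\<sigma> \<circ> tr a d) a) (\<sigma> \<circ> tr a d))) \<le> gser y V \<sigma>"
proof -
  define \<rho> where "\<rho> a = \<sigma> \<circ> tr a d" for a
  have p\<rho>: "permutation (\<rho> a)" for a unfolding \<rho>_def by (rule permutation_comp_tr[OF p])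
  have fo: "finite (orb \<tau> x)" "orb \<tau> x \<noteq> {}" if "permutation \<tau>" for \<tau> x
    using finite_orbit[OF permutation_self_in_orbit[OF that]] orbit_nonempty[of \<tau> x] by auto
  have y: "0 \<le> y" using u by (simp add: y_def)
  note sm = gser_summable(1)[OF u, folded y_def]
  have s1: "(\<lambda>m. of_bool (card V = 1 \<and> m = 0) * y ^ m) sums of_bool (card V = 1)"
  proof -
    have "(\<lambda>m. of_bool (card V = 1 \<and> m = 0) * y ^ m) = (\<lambda>m. if m = 0 then of_bool (card V = 1) else 0)"
      by (auto simp: fun_eq_iff)
    then show ?thesis using sums_single[of 0 "\<lambda>_. of_bool (card V = 1) :: real"] by simp
  qed
  have s2: "(\<lambda>m. (if m = 0 then 0 else gcount (insert w V) (\<rho> w) 0 (m - 1)) * y ^ m) sums (y * gser y (insert w V) (\<rho> w))"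
  proof -
    have "(\<lambda>m. gcount (insert w V) (\<rho> w) 0 m * y ^ m) sums gser y (insert w V) (\<rho> w)"
      unfolding gser_def using fo[OF p] p\<rho> by (intro summable_sums sm) (auto simp: V_def)
    then have "(\<lambda>m. y * (gcount (insert w V) (\<rho> w) 0 m * y ^ m)) sums (y * gser y (insert w V) (\<rho> w))"
      by (rule sums_mult)
    then have "(\<lambda>m. (if Suc m = 0 then 0 else gcount (insert w V) (\<rho> w) 0 (Suc m - 1)) * y ^ Suc m) sums (y * gser y (insert w V) (\<rho> w))"
      by (simp add: mult_ac)
    then show ?thesis by (subst (asm) sums_Suc_iff) simp
  qed
  have s3: "(\<lambda>m. (\<Sum>a\<in>V - {d}. \<Sum>j\<le>m. gcount (orb (\<rho> a) d) (\<rho> a) 0 j * gcount (orb (\<rho> a) a) (\<rho> a) 0 (m - j)) * y ^ m) sums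
     (\<Sum>a\<in>V - {d}. gser y (orb (\<rho> a) d) (\<rho> a) * gser y (orb (\<rho> a) a) (\<rho> a))"
    unfolding sum_distrib_right
  proof (rule sums_sum)
    fix a
    let ?f = "\<lambda>j. gcount (orb (\<rho> a) d) (\<rho> a) 0 j * y ^ j" and ?g = "\<lambda>j. gcount (orb (\<rho> a) a) (\<rho> a) 0 j * y ^ j"
    have "summable (\<lambda>j. norm (?f j))" "summable (\<lambda>j. norm (?g j))"
      using sm[OF p\<rho>[of a] fo[OF p\<rho>[of a], of d]] sm[OF p\<rho>[of a] fo[OF p\<rho>[of a], of a]] y 
      by (simp_all add: abs_mult gcount_nonneg)
    then have "(\<lambda>m. \<Sum>j\<le>m. ?f j * ?g (m - j)) sums (gser y (orb (\<rho> a) d) (\<rho> a) * gser y (orb (\<rho> a) a) (\<rho> a))"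
      unfolding gser_def by (rule Cauchy_product_sums)
    moreover have "?f j * ?g (m - j) = gcount (orb (\<rho> a) d) (\<rho> a) 0 j * gcount (orb (\<rho> a) a) (\<rho> a) 0 (m - j) * y ^ m" if "j \<le> m" for j m
    proof -
      have "y ^ m = y ^ j * y ^ (m - j)" using that by (simp add: power_add[symmetric])
      then show ?thesis by simp
    qed
    ultimately show "(\<lambda>m. \<Sum>j\<le>m. gcount (orb (\<rho> a) d) (\<rho> a) 0 j * gcount (orb (\<rho> a) a) (\<rho> a) 0 (m - j) * y ^ m) sums
      (gser y (orb (\<rho> a) d) (\<rho> a) * gser y (orb (\<rho> a) a) (\<rho> a))" by simp
  qed
  have s4: "(\<lambda>m. gcount V \<sigma> 0 m * y ^ m) sums gser y V \<sigma>"
    unfolding gser_def V_def using fo[OF p] by (intro summable_sums sm p) auto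
  show ?thesis
    unfolding \<rho>_def[symmetric]
  proof (rule sums_le[OF _ sums_add[OF s1 sums_add[OF s2 s3]] s4])
    fix m
    show "of_bool (card V = 1 \<and> m = 0) * y ^ m + ((if m = 0 then 0 else gcount (insert w V) (\<rho> w) 0 (m - 1)) * y ^ m +
      (\<Sum>a\<in>V - {d}. \<Sum>j\<le>m. gcount (orb (\<rho> a) d) (\<rho> a) 0 j * gcount (orb (\<rho> a) a) (\<rho> a) 0 (m - j)) * y ^ m) \<le> gcount V \<sigma> 0 m * y ^ m"
      using mult_right_mono[OF gcount_0_lower[OF p fo(1)[OF p] w, of m, folded \<rho>_def V_def] zero_le_power[OF y, of m]]
      by (simp only: distrib_right)
  qed
qed

text \<open>The defect \<open>crit - gser\<close> satisfies the linearised recursion as an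
  inequality. Starting from the bound \<open>S * t ^ k\<close> on cycles of length \<open>k\<close>,
  uniform over all permutations and points, each application gains the factor
  \<open>\<phi> < 1\<close>, so the defect is not positive.\<close>

lemma gser_exact:
  assumes u: "0 < u" "u < 1/6" and p: "permutation \<sigma>"
  shows "gser (u * (1 - 2 * u)\<^sup>2) (orb \<sigma> d) \<sigma> = crit u (card (orb \<sigma> d))"
proof -
  define v where "v = 1 - 2 * u"
  define y where "y = u * (1 - 2 * u)\<^sup>2"
  have v: "0 < v" using u by (simp add: v_def)
  have y: "0 \<le> y" using u by (simp add: y_def)
  have "u / v < 1 / 4" using u v by (simp add: v_def field_simps)
  then obtain z where z: "u / v < z" "z < 1/4" using dense by blast
  define t where "t = 1 / (v\<^sup>2 * z)"
  have "0 < z" using z u v by (smt (verit) divide_pos_pos)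
  then have t: "0 < t" using v by (simp add: t_def)
  obtain S where S0: "0 \<le> S" and S1: "y * t + 2 * S < 1" and acS: "\<And>k. 0 < k \<Longrightarrow> crit u k \<le> S * t ^ k"
    and convS: "\<And>n C. 0 \<le> C \<Longrightarrow> (\<Sum>i=1..<n. crit u i * (C * t ^ (n - i))) \<le> S * (C * t ^ n)"
    using crit_weight[OF u z[unfolded v_def]] unfolding t_def y_def v_def by blast
  have acn: "0 \<le> crit u i" if "0 < i" for i
    using crit_nonneg[of u "i - 1"] u that by simp
  define \<phi> where "\<phi> = y * t + 2 * S"
  have phi: "0 \<le> \<phi>" "\<phi> < 1" unfolding \<phi>_def using y t S0 S1 by simp_all
  have fo: "finite (orb \<tau> x)" "orb \<tau> x \<noteq> {}" "0 < card (orb \<tau> x)" if "permutation \<tau>" for \<tau> x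
    using finite_orbit[OF permutation_self_in_orbit[OF that]] orbit_nonempty[of \<tau> x] by (auto simp: card_gt_0_iff)
  have le: "gser y V \<tau> \<le> crit u (card V)" if "permutation \<tau>" "finite V" "V \<noteq> {}" for \<tau> V
    unfolding y_def using u that by (intro gser_summable(2)) auto
  have ge: "0 \<le> gser y V \<tau>" if "permutation \<tau>" "finite V" "V \<noteq> {}" for \<tau> V
    unfolding y_def using u that by (intro gser_summable(3)) auto
  have step: "crit u (card (orb \<tau> x)) - gser y (orb \<tau> x) \<tau> \<le> \<phi> * B * t ^ card (orb \<tau> x)"
    if p: "permutation \<tau>" and B: "\<And>\<tau> x. permutation \<tau> \<Longrightarrow> crit u (card (orb \<tau> x)) - gser y (orb \<tau> x) \<tau> \<le> B * t ^ card (orb \<tau> x)"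
      and B0: "0 \<le> B" for \<tau> x B
  proof -
    define V where "V = orb \<tau> x"
    define \<rho> where "\<rho> a = \<tau> \<circ> tr a x" for a
    have p\<rho>: "permutation (\<rho> a)" for a unfolding \<rho>_def by (rule permutation_comp_tr[OF p])
    obtain w where w: "w \<notin> orb \<tau> x" "\<tau> w = w" using ex_new[OF p fo(1)[OF p]] .
    obtain k where k: "card V = Suc k" using fo(3)[OF p, of x] by (cases "card V") (auto simp: V_def)
    \<comment> \<open>Swallowing the fixed point \<open>w\<close> leaves a single cycle through
      \<open>x\<close>, so the assumption on defects applies again.\<close>
    have ow: "orb (\<rho> w) x = insert w V"
      using orbit_merge(1)[OF p w(1)] w(2) orbit_eq_singleton_iff[of \<tau> w] unfolding \<rho>_def V_def by auto
    have cw: "card (insert w V) = Suc (Suc k)" using w k fo[OF p] by (simp add: V_def)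
    let ?D = "\<lambda>a. orb (\<rho> a) x" and ?A = "\<lambda>a. orb (\<rho> a) a"
    have lower: "of_bool (k = 0) + (y * gser y (insert w V) (\<rho> w) + (\<Sum>a\<in>V - {x}. gser y (?D a) (\<rho> a) * gser y (?A a) (\<rho> a))) \<le> gser y V \<tau>"
      using gser_0_lower[OF less_imp_le[OF u(1)] less_imp_le[OF u(2)] p w, folded V_def y_def \<rho>_def]
      unfolding k by (simp only: One_nat_def nat.inject)
    have card: "card (?D ((\<tau> ^^ j) x)) = Suc k - j" "card (?A ((\<tau> ^^ j) x)) = j" if "j \<in> {1..<Suc k}" for j
      using orbit_split(2,3)[OF p, of j x] that k unfolding V_def \<rho>_def by auto
    have sums: "(\<Sum>a\<in>V - {x}. f (card (?D a)) (card (?A a))) = (\<Sum>j=1..k. f (Suc k - j) j)" for f :: "nat \<Rightarrow> nat \<Rightarrow> real"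
    proof -
      have "(\<Sum>a\<in>V - {x}. f (card (?D a)) (card (?A a))) = (\<Sum>j=1..<Suc k. f (card (?D ((\<tau> ^^ j) x))) (card (?A ((\<tau> ^^ j) x))))"
        using sum_orbit[OF p, where d = x and f = "\<lambda>a. f (card (?D a)) (card (?A a))"] unfolding V_def[symmetric] k .
      also have "\<dots> = (\<Sum>j=1..<Suc k. f (Suc k - j) j)" by (intro sum.cong refl) (simp add: card)
      finally show ?thesis by (simp add: atLeastLessThanSuc_atLeastAtMost)
    qed
    have up: "crit u (Suc k) = of_bool (k = 0) + y * crit u (Suc (Suc k)) + (\<Sum>j=1..k. crit u (Suc k - j) * crit u j)"
      using crit_rec[of u k] u unfolding y_def by (simp add: mult.commute)
    have d1: "crit u (Suc (Suc k)) - gser y (insert w V) (\<rho> w) \<le> B * t ^ Suc (Suc k)"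
      using B[OF p\<rho>, of w x] unfolding ow cw .
    have d2: "crit u (card (?D a)) * crit u (card (?A a)) - gser y (?D a) (\<rho> a) * gser y (?A a) (\<rho> a)
      \<le> crit u (card (?D a)) * (B * t ^ card (?A a)) + crit u (card (?A a)) * (B * t ^ card (?D a))" for a
    proof -
      note o = fo[OF p\<rho>[of a], of x] fo[OF p\<rho>[of a], of a]
      \<comment> \<open>The difference of products is telescoped so that each term is a defect times
        a quantity bounded by \<open>crit\<close>.\<close>
      have "crit u (card (?D a)) * crit u (card (?A a)) - gser y (?D a) (\<rho> a) * gser y (?A a) (\<rho> a)
        = crit u (card (?D a)) * (crit u (card (?A a)) - gser y (?A a) (\<rho> a)) + gser y (?A a) (\<rho> a) * (crit u (card (?D a)) - gser y (?D a) (\<rho> a))"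
        by (simp add: algebra_simps)
      also have "\<dots> \<le> crit u (card (?D a)) * (B * t ^ card (?A a)) + crit u (card (?A a)) * (B * t ^ card (?D a))"
        by (intro add_mono mult_mono B[OF p\<rho>] le ge acn p\<rho> o order_refl) (use le[OF p\<rho>[of a] o(1,2)] le[OF p\<rho>[of a] o(4,5)] in simp_all)
      finally show ?thesis .
    qed
    have conv: "(\<Sum>j=1..k. crit u (Suc k - j) * (B * t ^ j)) = (\<Sum>j=1..k. crit u j * (B * t ^ (Suc k - j)))"
      by (rule sum.reindex_bij_witness[of _ "\<lambda>j. Suc k - j" "\<lambda>j. Suc k - j"]) auto
    have conv2: "(\<Sum>j=1..k. crit u j * (B * t ^ (Suc k - j))) \<le> S * (B * t ^ Suc k)"
      using convS[OF B0, of "Suc k"] by (simp only: atLeastLessThanSuc_atLeastAtMost)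
    have "crit u (card V) - gser y V \<tau> \<le> y * (crit u (Suc (Suc k)) - gser y (insert w V) (\<rho> w)) + 
      (\<Sum>a\<in>V - {x}. crit u (card (?D a)) * crit u (card (?A a)) - gser y (?D a) (\<rho> a) * gser y (?A a) (\<rho> a))"
      using lower up sums[of "\<lambda>i j. crit u i * crit u j"] unfolding k sum_subtractf
      by (simp add: algebra_simps)
    also have "\<dots> \<le> y * (B * t ^ Suc (Suc k)) + 
      (\<Sum>a\<in>V - {x}. crit u (card (?D a)) * (B * t ^ card (?A a)) + crit u (card (?A a)) * (B * t ^ card (?D a)))"
      by (intro add_mono mult_left_mono d1 y sum_mono d2)
    also have "\<dots> = y * (B * t ^ Suc (Suc k)) + (\<Sum>j=1..k. crit u (Suc k - j) * (B * t ^ j) + crit u j * (B * t ^ (Suc k - j)))"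
      using sums[of "\<lambda>i j. crit u i * (B * t ^ j) + crit u j * (B * t ^ i)"] by simp
    also have "\<dots> \<le> y * (B * t ^ Suc (Suc k)) + (S * (B * t ^ Suc k) + S * (B * t ^ Suc k))"
      unfolding sum.distrib conv by (intro add_left_mono add_mono conv2)
    also have "\<dots> = \<phi> * B * t ^ card V"
      unfolding \<phi>_def k by (simp add: algebra_simps)
    finally show ?thesis unfolding V_def .
  qed
  have iter: "permutation \<tau> \<Longrightarrow> crit u (card (orb \<tau> x)) - gser y (orb \<tau> x) \<tau> \<le> \<phi> ^ n * S * t ^ card (orb \<tau> x)" for \<tau> x n
  proof (induct n arbitrary: \<tau> x)
    case 0
    have "crit u (card (orb \<tau> x)) \<le> S * t ^ card (orb \<tau> x)" by (rule acS[OF fo(3)[OF 0]])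
    then show ?case using ge[OF 0 fo(1,2)[OF 0], of x] by simp
  next
    case (Suc n)
    then show ?case using step[of \<tau> "\<phi> ^ n * S" x] S0 phi by (simp add: mult_ac)
  qed
  have "(\<lambda>n. \<phi> ^ n * S * t ^ card (orb \<sigma> d)) \<longlonglongrightarrow> 0 * S * t ^ card (orb \<sigma> d)"
    using phi by (intro tendsto_intros LIMSEQ_realpow_zero)
  then have "crit u (card (orb \<sigma> d)) - gser y (orb \<sigma> d) \<sigma> \<le> 0"
    using iter[OF p, of d] by (intro LIMSEQ_le_const[of _ 0]) auto
  then show ?thesis using le[OF p fo(1,2)[OF p], of d] unfolding y_def by simp
qed

text \<open>With \<open>y = u (1 - 2 u)\<^sup>2\<close> and \<open>f\<close> the power series, \<open>f' (y) = 1 / (1 - 2 u)^4\<close>. As \<open>dy/du\<close> vanishes at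
  \<open>u = 1/6\<close>, the second derivative cannot stay bounded at \<open>y = 2/27\<close>.\<close>

lemma critical_point_radius:
  fixes a :: "nat \<Rightarrow> real"
  assumes S: "\<And>u. 0 < u \<Longrightarrow> u < 1/6 \<Longrightarrow> (\<Sum>m. a m * (u * (1 - 2 * u)\<^sup>2) ^ m) = (1 - 3 * u) / (1 - 2 * u)\<^sup>2"
  shows "conv_radius a \<le> ereal (2/27)"
proof (rule ccontr)
  assume "\<not> conv_radius a \<le> ereal (2/27)"
  then have R: "ereal (2/27) < fps_conv_radius (Abs_fps a)"
    by (simp add: fps_conv_radius_def)
  define y where "y u = u * (1 - 2 * u)\<^sup>2" for u :: real
  define F0 F1 F2 where "F0 = Abs_fps a" and "F1 = fps_deriv F0" and "F2 = fps_deriv F1"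
  have rad: "ereal (2/27) < fps_conv_radius F0" "ereal (2/27) < fps_conv_radius F1" "ereal (2/27) < fps_conv_radius F2"
    using R fps_conv_radius_deriv[of F0] fps_conv_radius_deriv[of F1] unfolding F0_def F1_def F2_def
    by (meson less_le_trans)+
  have dy: "(y has_field_derivative ((1 - 2 * u) * (1 - 6 * u))) (at u)" for u
    unfolding y_def by (auto intro!: derivative_eq_intros simp: power2_eq_square algebra_simps)
  have y_le: "norm (y u) \<le> 2/27" if "0 < u" "u \<le> 1/6" for u
  proof -
    \<comment> \<open>The double zero shows that \<open>y\<close> has its maximum 2/27 at
      \<open>u = 1/6\<close>; all arguments stay inside the assumed disc of convergence.\<close>
    have "2/27 - y u = 4 * (u - 1/6)\<^sup>2 * (2/3 - u)"
      by (simp add: y_def power2_eq_square field_simps)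
    moreover have "0 \<le> 4 * (u - 1/6)\<^sup>2 * (2/3 - u)" using that by simp
    moreover have "0 \<le> y u" using that by (simp add: y_def)
    ultimately show ?thesis unfolding real_norm_def by linarith
  qed
  have y_rad: "ereal (norm (y u)) < fps_conv_radius F" if "0 < u" "u \<le> 1/6" "ereal (2/27) < fps_conv_radius F" for u F
    using y_le[OF that(1,2)] that(3) by (meson ereal_less_eq(3) le_less_trans)
  have dF: "((\<lambda>u. eval_fps F (y u)) has_field_derivative (eval_fps (fps_deriv F) (y u) * ((1 - 2 * u) * (1 - 6 * u)))) (at u)"
    if "0 < u" "u \<le> 1/6" "ereal (2/27) < fps_conv_radius F" for u F
    by (rule DERIV_chain2[OF has_field_derivative_eval_fps[OF y_rad[OF that]] dy])
  have op: "open {0<..<1/6::real}" by simp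
  have E0: "eval_fps F0 (y u) = (1 - 3 * u) / (1 - 2 * u)\<^sup>2" if "u \<in> {0<..<1/6}" for u
    using S[of u] that by (simp add: eval_fps_def F0_def y_def)
  have E1: "eval_fps F1 (y u) = 1 / (1 - 2 * u) ^ 4" if u: "u \<in> {0<..<1/6}" for u
  proof -
    have v: "1 - 2 * u \<noteq> 0" "1 - 6 * u \<noteq> 0" using u by auto
    have "((\<lambda>u. eval_fps F0 (y u)) has_field_derivative (eval_fps F1 (y u) * ((1 - 2 * u) * (1 - 6 * u)))) (at u)"
      unfolding F1_def using u rad by (intro dF) auto
    then have "((\<lambda>u. (1 - 3 * u) / (1 - 2 * u)\<^sup>2) has_field_derivative (eval_fps F1 (y u) * ((1 - 2 * u) * (1 - 6 * u)))) (at u)"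
      by (rule has_field_derivative_transform_within_open[OF _ op u]) (use E0 in auto)
    moreover have "((\<lambda>u. (1 - 3 * u) / (1 - 2 * u)\<^sup>2) has_field_derivative ((1 - 6 * u) / (1 - 2 * u) ^ 3)) (at u)"
      using v by (auto intro!: derivative_eq_intros simp: divide_simps power2_eq_square power3_eq_cube) (simp add: algebra_simps)
    ultimately have "eval_fps F1 (y u) * ((1 - 2 * u) * (1 - 6 * u)) = (1 - 6 * u) / (1 - 2 * u) ^ 3"
      by (rule DERIV_unique)
    then show ?thesis using v by (simp add: divide_simps power4_eq_xxxx power3_eq_cube mult_ac)
  qed
  have E2: "eval_fps F2 (y u) * ((1 - 2 * u) * (1 - 6 * u)) = 8 / (1 - 2 * u) ^ 5" if u: "u \<in> {0<..<1/6}" for u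
  proof -
    have v: "1 - 2 * u \<noteq> 0" using u by auto
    have "((\<lambda>u. eval_fps F1 (y u)) has_field_derivative (eval_fps F2 (y u) * ((1 - 2 * u) * (1 - 6 * u)))) (at u)"
      unfolding F2_def using u rad by (intro dF) auto
    then have "((\<lambda>u. 1 / (1 - 2 * u) ^ 4) has_field_derivative (eval_fps F2 (y u) * ((1 - 2 * u) * (1 - 6 * u)))) (at u)"
      by (rule has_field_derivative_transform_within_open[OF _ op u]) (use E1 in auto)
    moreover have "((\<lambda>u. 1 / (1 - 2 * u) ^ 4) has_field_derivative (8 / (1 - 2 * u) ^ 5)) (at u)"
    proof -
      define w where "w = 1 - 2 * u"
      have "w ^ 3 * (8 * w ^ 5) = 8 * (w ^ 4 * w ^ 4)" by (simp add: power_add[symmetric])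
      then show ?thesis using v 
        by (auto intro!: derivative_eq_intros simp: divide_simps w_def[symmetric])
    qed
    ultimately show ?thesis by (rule DERIV_unique)
  qed
  \<comment> \<open>At \<open>u = 1/6\<close> the factor \<open>1 - 6 * u\<close> forces the
    left-hand side of \<open>E2\<close> to 0, as its other factors are continuous there, whereas the
    right-hand side tends to \<open>8 / (2/3) ^ 5\<close>.\<close>
  have "isCont (\<lambda>u. eval_fps F2 (y u)) (1/6)"
    by (rule DERIV_isCont[OF dF]) (use rad in auto)
  then have "isCont (\<lambda>u. eval_fps F2 (y u) * ((1 - 2 * u) * (1 - 6 * u))) (1/6)"
    by (intro continuous_intros)
  then have "((\<lambda>u. eval_fps F2 (y u) * ((1 - 2 * u) * (1 - 6 * u))) \<longlongrightarrow> 0) (at (1/6))"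
    by (simp add: isCont_def)
  then have "((\<lambda>u. eval_fps F2 (y u) * ((1 - 2 * u) * (1 - 6 * u))) \<longlongrightarrow> 0) (at_left (1/6))"
    by (rule tendsto_mono[OF at_le, rotated]) simp
  moreover have "\<forall>\<^sub>F u in at_left (1/6::real). eval_fps F2 (y u) * ((1 - 2 * u) * (1 - 6 * u)) = 8 / (1 - 2 * u) ^ 5"
    using eventually_at_left_real[of 0 "1/6::real"] by (rule eventually_mono) (auto intro: E2)
  ultimately have "((\<lambda>u. 8 / (1 - 2 * u) ^ 5) \<longlongrightarrow> 0) (at_left (1/6::real))"
    by (rule Lim_transform_eventually)
  moreover have "((\<lambda>u. 8 / (1 - 2 * u) ^ 5) \<longlongrightarrow> 8 / (1 - 2 * (1/6)) ^ 5) (at_left (1/6::real))"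
    by (intro tendsto_intros) auto
  ultimately have "8 / (1 - 2 * (1/6)) ^ 5 = (0::real)"
    using tendsto_unique[OF trivial_limit_at_left_real] by blast
  then show False by simp
qed

lemma genus_0_radius: "conv_radius (gcount {d} id 0) \<le> ereal (2/27)"
proof (rule critical_point_radius)
  fix u :: real assume u: "0 < u" "u < 1/6"
  have o: "orb id d = {d}" by (simp add: orbit_eq_singleton_iff)
  show "(\<Sum>m. gcount {d} id 0 m * (u * (1 - 2 * u)\<^sup>2) ^ m) = (1 - 3 * u) / (1 - 2 * u)\<^sup>2"
    using gser_exact[OF u, of id d] by (simp add: o gser_def crit_1)
qed

section \<open>Factorisations of the identity\<close>

text \<open>Elementary symmetric polynomials, with the colours in decreasing (\<open>esym\<close>) and in increasing
  (\<open>esym_rev\<close>) order.\<close>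

fun esym :: "nat list \<Rightarrow> nat \<Rightarrow> (state \<Rightarrow> nat) \<Rightarrow> state \<Rightarrow> nat" where
  "esym [] 0 f = f"
| "esym [] (Suc r) f = (\<lambda>s. 0)"
| "esym (x # xs) 0 f = f"
| "esym (x # xs) (Suc r) f = (\<lambda>s. esym xs (Suc r) f s + jm x (set xs) (esym xs r f) s)"

fun esym_rev :: "nat list \<Rightarrow> nat \<Rightarrow> (state \<Rightarrow> nat) \<Rightarrow> state \<Rightarrow> nat" where
  "esym_rev [] 0 f = f"
| "esym_rev [] (Suc r) f = (\<lambda>s. 0)"
| "esym_rev (x # xs) 0 f = f"
| "esym_rev (x # xs) (Suc r) f = (\<lambda>s. esym_rev xs (Suc r) f s + esym_rev xs r (jm x (set xs) f) s)"

lemma esym_0 [simp]: "esym xs 0 f = f" by (cases xs) auto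
lemma esym_rev_0 [simp]: "esym_rev xs 0 f = f" by (cases xs) auto

lemma esym_rev_plus: "esym_rev xs r (\<lambda>s. f s + g s) = (\<lambda>s. esym_rev xs r f s + esym_rev xs r g s)"
proof (induct xs arbitrary: r f g)
  case Nil
  then show ?case by (cases r) auto
next
  case (Cons x xs)
  then show ?case by (cases r) (auto simp: jm_plus)
qed

lemma jm_esym_rev_commute:
  "x \<notin> A \<Longrightarrow> distinct xs \<Longrightarrow> set xs \<subseteq> A \<Longrightarrow> jm x A (esym_rev xs r f) = esym_rev xs r (jm x A f)"
proof (induct xs arbitrary: r f)
  case Nil
  then show ?case by (cases r) auto
next
  case (Cons z xs)
  show ?case
  proof (cases r)
    case (Suc q)
    have "jm x A (esym_rev xs q (jm z (set xs) f)) = esym_rev xs q (jm x A (jm z (set xs) f))"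
      using Cons by auto
    also have "jm x A (jm z (set xs) f) = jm z (set xs) (jm x A f)"
      using Cons.prems by (intro jm_commute) auto
    finally show ?thesis using Cons Suc by (simp add: jm_plus)
  qed simp
qed

text \<open>The one-variable case is \<open>(1 + x) / (1 - x) \<le> 2 / (1 - x)\<close> coefficientwise.\<close>

lemma esym_rev_hsym_le:
  "distinct xs \<Longrightarrow> (\<Sum>a\<le>R. esym_rev xs a (hsym xs (R - a) f) s) \<le> 2 ^ length xs * hsym xs R f s"
proof (induct xs arbitrary: R s)
  case Nil
  then show ?case by (cases R) (auto simp: sum.atMost_shift intro!: sum.neutral)
next
  case (Cons x xs)
  define h where "h r = hsym (x # xs) r f" for r
  define h' where "h' r = hsym xs r f" for r
  define t where "t g = jm x (set xs) g" for g
  \<comment> \<open>\<open>Z\<close> omits the colour \<open>x\<close> from both factors,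
    \<open>Y\<close> only from the elementary one.\<close>
  define Z where "Z r s = (\<Sum>a\<le>r. esym_rev xs a (h' (r - a)) s)" for r s
  define Y where "Y r s = (\<Sum>a\<le>r. esym_rev xs a (h (r - a)) s)" for r s
  have Z: "Z r s \<le> 2 ^ length xs * h' r s" for r s
    using Cons unfolding Z_def h'_def by simp
  have h0: "h 0 = h' 0" by (simp add: h_def h'_def)
  have h_Suc: "h (Suc r) = (\<lambda>s. h' (Suc r) s + t (h r) s)" for r by (simp add: h_def h'_def t_def)
  have YS: "Y (Suc r) s = Z (Suc r) s + t (Y r) s" for r s
  proof -
    have c: "esym_rev xs a (t (h k)) = t (esym_rev xs a (h k))" for a k
      unfolding t_def using Cons.prems by (intro jm_esym_rev_commute[symmetric]) auto
    have "Y (Suc r) s = (\<Sum>a\<le>r. esym_rev xs a (h (Suc r - a)) s) + esym_rev xs (Suc r) (h 0) s" by (simp add: Y_def)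
    also have "(\<Sum>a\<le>r. esym_rev xs a (h (Suc r - a)) s) = (\<Sum>a\<le>r. esym_rev xs a (h' (Suc r - a)) s + t (esym_rev xs a (h (r - a))) s)"
    proof (rule sum.cong[OF refl])
      fix a assume "a \<in> {..r}"
      then have "Suc r - a = Suc (r - a)" by simp
      then show "esym_rev xs a (h (Suc r - a)) s = esym_rev xs a (h' (Suc r - a)) s + t (esym_rev xs a (h (r - a))) s"
        by (simp add: h_Suc esym_rev_plus c)
    qed
    also have "\<dots> = (\<Sum>a\<le>r. esym_rev xs a (h' (Suc r - a)) s) + t (Y r) s"
      unfolding t_def Y_def jm_sum by (simp add: sum.distrib)
    finally show ?thesis by (simp add: Z_def h0)
  qed
  have Y: "Y r s \<le> 2 ^ length xs * h r s" for r s
  proof (induct r arbitrary: s)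
    case 0
    then show ?case using Z[of 0 s] by (simp add: Y_def Z_def h0)
  next
    case (Suc r)
    have "t (Y r) s \<le> t (\<lambda>s. 2 ^ length xs * h r s) s"
      unfolding t_def by (rule jm_mono) (rule Suc)
    then show ?case using Z[of "Suc r" s] unfolding YS h_Suc t_def jm_cmult by (simp add: distrib_left)
  qed
  have main: "(\<Sum>a\<le>R. esym_rev (x # xs) a (h (R - a)) s) \<le> 2 * (2 ^ length xs * h R s)"
  proof (cases R)
    case 0
    then show ?thesis by simp
  next
    case (Suc r)
    have c: "esym_rev xs a (t (h k)) = t (esym_rev xs a (h k))" for a k
      unfolding t_def using Cons.prems by (intro jm_esym_rev_commute[symmetric]) auto
    have "(\<Sum>a\<le>Suc r. esym_rev (x # xs) a (h (Suc r - a)) s) = 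
       h (Suc r) s + (\<Sum>a\<le>r. esym_rev xs (Suc a) (h (r - a)) s + t (esym_rev xs a (h (r - a))) s)"
      by (subst sum.atMost_Suc_shift) (simp add: t_def[symmetric] c)
    also have "\<dots> = Y (Suc r) s + t (Y r) s"
      unfolding Y_def sum.atMost_Suc_shift[of _ r] t_def jm_sum by (simp add: sum.distrib)
    also have "\<dots> \<le> 2 ^ length xs * h (Suc r) s + 2 ^ length xs * h (Suc r) s"
    proof (intro add_mono Y)
      have "t (Y r) s \<le> t (\<lambda>s. 2 ^ length xs * h r s) s"
        unfolding t_def by (rule jm_mono) (rule Y)
      then show "t (Y r) s \<le> 2 ^ length xs * h (Suc r) s" unfolding h_Suc t_def jm_cmult by (simp add: distrib_left)
    qed
    finally show ?thesis using Suc by simp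
  qed
  then show ?case by (simp add: h_def)
qed

text \<open>The induction hypothesis is strengthened to \<open>(1 + x) / (1 - x) = 2 / (1 - x) - 1\<close>.\<close>

lemma hsym_esym_le:
  "distinct xs \<Longrightarrow> (\<Sum>b\<le>R. hsym xs (R - b) (esym xs b f) s) \<le> 2 ^ length xs * hsym xs R f s"
proof (induct xs arbitrary: R s)
  case Nil
  have "hsym [] (R - b) (esym [] b f) s = (if b = 0 then hsym [] R f s else 0)" if "b \<le> R" for b
    using that by (cases b; cases "R - b") auto
  then show ?case by (simp add: sum.delta)
next
  case (Cons x xs)
  define h where "h r = hsym (x # xs) r f" for r
  define h' where "h' r = hsym xs r f" for r
  define t where "t g = jm x (set xs) g" for g
  \<comment> \<open>Here \<open>x\<close> is absent from both factors in \<open>Z'\<close>, present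
    in the elementary one in \<open>Y\<close>, and in both in \<open>Z\<close>.\<close>
  define Z' where "Z' r s = (\<Sum>b\<le>r. hsym xs (r - b) (esym xs b f) s)" for r s
  define Y where "Y r s = (\<Sum>b\<le>r. hsym xs (r - b) (esym (x # xs) b f) s)" for r s
  define Z where "Z r s = (\<Sum>b\<le>r. hsym (x # xs) (r - b) (esym (x # xs) b f) s)" for r s
  have Z': "Z' r s \<le> 2 ^ length xs * h' r s" for r s
    using Cons unfolding Z'_def h'_def by simp
  have h_Suc: "h (Suc r) = (\<lambda>s. h' (Suc r) s + t (h r) s)" for r by (simp add: h_def h'_def t_def)
  have c: "hsym xs k (t g) = t (hsym xs k g)" for k g
    unfolding t_def using Cons.prems by (intro jm_hsym_commute[symmetric]) auto
  have YS: "Y (Suc r) s = Z' (Suc r) s + t (Z' r) s" for r s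
  proof -
    have "Y (Suc r) s = hsym xs (Suc r) f s + (\<Sum>b\<le>r. hsym xs (r - b) (esym xs (Suc b) f) s + t (hsym xs (r - b) (esym xs b f)) s)"
      unfolding Y_def by (subst sum.atMost_Suc_shift) (simp add: t_def[symmetric] hsym_plus c)
    also have "\<dots> = Z' (Suc r) s + t (Z' r) s"
      unfolding Z'_def sum.atMost_Suc_shift[of _ r] t_def jm_sum by (simp add: sum.distrib)
    finally show ?thesis .
  qed
  have ZS: "Z (Suc r) s = Y (Suc r) s + t (Z r) s" for r s
  proof -
    have "(\<Sum>b\<le>r. hsym (x # xs) (Suc r - b) (esym (x # xs) b f) s) = 
       (\<Sum>b\<le>r. hsym xs (Suc r - b) (esym (x # xs) b f) s + t (hsym (x # xs) (r - b) (esym (x # xs) b f)) s)"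
      by (intro sum.cong refl) (simp add: Suc_diff_le t_def)
    also have "\<dots> = (\<Sum>b\<le>r. hsym xs (Suc r - b) (esym (x # xs) b f) s) + t (Z r) s"
      unfolding Z_def t_def jm_sum by (simp add: sum.distrib)
    finally show ?thesis unfolding Z_def Y_def by simp
  qed
  have main: "Z r s + 2 ^ length xs * h' r s \<le> 2 * 2 ^ length xs * h r s" for r s
  proof (induct r arbitrary: s)
    case 0
    then show ?case by (simp add: Z_def h_def h'_def)
  next
    case (Suc r)
    have "t (\<lambda>s. Z r s + Z' r s) s \<le> t (\<lambda>s. 2 * 2 ^ length xs * h r s) s"
      unfolding t_def
    proof (rule jm_mono)
      fix s show "Z r s + Z' r s \<le> 2 * 2 ^ length xs * h r s"
        using Suc[of s] Z'[of r s] by linarith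
    qed
    then have "t (Z r) s + t (Z' r) s \<le> 2 * 2 ^ length xs * t (h r) s"
      unfolding t_def jm_plus jm_cmult .
    then show ?case using Z'[of "Suc r" s] unfolding ZS YS h_Suc distrib_left mult.assoc by linarith
  qed
  have "Z R s \<le> 2 * 2 ^ length xs * h R s" using main[of R s] by linarith
  then show ?case by (simp add: Z_def h_def)
qed

section \<open>Expansion into explicit words\<close>

definition run :: "state \<Rightarrow> (nat \<times> nat) list \<Rightarrow> state" where
  "run s w = foldl (\<lambda>s (a, x). step s a x) s w"

lemma run_simps [simp]: "run s [] = s" "run s ((a, x) # w) = run (step s a x) w" "run s (v @ w) = run (run s v) w"
  by (simp_all add: run_def)

fun weak_words :: "nat list \<Rightarrow> nat \<Rightarrow> (nat \<times> nat) list set" where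
  "weak_words [] 0 = {[]}"
| "weak_words [] (Suc r) = {}"
| "weak_words (x # xs) 0 = {[]}"
| "weak_words (x # xs) (Suc r) = weak_words xs (Suc r) \<union> (\<Union>a\<in>set xs. Cons (a, x) ` weak_words (x # xs) r)"

fun strict_words :: "nat list \<Rightarrow> nat \<Rightarrow> (nat \<times> nat) list set" where
  "strict_words [] 0 = {[]}"
| "strict_words [] (Suc r) = {}"
| "strict_words (x # xs) 0 = {[]}"
| "strict_words (x # xs) (Suc r) = strict_words xs (Suc r) \<union> (\<Union>a\<in>set xs. Cons (a, x) ` strict_words xs r)"

lemma finite_weak_words [simp]: "finite (weak_words xs r)"
  by (induct xs r rule: weak_words.induct) auto

lemma finite_strict_words [simp]: "finite (strict_words xs r)"
  by (induct xs r rule: strict_words.induct) auto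

lemma weak_words_colours: "w \<in> weak_words xs r \<Longrightarrow> snd ` set w \<subseteq> set xs"
proof (induct xs r arbitrary: w rule: weak_words.induct)
  case (4 x xs r)
  from 4(3) consider "w \<in> weak_words xs (Suc r)" | a w' where "a \<in> set xs" "w = (a, x) # w'" "w' \<in> weak_words (x # xs) r"
    by auto
  then show ?case
  proof cases
    case 1
    show ?thesis using 4(1)[OF 1] by auto
  next
    case 2
    show ?thesis using 4(2)[OF 2(1,3)] 2(2) by auto
  qed
qed auto

lemma strict_words_colours: "w \<in> strict_words xs r \<Longrightarrow> snd ` set w \<subseteq> set xs"
proof (induct xs r arbitrary: w rule: strict_words.induct)
  case (4 x xs r)
  from 4(3) consider "w \<in> strict_words xs (Suc r)" | a w' where "a \<in> set xs" "w = (a, x) # w'" "w' \<in> strict_words xs r"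
    by auto
  then show ?case
  proof cases
    case 1
    show ?thesis using 4(1)[OF 1] by auto
  next
    case 2
    show ?thesis using 4(2)[OF 2(1,3)] 2(2) by auto
  qed
qed auto

lemma sum_Cons_words:
  assumes "finite A" "finite W" "finite W'" "\<And>w. w \<in> W' \<Longrightarrow> x \<notin> snd ` set w"
  shows "(\<Sum>w\<in>W' \<union> (\<Union>a\<in>A. Cons (a, x) ` W). F w) = (\<Sum>w\<in>W'. F w) + (\<Sum>a\<in>A. \<Sum>w\<in>W. F ((a, x) # w) :: nat)"
proof -
  have "(\<Sum>w\<in>W' \<union> (\<Union>a\<in>A. Cons (a, x) ` W). F w) = (\<Sum>w\<in>W'. F w) + (\<Sum>w\<in>(\<Union>a\<in>A. Cons (a, x) ` W). F w)"
    using assms by (intro sum.union_disjoint) force+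
  also have "(\<Sum>w\<in>(\<Union>a\<in>A. Cons (a, x) ` W). F w) = (\<Sum>a\<in>A. \<Sum>w\<in>Cons (a, x) ` W. F w)"
    using assms by (intro sum.UNION_disjoint) auto
  also have "\<dots> = (\<Sum>a\<in>A. \<Sum>w\<in>W. F ((a, x) # w))"
    by (rule sum.cong[OF refl]) (simp add: sum.reindex)
  finally show ?thesis .
qed

lemma hsym_words: "distinct xs \<Longrightarrow> hsym xs r f s = (\<Sum>w\<in>weak_words xs r. f (run s w))"
proof (induct xs r f arbitrary: s rule: hsym.induct)
  case (4 x xs r f)
  then have "\<And>w. w \<in> weak_words xs (Suc r) \<Longrightarrow> x \<notin> snd ` set w" using weak_words_colours by fastforce
  then show ?case using 4 by (simp add: sum_Cons_words jm_def)
qed auto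

lemma esym_words: "distinct xs \<Longrightarrow> esym xs r f s = (\<Sum>w\<in>strict_words xs r. f (run s w))"
proof (induct xs r f arbitrary: s rule: esym.induct)
  case (4 x xs r f)
  then have "\<And>w. w \<in> strict_words xs (Suc r) \<Longrightarrow> x \<notin> snd ` set w" using strict_words_colours by fastforce
  then show ?case using 4 by (simp add: sum_Cons_words jm_def)
qed auto

lemma esym_rev_words: "distinct xs \<Longrightarrow> esym_rev xs r f s = (\<Sum>w\<in>strict_words xs r. f (run s (rev w)))"
proof (induct xs r f arbitrary: s rule: esym_rev.induct)
  case (4 x xs r f)
  then have "\<And>w. w \<in> strict_words xs (Suc r) \<Longrightarrow> x \<notin> snd ` set w" using strict_words_colours by fastforce
  then have "(\<Sum>w\<in>strict_words (x # xs) (Suc r). f (run s (rev w))) = (\<Sum>w\<in>strict_words xs (Suc r). f (run s (rev w)))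
     + (\<Sum>a\<in>set xs. \<Sum>w\<in>strict_words xs r. f (step (run s (rev w)) a x))"
    by (simp add: sum_Cons_words)
  also have "(\<Sum>a\<in>set xs. \<Sum>w\<in>strict_words xs r. f (step (run s (rev w)) a x)) = (\<Sum>w\<in>strict_words xs r. jm x (set xs) f (run s (rev w)))"
    unfolding jm_def by (rule sum.swap)
  finally show ?case using 4 by simp
qed auto

definition colours :: "nat \<Rightarrow> nat list" where "colours n = rev [1..<Suc n]"

lemma colours_simps [simp]: "colours 0 = []" "colours (Suc n) = Suc n # colours n" "set (colours n) = {1..n}" "distinct (colours n)" "length (colours n) = n"
  by (auto simp: colours_def)

lemma is_walk_simps: "is_walk n []" "is_walk n ((a, x) # w) \<longleftrightarrow> 1 \<le> a \<and> a < x \<and> x \<le> n \<and> is_walk n w"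
  by (auto simp: is_walk_def)

lemma is_walk_mono: "is_walk n w \<Longrightarrow> n \<le> m \<Longrightarrow> is_walk m w"
  by (fastforce simp: is_walk_def)

lemma weak_words_iff: "w \<in> weak_words (colours n) r \<longleftrightarrow> length w = r \<and> is_walk n w \<and> sorted (rev (map snd w))"
proof (induct n arbitrary: w r)
  case 0
  then show ?case by (cases r; cases w) (auto simp: is_walk_def)
next
  case (Suc n)
  show ?case
  proof (induct r arbitrary: w)
    case 0
    then show ?case by (auto simp: is_walk_def)
  next
    case (Suc r)
    note IH = \<open>\<And>w r. (w \<in> weak_words (colours n) r) = _ w r\<close>
    show ?case
    proof (cases w)
      case Nil
      then show ?thesis using IH by auto
    next
      case (Cons p w')
      obtain a x where p: "p = (a, x)" by fastforce
      show ?thesis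
      proof (cases "x = Suc n")
        case True
        have "(\<forall>(s, t)\<in>set w'. t \<le> Suc n)" if "is_walk (Suc n) w'" using that by (auto simp: is_walk_def)
        then show ?thesis using IH[of w "Suc r"] Suc[of w'] Cons p True
          by (auto simp: is_walk_simps sorted_append image_iff)
      next
        case False
        have "is_walk n w'" if "is_walk (Suc n) w'" "x \<le> n" "\<forall>t\<in>snd ` set w'. t \<le> x"
          using that by (fastforce simp: is_walk_def)
        then show ?thesis using IH[of w "Suc r"] Cons p False is_walk_mono[of n w' "Suc n"]
          by (auto simp: is_walk_simps sorted_append image_iff)
      qed
    qed
  qed
qed

lemma walk_end_simps [simp]:
  "walk_end \<rho> [] = \<rho>" "walk_end \<rho> ((a, b) # w) = walk_end (\<rho> \<circ> tr a b) w" "walk_end \<rho> (v @ w) = walk_end (walk_end \<rho> v) w"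
  by (simp_all add: walk_end_def)

lemma fst_run: "fst (run s w) = walk_end (fst s) w"
proof (induct w arbitrary: s)
  case (Cons p w)
  obtain a b where "p = (a, b)" by fastforce
  then show ?case using Cons[of "step s a b"] by (simp only: run_simps walk_end_simps fst_step)
qed simp

lemma walk_end_rev: "walk_end (walk_end \<tau> q) (rev q) = \<tau>"
proof (induct q arbitrary: \<tau>)
  case (Cons p q)
  obtain a b where "p = (a, b)" by fastforce
  then have "walk_end (walk_end \<tau> (p # q)) (rev (p # q)) = walk_end (walk_end (\<tau> \<circ> tr a b) q) (rev q) \<circ> tr a b"
    by (simp only: walk_end_simps rev.simps)
  then show ?case unfolding Cons comp_tr_tr .
qed simp

lemma walk_end_permutes:
  "is_walk d w \<Longrightarrow> \<rho> permutes {1..d} \<Longrightarrow> walk_end \<rho> w permutes {1..d}"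
proof (induct w arbitrary: \<rho>)
  case (Cons p w)
  obtain a b where p: "p = (a, b)" by fastforce
  have "tr a b permutes {1..d}" using Cons.prems p by (intro permutes_swap_id) (auto simp: is_walk_simps)
  then have "\<rho> \<circ> tr a b permutes {1..d}" using Cons.prems by (intro permutes_compose)
  then show ?case using Cons p by (simp add: is_walk_simps)
qed simp

lemma size_cycle_type: "size (cycle_type d \<rho>) = ncycles {1..d} \<rho>"
  by (simp add: cycle_type_def ncycles_def)

lemma ncycles_le_card: "finite S \<Longrightarrow> ncycles S \<sigma> \<le> card S"
  by (simp add: ncycles_def card_image_le)

lemma strict_words_0 [simp]: "strict_words xs 0 = {[]}" by (cases xs) auto

lemma strict_words_Cons: "w \<in> strict_words xs r \<Longrightarrow> w \<in> strict_words (x # xs) r"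
  by (cases r) auto

text \<open>If the largest point \<open>n\<close> is moved, the transposition with its preimage
  \<open>a\<close> turns it into a fixed point, and the cycles on the smaller points are as many as
  before. So each colour is used at most once, in decreasing order, and every letter creates one
  cycle.\<close>

lemma strict_factorisation:
  "\<rho> permutes {1..n} \<Longrightarrow> \<exists>q\<in>strict_words (colours n) (n - ncycles {1..n} \<rho>). walk_end \<rho> q = id"
proof (induct n arbitrary: \<rho>)
  case 0
  then show ?case by (simp add: ncycles_def)
next
  case (Suc n)
  have p: "permutation \<rho>" using Suc.prems by (auto simp: permutation_permutes)
  have st: "{1..Suc n} = {1..n} \<union> {Suc n}" by auto
  have step: "ncycles {1..Suc n} \<tau> = Suc (ncycles {1..n} \<tau>)" if "\<tau> permutes {1..n}" for \<tau>
  proof -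
    have "\<tau> ` {1..n} \<subseteq> {1..n}" "\<tau> (Suc n) = Suc n"
      using permutes_image[OF that] permutes_not_in[OF that] by auto
    then have "ncycles ({1..n} \<union> {Suc n}) \<tau> = ncycles {1..n} \<tau> + ncycles {Suc n} \<tau>"
      by (intro ncycles_Un) auto
    then show ?thesis unfolding st by (simp add: ncycles_def)
  qed
  have sub: "\<tau> permutes {1..n}" if "\<tau> permutes {1..Suc n}" "\<tau> (Suc n) = Suc n" for \<tau>
  proof (rule permutes_superset[OF that(1)])
    fix x assume "x \<in> {1..Suc n} - {1..n}"
    then have "x = Suc n" by auto
    then show "\<tau> x = x" using that(2) by simp
  qed
  show ?case
  proof (cases "\<rho> (Suc n) = Suc n")
    case True
    have r: "\<rho> permutes {1..n}" by (rule sub[OF Suc.prems True])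
    then show ?thesis using Suc.hyps[OF r] step[OF r] strict_words_Cons by auto
  next
    case False
    define a where "a = inv' \<rho> (Suc n)"
    have \<rho>a: "\<rho> a = Suc n" unfolding a_def by (rule permutes_inverses(1)[OF Suc.prems])
    then have an: "a \<noteq> Suc n" using False by auto
    have "a \<in> {1..Suc n}" using permutes_in_image[OF Suc.prems, of a] \<rho>a by simp
    then have a: "a \<in> {1..n}" using an by auto
    define \<tau> where "\<tau> = \<rho> \<circ> tr a (Suc n)"
    have "tr a (Suc n) permutes {1..Suc n}" using a by (intro permutes_swap_id) auto
    then have "\<tau> permutes {1..Suc n}" unfolding \<tau>_def using Suc.prems by (rule permutes_compose)
    moreover have "\<tau> (Suc n) = Suc n" by (simp add: \<tau>_def \<rho>a)
    ultimately have t: "\<tau> permutes {1..n}" by (rule sub)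
    have "Suc n \<in> orb \<rho> a" using orbit.base[of \<rho> a] \<rho>a by simp
    then have "a \<in> orb \<rho> (Suc n)" by (rule orbit_sym[OF p])
    then have "ncycles {1..Suc n} \<tau> = Suc (ncycles {1..Suc n} \<rho>)"
      unfolding \<tau>_def using an a by (intro ncycles_split p) auto
    then have c: "ncycles {1..Suc n} \<rho> = ncycles {1..n} \<tau>" using step[OF t] by simp
    have le: "ncycles {1..n} \<tau> \<le> n" using ncycles_le_card[of "{1..n}" \<tau>] by simp
    obtain q where q: "q \<in> strict_words (colours n) (n - ncycles {1..n} \<tau>)" "walk_end \<tau> q = id"
      using Suc.hyps[OF t] by blast
    have "(a, Suc n) # q \<in> strict_words (colours (Suc n)) (Suc n - ncycles {1..Suc n} \<rho>)"
      unfolding c Suc_diff_le[OF le] using q a by (auto simp: image_iff)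
    moreover have "walk_end \<rho> ((a, Suc n) # q) = id" using q by (simp add: \<tau>_def)
    ultimately show ?thesis by blast
  qed
qed

section \<open>Transitivity and connectedness\<close>

lemma eqv_run: "eqv (snd s) \<Longrightarrow> eqv (snd (run s w))"
proof (induct w arbitrary: s)
  case (Cons p w)
  obtain a b where "p = (a, b)" by fastforce
  then show ?case using Cons(1)[of "step s a b"] Cons(2) by (simp add: eqv_link)
qed simp

lemma link_mono: "e \<subseteq> link e a b"
  by (auto simp: link_def)

lemma run_mono: "snd s \<subseteq> snd (run s w)"
proof (induct w arbitrary: s)
  case (Cons p w)
  obtain a b where "p = (a, b)" by fastforce
  then show ?case using Cons[of "step s a b"] link_mono[of "snd s" a b] by auto
qed simp

lemma run_edge: "(a, b) \<in> set w \<Longrightarrow> (a, b) \<in> snd (run s w)"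
proof (induct w arbitrary: s)
  case (Cons p w)
  obtain c d where p: "p = (c, d)" by fastforce
  show ?case
  proof (cases "(a, b) = (c, d)")
    case True
    have "(a, b) \<in> link (snd s) a b" by (auto simp: link_def)
    then show ?thesis using True p run_mono[of "step s c d" w] by auto
  next
    case False
    then show ?thesis using Cons.hyps[of "step s c d"] Cons.prems p by auto
  qed
qed simp

lemma walk_end_related:
  assumes e: "eqv e" and w: "\<And>a b. (a, b) \<in> set w \<Longrightarrow> (a, b) \<in> e" and \<tau>: "\<And>x. (x, \<tau> x) \<in> e"
  shows "(x, walk_end \<tau> w x) \<in> e"
  using w \<tau>
proof (induct w arbitrary: \<tau> x)
  case (Cons p w)
  obtain a b where p: "p = (a, b)" by fastforce
  have "(y, tr a b y) \<in> e" for y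
    using Cons.prems(1)[of a b] p eqv_refl[OF e] eqv_sym[OF e] by (auto simp: Transposition.transpose_def)
  then have "(y, (\<tau> \<circ> tr a b) y) \<in> e" for y
    using Cons.prems(2) eqv_trans[OF e] unfolding o_apply by blast
  then show ?case using Cons p by simp
qed simp

lemma generate_related:
  assumes e: "eqv e" and H: "\<And>h. h \<in> H \<Longrightarrow> h permutes {1..d} \<and> (\<forall>x. (x, h x) \<in> e)"
    and p: "p \<in> generate (sym_group d) H"
  shows "(x, p x) \<in> e"
  using p
proof (induct arbitrary: x rule: generate.induct)
  case one
  then show ?case by (simp add: sym_group_one eqv_refl[OF e])
next
  case (incl h)
  then show ?case using H by blast
next
  case (inv h)
  have h: "h permutes {1..d}" using H inv by blast
  have "inv\<^bsub>sym_group d\<^esub> h = inv' h"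
    using h by (intro sym_group_inv_equality) (simp add: sym_group_carrier)
  moreover have "(inv' h x, h (inv' h x)) \<in> e" using H inv by blast
  ultimately show ?case using permutes_inverses(1)[OF h, of x] eqv_sym[OF e] by simp
next
  case (eng h1 h2)
  then show ?case using eqv_trans[OF e] by (simp add: sym_group_mult) blast
qed

text \<open>The two endpoints of the walk are products of letters of \<open>p\<close> and of
  \<open>q\<close>. Hence every generator of the group moves points only within the classes of the
  completed word.\<close>

lemma transitive_imp_conn:
  assumes \<rho>: "\<rho> permutes {1..d}" and w: "is_walk d w" and tw: "transitive_walk d \<rho> w"
    and q: "walk_end (walk_end \<rho> w) q = id" and p: "walk_end \<rho> p = id"
  shows "conn {1..d} (snd (run (id, Id) (rev q @ rev w @ p)))"
proof -
  define e where "e = snd (run (id, Id) (rev q @ rev w @ p))"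
  have e: "eqv e" unfolding e_def by (rule eqv_run) simp
  have ed: "(a, b) \<in> e" if "(a, b) \<in> set q \<union> set w \<union> set p" for a b
    unfolding e_def using that by (intro run_edge) auto
  let ?H = "{\<rho>, walk_end \<rho> w} \<union> (\<lambda>(s, t). tr s t) ` set w"
  have H: "h permutes {1..d} \<and> (\<forall>x. (x, h x) \<in> e)" if hH: "h \<in> ?H" for h
  proof -
    have rel: "(x, \<tau> x) \<in> e" if "walk_end \<tau> v = id" "set v \<subseteq> set q \<union> set w \<union> set p" for \<tau> v x
    proof -
      have "\<tau> = walk_end id (rev v)" using walk_end_rev[of \<tau> v] that(1) by simp
      then show ?thesis
        using walk_end_related[OF e, of "rev v" id x] ed that(2) eqv_refl[OF e] by auto
    qed
    consider "h = \<rho>" | "h = walk_end \<rho> w" | s t where "(s, t) \<in> set w" "h = tr s t" using hH by auto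
    then show ?thesis
    proof cases
      case 1
      then show ?thesis using \<rho> rel[OF p] by auto
    next
      case 2
      then show ?thesis using walk_end_permutes[OF w \<rho>] rel[OF q] by auto
    next
      case 3
      have "s \<in> {1..d}" "t \<in> {1..d}" using w 3 by (auto simp: is_walk_def)
      then have "h permutes {1..d}" unfolding 3 by (intro permutes_swap_id)
      moreover have "(x, h x) \<in> e" for x
        using ed[of s t] 3 eqv_refl[OF e] eqv_sym[OF e] by (auto simp: Transposition.transpose_def)
      ultimately show ?thesis by blast
    qed
  qed
  show ?thesis
    unfolding conn_def e_def[symmetric]
  proof (intro ballI)
    fix x y assume "x \<in> {1..d}" "y \<in> {1..d}"
    then obtain g where "g \<in> generate (sym_group d) ?H" "g x = y"
      using tw unfolding transitive_walk_def by blast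
    then show "(x, y) \<in> e" using generate_related[OF e H] by blast
  qed
qed

lemma link_subset:
  assumes "refl P" "trans P" "e \<subseteq> P" "(a, b) \<in> P" "(b, a) \<in> P"
  shows "link e a b \<subseteq> P"
proof -
  have "link e a b \<subseteq> P\<^sup>*" unfolding link_def using assms by (intro rtrancl_mono) auto
  also have "P\<^sup>* \<subseteq> P"
  proof (rule subrelI)
    fix x y assume "(x, y) \<in> P\<^sup>*"
    then show "(x, y) \<in> P"
    proof induct
      case base
      show ?case using assms(1) by (simp add: refl_on_def)
    next
      case (step y z)
      show ?case by (rule transD[OF assms(2) step(3,2)])
    qed
  qed
  finally show ?thesis .
qed

text \<open>Being carried to one another by the generated group is reflexive, transitive and
  contains every edge of \<open>w\<close> in both directions, hence the whole relation of the
  run.\<close>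

lemma conn_imp_transitive:
  assumes c: "conn {1..d} (snd (run (id, Id) (rev w)))"
  shows "transitive_walk d id w"
proof -
  let ?H = "{id, walk_end id w} \<union> (\<lambda>(s, t). tr s t) ` set w"
  define P where "P = {(x, y). \<exists>p\<in>generate (sym_group d) ?H. p x = y}"
  have "refl P" unfolding P_def refl_on_def using generate.one[of "sym_group d" ?H]
    by (simp only: sym_group_one) (auto intro: bexI[of _ id])
  moreover have "trans P"
    unfolding trans_def
  proof (intro allI impI)
    fix x y z assume "(x, y) \<in> P" "(y, z) \<in> P"
    then obtain p1 p2 where "p1 \<in> generate (sym_group d) ?H" "p1 x = y" "p2 \<in> generate (sym_group d) ?H" "p2 y = z"
      by (auto simp: P_def)
    moreover from this have "p2 \<circ> p1 \<in> generate (sym_group d) ?H"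
      using generate.eng[of p2 "sym_group d" ?H p1] by (simp only: sym_group_mult)
    ultimately show "(x, z) \<in> P" unfolding P_def by (auto intro: bexI[of _ "p2 \<circ> p1"])
  qed
  moreover have "(a, b) \<in> P \<and> (b, a) \<in> P" if "(a, b) \<in> set w" for a b
  proof -
    have "tr a b \<in> (\<lambda>(s, t). tr s t) ` set w" using that by (intro image_eqI[where x = "(a, b)"]) auto
    then have g: "tr a b \<in> generate (sym_group d) ?H" by (intro generate.incl) blast
    have "(a, tr a b a) \<in> P" "(b, tr a b b) \<in> P" unfolding P_def using g by blast+
    then show ?thesis by simp
  qed
  ultimately have step: "snd (run s v) \<subseteq> P" if "snd s \<subseteq> P" "set v \<subseteq> set w" for s v
    using that
  proof (induct v arbitrary: s)
    case (Cons p v)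
    obtain a b where "p = (a, b)" by fastforce
    then show ?case using Cons link_subset[of P "snd s" a b] by simp
  qed simp
  have "Id \<subseteq> P" using \<open>refl P\<close> by (auto simp: refl_on_def)
  then have "snd (run (id, Id) (rev w)) \<subseteq> P" by (intro step) auto
  then show ?thesis using c unfolding transitive_walk_def conn_def P_def by auto
qed

section \<open>Closed walks compared with Hurwitz numbers\<close>

lemma nwalks_eq_hsym: "nwalks {1..d} r \<sigma> = hsym (colours d) r (at_id {1..d} (conn {1..d})) (\<sigma>, Id)"
  unfolding nwalks_def using hsym_set_eq_hsym[of "colours d"] by simp

definition all_walks :: "nat \<Rightarrow> nat \<Rightarrow> ((nat \<Rightarrow> nat) \<times> (nat \<times> nat) list) set" where
  "all_walks g d = {(\<rho>, w). \<rho> permutes {1..d} \<and>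
    int (length w) = 2 * int g - 2 + int (size (cycle_type d \<rho>)) + int (size (cycle_type d (walk_end \<rho> w))) \<and>
    is_walk d w \<and> monotone_walk w \<and> transitive_walk d \<rho> w}"

lemma finite_all_walks: "finite (all_walks g d)"
proof -
  have "all_walks g d \<subseteq> {\<rho>. \<rho> permutes {1..d}} \<times> {w. set w \<subseteq> {1..d} \<times> {1..d} \<and> length w \<le> 2 * g + 2 * d}"
  proof
    fix z assume "z \<in> all_walks g d"
    then obtain \<rho> w where z: "z = (\<rho>, w)" "\<rho> permutes {1..d}" "is_walk d w"
      "int (length w) = 2 * int g - 2 + int (ncycles {1..d} \<rho>) + int (ncycles {1..d} (walk_end \<rho> w))"
      by (auto simp: all_walks_def size_cycle_type)
    have "ncycles {1..d} \<rho> \<le> d" "ncycles {1..d} (walk_end \<rho> w) \<le> d"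
      using ncycles_le_card[of "{1..d}"] by auto
    then have "length w \<le> 2 * g + 2 * d" using z(4) by linarith
    moreover have "set w \<subseteq> {1..d} \<times> {1..d}" using z(3) by (fastforce simp: is_walk_def)
    ultimately show "z \<in> {\<rho>. \<rho> permutes {1..d}} \<times> {w. set w \<subseteq> {1..d} \<times> {1..d} \<and> length w \<le> 2 * g + 2 * d}"
      using z by auto
  qed
  then show ?thesis
    by (rule finite_subset) (intro finite_cartesian_product finite_permutations finite_lists_length_le; simp)
qed

text \<open>Completing a walk from \<open>\<rho>\<close> to \<open>\<sigma>\<close> by strictly monotone factorisations of \<open>\<rho>\<close> and \<open>\<sigma>\<close> gives a walk from
  the identity to itself whose length no longer depends on the cycle types.\<close>

lemma all_walks_le:
  assumes "1 \<le> d"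
  shows "card (all_walks g d) \<le> 4 ^ d * nwalks {1..d} (2 * g + 2 * d - 2) id"
proof -
  define R where "R = 2 * g + 2 * d - 2"
  define \<delta> where "\<delta> = at_id {1..d} (conn {1..d})"
  let ?xs = "colours d" and ?s = "(id, Id) :: state"
  define q where "q \<rho> = (SOME q. q \<in> strict_words ?xs (d - ncycles {1..d} \<rho>) \<and> walk_end \<rho> q = id)" for \<rho>
  have q: "q \<rho> \<in> strict_words ?xs (d - ncycles {1..d} \<rho>)" "walk_end \<rho> (q \<rho>) = id" if "\<rho> permutes {1..d}" for \<rho>
  proof -
    have "\<exists>q. q \<in> strict_words ?xs (d - ncycles {1..d} \<rho>) \<and> walk_end \<rho> q = id" using strict_factorisation[OF that] by blast
    from someI_ex[OF this] show "q \<rho> \<in> strict_words ?xs (d - ncycles {1..d} \<rho>)" "walk_end \<rho> (q \<rho>) = id"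
      unfolding q_def by auto
  qed
  \<comment> \<open>Recording the lengths of the two factorisations makes the target a disjoint
    union, over which the sums of operators are taken.\<close>
  define \<Phi> where "\<Phi> = (\<lambda>(\<rho>, w). (d - ncycles {1..d} \<rho>, d - ncycles {1..d} (walk_end \<rho> w), q (walk_end \<rho> w), rev w, q \<rho>))"
  define TT where "TT = (SIGMA b:{..R}. SIGMA a:{..R - b}. strict_words ?xs a \<times> weak_words ?xs (R - b - a) \<times> strict_words ?xs b)"
  define F where "F = (\<lambda>(b::nat, a::nat, q, w, p). \<delta> (run ?s (rev q @ w @ p)))"
  have \<Phi>: "\<Phi> z \<in> TT \<and> F (\<Phi> z) = 1" if "z \<in> all_walks g d" for z
  proof -
    obtain \<rho> w where z: "z = (\<rho>, w)" and \<rho>: "\<rho> permutes {1..d}" and w: "is_walk d w" "monotone_walk w" 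
      and t: "transitive_walk d \<rho> w"
      and l: "int (length w) = 2 * int g - 2 + int (ncycles {1..d} \<rho>) + int (ncycles {1..d} (walk_end \<rho> w))"
      using \<open>z \<in> all_walks g d\<close> by (auto simp: all_walks_def size_cycle_type)
    have \<sigma>: "walk_end \<rho> w permutes {1..d}" by (rule walk_end_permutes[OF w(1) \<rho>])
    have c: "ncycles {1..d} \<rho> \<le> d" "ncycles {1..d} (walk_end \<rho> w) \<le> d"
      using ncycles_le_card[of "{1..d}"] by auto
    \<comment> \<open>The lengths of the walk and of both factorisations add up to \<open>R\<close>,
      because the numbers of cycles cancel.\<close>
    have le: "d - ncycles {1..d} \<rho> \<le> R" "d - ncycles {1..d} (walk_end \<rho> w) \<le> R - (d - ncycles {1..d} \<rho>)"
      "length w = R - (d - ncycles {1..d} \<rho>) - (d - ncycles {1..d} (walk_end \<rho> w))"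
      using l c assms unfolding R_def by linarith+
    have "rev w \<in> weak_words ?xs (length w)"
      using w by (auto simp: weak_words_iff is_walk_def monotone_walk_def rev_map[symmetric])
    then have "rev w \<in> weak_words ?xs (R - (d - ncycles {1..d} \<rho>) - (d - ncycles {1..d} (walk_end \<rho> w)))"
      unfolding le(3) .
    then have "\<Phi> z \<in> TT"
      unfolding \<Phi>_def TT_def z prod.case using le(1,2) q(1)[OF \<rho>] q(1)[OF \<sigma>]
      by (intro SigmaI) (simp_all only: atMost_iff)
    moreover have "F (\<Phi> z) = 1"
    proof -
      let ?r = "run ?s (rev (q (walk_end \<rho> w)) @ rev w @ q \<rho>)"
      have "walk_end id (rev (q (walk_end \<rho> w))) = walk_end \<rho> w"
        using walk_end_rev[of "walk_end \<rho> w" "q (walk_end \<rho> w)"] q(2)[OF \<sigma>] by simp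
      then have "fst ?r = id"
        unfolding fst_run using walk_end_rev[of \<rho> w] q(2)[OF \<rho>] by simp
      moreover have "conn {1..d} (snd ?r)"
        by (rule transitive_imp_conn[OF \<rho> w(1) t q(2)[OF \<sigma>] q(2)[OF \<rho>]])
      ultimately show ?thesis unfolding F_def \<Phi>_def z \<delta>_def at_id_def by simp
    qed
    ultimately show ?thesis ..
  qed
  \<comment> \<open>The starting permutation is recovered from its chosen factorisation by reading
    it backwards from the identity.\<close>
  have inj: "inj_on \<Phi> (all_walks g d)"
  proof (rule inj_onI)
    fix z z' assume z: "z \<in> all_walks g d" "z' \<in> all_walks g d" "\<Phi> z = \<Phi> z'"
    obtain \<rho> w \<rho>' w' where e: "z = (\<rho>, w)" "z' = (\<rho>', w')" by fastforce
    have \<rho>: "\<rho> permutes {1..d}" "\<rho>' permutes {1..d}" using z(1,2) unfolding e by (auto simp: all_walks_def)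
    have qq: "q \<rho> = q \<rho>'" and "w = w'"
      using z(3) unfolding \<Phi>_def e prod.case by (simp_all only: prod.inject rev_is_rev_conv)
    have "walk_end id (rev (q \<rho>)) = \<rho>" "walk_end id (rev (q \<rho>')) = \<rho>'"
      using walk_end_rev[of \<rho> "q \<rho>"] walk_end_rev[of \<rho>' "q \<rho>'"] unfolding q(2)[OF \<rho>(1)] q(2)[OF \<rho>(2)] .
    then have "\<rho> = \<rho>'" unfolding qq by (rule trans[OF sym])
    then show "z = z'" using e \<open>w = w'\<close> by simp
  qed
  have finT: "finite TT" unfolding TT_def by (intro finite_SigmaI finite_cartesian_product) auto
  have "card (all_walks g d) = card (\<Phi> ` all_walks g d)" by (rule card_image[OF inj, symmetric])
  also have "\<dots> = (\<Sum>z\<in>\<Phi> ` all_walks g d. F z)"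
  proof -
    have "(\<Sum>z\<in>\<Phi> ` all_walks g d. F z) = (\<Sum>z\<in>\<Phi> ` all_walks g d. 1)"
      by (rule sum.cong[OF refl]) (use \<Phi> in blast)
    then show ?thesis by simp
  qed
  also have "\<dots> \<le> (\<Sum>z\<in>TT. F z)" using \<Phi> by (intro sum_mono2[OF finT] image_subsetI) blast+
  also have "\<dots> = (\<Sum>b\<le>R. \<Sum>a\<le>R - b. \<Sum>q\<in>strict_words ?xs a. \<Sum>w\<in>weak_words ?xs (R - b - a). \<Sum>p\<in>strict_words ?xs b. \<delta> (run ?s (rev q @ w @ p)))"
  proof -
    have "(\<Sum>a\<le>R - b. \<Sum>q\<in>strict_words ?xs a. \<Sum>w\<in>weak_words ?xs (R - b - a). \<Sum>p\<in>strict_words ?xs b. \<delta> (run ?s (rev q @ w @ p)))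
       = (\<Sum>(a, q, w, p)\<in>(SIGMA a:{..R - b}. strict_words ?xs a \<times> weak_words ?xs (R - b - a) \<times> strict_words ?xs b). \<delta> (run ?s (rev q @ w @ p)))" for b
      unfolding sum.cartesian_product by (rule sum.Sigma) auto
    then show ?thesis
      unfolding TT_def F_def by (simp only:) (rule sum.Sigma[symmetric]; auto)
  qed
  also have "\<dots> = (\<Sum>b\<le>R. \<Sum>a\<le>R - b. esym_rev ?xs a (hsym ?xs (R - b - a) (esym ?xs b \<delta>)) ?s)"
    by (simp add: esym_rev_words hsym_words esym_words)
  \<comment> \<open>Each of the two elementary factors is absorbed into the complete one at the
    price \<open>2 ^ d\<close>.\<close>
  also have "\<dots> \<le> (\<Sum>b\<le>R. 2 ^ d * hsym ?xs (R - b) (esym ?xs b \<delta>) ?s)"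
    by (rule sum_mono) (rule esym_rev_hsym_le[OF colours_simps(4), unfolded colours_simps(5)])
  also have "\<dots> \<le> 2 ^ d * (2 ^ d * hsym ?xs R \<delta> ?s)"
    using hsym_esym_le[of ?xs R \<delta> ?s] by (simp add: sum_distrib_left[symmetric])
  also have "\<dots> = 4 ^ d * nwalks {1..d} R id"
    unfolding nwalks_eq_hsym \<delta>_def by (simp add: power_mult_distrib[symmetric])
  finally show ?thesis unfolding R_def .
qed

lemma cycle_type_id: "cycle_type d id = replicate_mset d 1"
proof -
  have "orb id x = {x}" for x by (simp add: orbit_eq_singleton_iff)
  then have "cycle_type d id = image_mset card (mset_set ((\<lambda>x. {x}) ` {1..d}))" by (simp add: cycle_type_def)
  also have "\<dots> = image_mset (\<lambda>x. 1) (mset_set {1..d})"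
    by (subst image_mset_mset_set[symmetric]) (auto simp: multiset.map_comp comp_def)
  also have "\<dots> = replicate_mset d 1" by (simp add: image_mset_const_eq)
  finally show ?thesis .
qed

text \<open>For the lower bound one pair of cycle types suffices. With the identity at both ends,
  words and monotone walks differ only by reversal.\<close>

lemma nwalks_le_hurwitz:
  assumes "1 \<le> d"
  shows "nwalks {1..d} (2 * g + 2 * d - 2) id \<le> monotone_hurwitz g (replicate_mset d 1) (replicate_mset d 1)"
proof -
  define R where "R = 2 * g + 2 * d - 2"
  define W where "W = {w\<in>weak_words (colours d) R. at_id {1..d} (conn {1..d}) (run (id, Id) w) = 1}"
  have d: "sum_mset (replicate_mset d (1::nat)) = d" by simp
  let ?X = "{(\<rho>, w). \<rho> permutes {1..d} \<and> cycle_type d \<rho> = replicate_mset d 1 \<and>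
        int (length w) = 2 * int g - 2 + int (size (replicate_mset d (1::nat))) + int (size (replicate_mset d (1::nat))) \<and>
        is_walk d w \<and> monotone_walk w \<and> transitive_walk d \<rho> w \<and>
        cycle_type d (walk_end \<rho> w) = replicate_mset d 1}"
  have "nwalks {1..d} R id = (\<Sum>w\<in>weak_words (colours d) R. at_id {1..d} (conn {1..d}) (run (id, Id) w))"
    unfolding nwalks_eq_hsym by (simp add: hsym_words)
  also have "\<dots> = (\<Sum>w\<in>W. at_id {1..d} (conn {1..d}) (run (id, Id) w))"
    unfolding W_def by (intro sum.mono_neutral_right) (auto simp: at_id_def)
  also have "\<dots> = card W" by (simp add: W_def)
  also have "\<dots> = card ((\<lambda>w. (id :: nat \<Rightarrow> nat, rev w)) ` W)" by (subst card_image) (auto simp: inj_on_def)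
  also have "\<dots> \<le> card ?X"
  proof (rule card_mono)
    show "finite ?X"
      by (rule finite_subset[OF _ finite_all_walks[of g d]]) (auto simp: all_walks_def)
    show "(\<lambda>w. (id :: nat \<Rightarrow> nat, rev w)) ` W \<subseteq> ?X"
    proof
      fix z assume "z \<in> (\<lambda>w. (id :: nat \<Rightarrow> nat, rev w)) ` W"
      then obtain w where z: "z = (id, rev w)" and w: "w \<in> weak_words (colours d) R" "at_id {1..d} (conn {1..d}) (run (id, Id) w) = 1"
        by (auto simp: W_def)
      have l: "length w = R" "is_walk d (rev w)" "monotone_walk (rev w)"
        using w(1) by (auto simp: weak_words_iff is_walk_def monotone_walk_def rev_map)
      have "conn {1..d} (snd (run (id, Id) w))" and fx: "\<forall>x\<in>{1..d}. walk_end id w x = x"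
        using w(2) unfolding at_id_def fst_run by (auto simp only: of_bool_eq_1_iff fst_conv)
      then have t: "transitive_walk d id (rev w)" by (intro conn_imp_transitive) simp
      have "is_walk d w" using l(2) by (simp add: is_walk_def)
      then have "walk_end id w permutes {1..d}" by (rule walk_end_permutes) (rule permutes_id)
      then have we: "walk_end id w = id"
      proof -
        assume p: "walk_end id w permutes {1..d}"
        have "walk_end id w x = x" for x using fx permutes_not_in[OF p, of x] by blast
        then show ?thesis by auto
      qed
      have "walk_end id (rev w) = id" using walk_end_rev[of id w] unfolding we .
      moreover have "int R = 2 * int g - 2 + int d + int d" unfolding R_def using assms by linarith
      ultimately show "z \<in> ?X" using z l t by (simp add: cycle_type_id permutes_id)
    qed
  qed
  also have "\<dots> = monotone_hurwitz g (replicate_mset d 1) (replicate_mset d 1)"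
    unfolding monotone_hurwitz_def Let_def d ..
  finally show ?thesis unfolding R_def .
qed

section \<open>The radius of convergence\<close>

lemma hsym_le_rel:
  assumes R: "\<And>s s' a b. R s s' \<Longrightarrow> R (step s a b) (step s' a b)" and f: "\<And>s s'. R s s' \<Longrightarrow> f s \<le> f s'"
  shows "R s s' \<Longrightarrow> hsym xs r f s \<le> hsym xs r f s'"
proof (induct xs arbitrary: s s' r)
  case Nil
  then show ?case by (cases r) (auto simp: f)
next
  case (Cons x xs)
  note IH = Cons.hyps
  show ?case using Cons.prems
  proof (induct r arbitrary: s s')
    case 0
    then show ?case by (simp add: f)
  next
    case (Suc r)
    have "jm x (set xs) (hsym (x # xs) r f) s \<le> jm x (set xs) (hsym (x # xs) r f) s'"
      unfolding jm_def by (intro sum_mono Suc.hyps R Suc.prems)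
    then show ?case using IH[OF Suc.prems, of "Suc r"] by simp
  qed
qed

lemma link_mono_rel: "e \<subseteq> e' \<Longrightarrow> link e a b \<subseteq> link e' a b"
  unfolding link_def by (rule rtrancl_mono) blast

text \<open>With \<open>d\<close> as the largest colour, two steps \<open>(a d)\<close> may precede
  every word. They cancel in the permutation and can only enlarge the relation.\<close>

lemma nwalks_add_2:
  assumes S: "finite S" "a \<in> S" "d \<in> S" "a \<noteq> d"
  shows "nwalks S r \<sigma> \<le> nwalks S (Suc (Suc r)) \<sigma>"
proof -
  let ?f = "at_id S (conn S)"
  have step: "hsym_set S q ?f (step s a d) \<le> hsym_set S (Suc q) ?f s" for q s
  proof -
    have "hsym_set S q ?f (step s a d) \<le> (\<Sum>a\<in>S - {d}. hsym_set S q ?f (step s a d))"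
      using S by (intro member_le_sum[where f = "\<lambda>a. hsym_set S q ?f (step s a d)"]) auto
    then show ?thesis unfolding hsym_set_Suc[OF S(1,3)] by simp
  qed
  have "nwalks S r \<sigma> \<le> hsym_set S r ?f (step (step (\<sigma>, Id) a d) a d)"
    unfolding nwalks_def hsym_set_def
  proof (rule hsym_le_rel[where R = "\<lambda>s s'. fst s = fst s' \<and> snd s \<subseteq> snd s'"])
    fix s s' :: state and a b
    assume "fst s = fst s' \<and> snd s \<subseteq> snd s'"
    then show "fst (step s a b) = fst (step s' a b) \<and> snd (step s a b) \<subseteq> snd (step s' a b)"
      unfolding fst_step snd_step using link_mono_rel by simp
  next
    fix s s' :: state
    assume *: "fst s = fst s' \<and> snd s \<subseteq> snd s'"
    then have "conn S (snd s) \<Longrightarrow> conn S (snd s')" unfolding conn_def by blast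
    then show "?f s \<le> ?f s'" using * by (simp add: at_id_def)
  next
    have "Id \<subseteq> link Id a d" by (rule link_mono)
    then have "Id \<subseteq> link (link Id a d) a d" using link_mono[of "link Id a d" a d] by (rule order_trans)
    then show "fst (\<sigma>, Id) = fst (step (step (\<sigma>, Id) a d) a d) \<and> snd (\<sigma>, Id) \<subseteq> snd (step (step (\<sigma>, Id) a d) a d)"
      by (simp only: fst_step fst_conv snd_conv snd_step comp_tr_tr)
  qed
  also have "\<dots> \<le> hsym_set S (Suc r) ?f (step (\<sigma>, Id) a d)" by (rule step)
  also have "\<dots> \<le> nwalks S (Suc (Suc r)) \<sigma>" unfolding nwalks_def by (rule step)
  finally show ?thesis .
qed

lemma nwalks_genus_mono:
  assumes S: "finite S" "a \<in> S" "d \<in> S" "a \<noteq> d"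
  shows "nwalks S r \<sigma> \<le> nwalks S (2 * g + r) \<sigma>"
proof (induct g)
  case (Suc g)
  then show ?case using nwalks_add_2[OF S, of "2 * g + r" \<sigma>] by simp
qed simp

section \<open>Coefficients of the series\<close>

lemma finite_partitions_of: "finite (partitions_of d)"
proof (rule finite_subset)
  show "partitions_of d \<subseteq> mset ` {xs. set xs \<subseteq> {0..d} \<and> length xs \<le> d}"
  proof
    fix \<alpha> assume "\<alpha> \<in> partitions_of d"
    then have \<alpha>: "\<And>k. k \<in># \<alpha> \<Longrightarrow> 0 < k" "sum_mset \<alpha> = d" by (auto simp: partitions_of_def)
    obtain xs where xs: "\<alpha> = mset xs" using ex_mset by metis
    have "length xs \<le> sum_list xs" if "\<And>k. k \<in> set xs \<Longrightarrow> 0 < k" for xs :: "nat list"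
      using that
    proof (induct xs)
      case (Cons x xs)
      then have "0 < x" "length xs \<le> sum_list xs" by auto
      then show ?case by simp
    qed simp
    moreover have "k \<le> sum_list xs" if "k \<in> set xs" for k using that by (intro member_le_sum_list) auto
    ultimately show "\<alpha> \<in> mset ` {xs. set xs \<subseteq> {0..d} \<and> length xs \<le> d}"
      using \<alpha> unfolding xs by (intro imageI) (auto simp: sum_mset_sum_list)
  qed
qed (intro finite_imageI finite_lists_length_le finite_atLeastAtMost)

lemma hurwitz_sum_le: "(\<Sum>\<alpha>\<in>partitions_of d. \<Sum>\<beta>\<in>partitions_of d. monotone_hurwitz g \<alpha> \<beta>) \<le> card (all_walks g d)"
proof -
  let ?P = "partitions_of d"
  define X where "X = (\<lambda>(\<alpha>, \<beta>). {(\<rho>, w)\<in>all_walks g d. cycle_type d \<rho> = \<alpha> \<and> cycle_type d (walk_end \<rho> w) = \<beta>})"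
  have "monotone_hurwitz g \<alpha> \<beta> = card (X (\<alpha>, \<beta>))" if "\<alpha> \<in> ?P" for \<alpha> \<beta>
  proof -
    have "sum_mset \<alpha> = d" using that by (simp add: partitions_of_def)
    then show ?thesis unfolding monotone_hurwitz_def X_def all_walks_def Let_def
      by (intro arg_cong[where f = card]) auto
  qed
  then have "(\<Sum>\<alpha>\<in>?P. \<Sum>\<beta>\<in>?P. monotone_hurwitz g \<alpha> \<beta>) = (\<Sum>\<alpha>\<in>?P. \<Sum>\<beta>\<in>?P. card (X (\<alpha>, \<beta>)))"
    by (intro sum.cong) auto
  also have "\<dots> = (\<Sum>z\<in>?P \<times> ?P. card (X z))" by (simp add: sum.cartesian_product)
  also have "\<dots> = card (\<Union>z\<in>?P \<times> ?P. X z)"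
  proof (rule card_UN_disjoint[symmetric])
    show "finite (?P \<times> ?P)" using finite_partitions_of by simp
    show "\<forall>z\<in>?P \<times> ?P. finite (X z)"
      by (auto simp: X_def intro: finite_subset[OF _ finite_all_walks[of g d]])
    show "\<forall>z\<in>?P \<times> ?P. \<forall>z'\<in>?P \<times> ?P. z \<noteq> z' \<longrightarrow> X z \<inter> X z' = {}"
      by (auto simp: X_def)
  qed
  also have "\<dots> \<le> card (all_walks g d)"
    by (rule card_mono[OF finite_all_walks]) (auto simp: X_def)
  finally show ?thesis .
qed

text \<open>The point 1 is the only marked one, and all others form the background; with one marked
  cycle, genus \<open>g\<close> means \<open>L = 2 * g\<close>.\<close>

lemma nwalks_eq_gcount: "real (nwalks {1..Suc m} (L + 2 * m) id) = gcount {1} id L m * fact m"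
proof -
  have "{1..Suc m} = {1} \<union> {2..Suc m}" by auto
  then have "nwalks {1..Suc m} (L + 2 * m) id = nwalks_bg {1} id m (L + 2 * m)"
    using nwalks_eq_nwalks_bg[of "{1}" "{2..Suc m}" id "L + 2 * m"] by simp
  then show ?thesis by (simp add: gcount_def)
qed

lemma F_coeff_Suc: "F_coeff g (Suc m) =
    real (\<Sum>\<alpha>\<in>partitions_of (Suc m). \<Sum>\<beta>\<in>partitions_of (Suc m). monotone_hurwitz g \<alpha> \<beta>) / fact (Suc m)"
  unfolding F_coeff_def by (simp only: nat.simps if_False)

lemma F_coeff_upper: "F_coeff g (Suc m) \<le> 4 ^ Suc m * gcount {1} id (2 * g) m"
proof -
  have e: "2 * g + 2 * Suc m - 2 = 2 * g + 2 * m" by simp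
  have "real (\<Sum>\<alpha>\<in>partitions_of (Suc m). \<Sum>\<beta>\<in>partitions_of (Suc m). monotone_hurwitz g \<alpha> \<beta>) \<le> real (card (all_walks g (Suc m)))"
    using hurwitz_sum_le[of g "Suc m"] by (simp only: of_nat_le_iff)
  also have "\<dots> \<le> real (4 ^ Suc m * nwalks {1..Suc m} (2 * g + 2 * m) id)"
    using all_walks_le[of "Suc m" g] unfolding e of_nat_le_iff by simp
  also have "\<dots> = 4 ^ Suc m * (gcount {1} id (2 * g) m * fact m)"
    unfolding of_nat_mult nwalks_eq_gcount by simp
  finally have "F_coeff g (Suc m) \<le> 4 ^ Suc m * (gcount {1} id (2 * g) m * fact m) / fact (Suc m)"
    unfolding F_coeff_Suc by (rule divide_right_mono) simp
  also have "\<dots> = 4 ^ Suc m * gcount {1} id (2 * g) m / real (Suc m)"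
    by (simp del: of_nat_Suc power_Suc)
  also have "\<dots> \<le> 4 ^ Suc m * gcount {1} id (2 * g) m / 1"
    using gcount_nonneg[of "{1}" id "2 * g" m] by (intro divide_left_mono) auto
  finally show ?thesis by simp
qed

lemma F_coeff_nonneg: "0 \<le> F_coeff g d"
proof (cases d)
  case (Suc m)
  show ?thesis unfolding Suc F_coeff_Suc by (intro divide_nonneg_nonneg of_nat_0_le_iff) simp
qed (simp add: F_coeff_def)

text \<open>For \<open>m = 0\<close> there is no transposition to insert. The factor
  \<open>Suc m\<close>, from the factorials, and the shift of the index are those of a derivative,
  which is how \<open>conv_radius_le\<close> uses them.\<close>

lemma F_coeff_lower:
  assumes "0 < m" shows "gcount {1} id 0 m \<le> real (Suc m) * F_coeff g (Suc m)"
proof -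
  let ?r = "replicate_mset (Suc m) (1::nat)"
  have e: "2 * g + 2 * Suc m - 2 = 2 * g + 2 * m" by simp
  have r: "?r \<in> partitions_of (Suc m)" by (auto simp: partitions_of_def split: if_splits)
  have "gcount {1} id 0 m * fact m = real (nwalks {1..Suc m} (0 + 2 * m) id)" by (rule nwalks_eq_gcount[symmetric])
  also have "\<dots> \<le> real (nwalks {1..Suc m} (2 * g + 2 * m) id)"
    using nwalks_genus_mono[of "{1..Suc m}" 1 "Suc m" "2 * m" id g] assms by simp
  also have "\<dots> \<le> real (monotone_hurwitz g ?r ?r)"
    using nwalks_le_hurwitz[of "Suc m" g] unfolding e by simp
  also have "\<dots> \<le> real (\<Sum>\<beta>\<in>partitions_of (Suc m). monotone_hurwitz g ?r \<beta>)"
    using r finite_partitions_of unfolding of_nat_le_iff by (intro member_le_sum) auto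
  also have "\<dots> \<le> real (\<Sum>\<alpha>\<in>partitions_of (Suc m). \<Sum>\<beta>\<in>partitions_of (Suc m). monotone_hurwitz g \<alpha> \<beta>)"
    using r finite_partitions_of unfolding of_nat_le_iff
    by (intro member_le_sum[where f = "\<lambda>\<alpha>. \<Sum>\<beta>\<in>partitions_of (Suc m). monotone_hurwitz g \<alpha> \<beta>"]) auto
  also have "\<dots> = F_coeff g (Suc m) * fact (Suc m)"
    unfolding F_coeff_Suc by (rule nonzero_divide_eq_eq[THEN iffD1, OF fact_nonzero refl])
  also have "\<dots> = real (Suc m) * F_coeff g (Suc m) * fact m" by (simp add: mult_ac)
  finally show ?thesis by (rule mult_right_le_imp_le) simp
qed

lemma conv_radius_ge: "ereal (1/54) \<le> conv_radius (F_coeff g)"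
proof (rule conv_radius_geI_ex)
  fix r :: real assume r: "0 < r" "ereal r < ereal (1/54)"
  then have r4: "4 * r < 2/27" by simp
  \<comment> \<open>By continuity at 1/6 some \<open>u < 1/6\<close> has
    \<open>u * (1 - 2 * u)\<^sup>2\<close> above \<open>4 * r\<close>, the 4 being the growth factor
    in \<open>F_coeff_upper\<close>.\<close>
  have "((\<lambda>u::real. u * (1 - 2 * u)\<^sup>2) \<longlongrightarrow> 1/6 * (1 - 2 * (1/6))\<^sup>2) (at_left (1/6))"
    by (intro tendsto_intros)
  then have "((\<lambda>u::real. u * (1 - 2 * u)\<^sup>2) \<longlongrightarrow> 2/27) (at_left (1/6))"
    by (simp add: power2_eq_square)
  from order_tendstoD(1)[OF this r4] have "\<forall>\<^sub>F u in at_left (1/6::real). 4 * r < u * (1 - 2 * u)\<^sup>2" .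
  moreover have "\<forall>\<^sub>F u in at_left (1/6::real). u \<in> {0<..<1/6}"
    by (rule eventually_at_left_real) simp
  ultimately have "\<forall>\<^sub>F u in at_left (1/6::real). 4 * r < u * (1 - 2 * u)\<^sup>2 \<and> u \<in> {0<..<1/6}"
    by (rule eventually_conj)
  then obtain u :: real where u: "0 < u" "u < 1/6" and y: "4 * r < u * (1 - 2 * u)\<^sup>2"
    using eventually_happens[of _ "at_left (1/6::real)"] by auto
  define y where "y = u * (1 - 2 * u)\<^sup>2"
  have y: "0 < y" "4 * r < y" using y r by (simp_all add: y_def)
  have "u / (1 - 2 * u) < 1/4" using u by (simp add: field_simps)
  then obtain z where "u / (1 - 2 * u) < z" "z < 1/4" using dense by blast
  from gsum_bound[OF u this, of "2 * g"] obtain C where C: "0 \<le> C" 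
    "\<And>N V \<sigma>. permutation \<sigma> \<Longrightarrow> finite V \<Longrightarrow> V \<noteq> {} \<Longrightarrow> gsum y N V \<sigma> (2 * g) \<le> C * (1 / ((1 - 2 * u)\<^sup>2 * z)) ^ card V"
    unfolding y_def by blast
  define B where "B = C * (1 / ((1 - 2 * u)\<^sup>2 * z))"
  have B: "gcount {1} id (2 * g) m * y ^ m \<le> B" for m
  proof -
    have "gcount {1} id (2 * g) m * y ^ m \<le> gsum y m {1} id (2 * g)"
      unfolding gsum_def using y by (intro member_le_sum) (auto intro!: mult_nonneg_nonneg gcount_nonneg)
    also have "\<dots> \<le> B" using C(2)[of id "{1}" m] by (simp add: B_def)
    finally show ?thesis .
  qed
  have bound: "F_coeff g (Suc m) * r ^ Suc m \<le> B * y * (4 * r / y) ^ Suc m" for m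
  proof -
    have "F_coeff g (Suc m) * r ^ Suc m \<le> 4 ^ Suc m * gcount {1} id (2 * g) m * r ^ Suc m"
      using r by (intro mult_right_mono F_coeff_upper) auto
    also have "\<dots> = (gcount {1} id (2 * g) m * y ^ m) * (y * (4 * r / y) ^ Suc m)"
      using y by (simp add: power_mult_distrib power_divide)
    also have "\<dots> \<le> B * (y * (4 * r / y) ^ Suc m)"
      using y r by (intro mult_right_mono B) auto
    finally show ?thesis by (simp only: mult.assoc)
  qed
  have "summable (\<lambda>m. F_coeff g (Suc m) * r ^ Suc m)"
  proof (rule summable_comparison_test')
    have "summable (\<lambda>m. (4 * r / y) ^ m)" using y r by (intro summable_geometric) auto
    then have "summable (\<lambda>m. (4 * r / y) ^ Suc m)" by (rule summable_Suc_iff[THEN iffD2])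
    then show "summable (\<lambda>m. B * y * (4 * r / y) ^ Suc m)" by (rule summable_mult)
    fix m show "norm (F_coeff g (Suc m) * r ^ Suc m) \<le> B * y * (4 * r / y) ^ Suc m"
      using bound[of m] F_coeff_nonneg[of g "Suc m"] r by (simp add: abs_mult)
  qed
  then have "summable (\<lambda>d. F_coeff g d * r ^ d)" by (rule summable_Suc_iff[THEN iffD1])
  then show "\<exists>z. norm z = r \<and> summable (\<lambda>n. F_coeff g n * z ^ n)"
    using r by (intro exI[of _ r]) auto
qed

lemma conv_radius_le: "conv_radius (F_coeff g) \<le> ereal (2/27)"
proof -
  define F where "F = Abs_fps (F_coeff g)"
  have nth: "fps_nth (fps_deriv F) m = real (Suc m) * F_coeff g (Suc m)" for m
    by (simp add: F_def)
  have "fps_conv_radius F \<le> fps_conv_radius (fps_deriv F)" by (rule fps_conv_radius_deriv)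
  then have "conv_radius (F_coeff g) \<le> conv_radius (fps_nth (fps_deriv F))"
    by (simp add: fps_conv_radius_def F_def)
  also have "\<dots> \<le> conv_radius (gcount {1} id 0)"
  proof (rule conv_radius_geI_ex)
    fix r :: real assume r: "0 < r" "ereal r < conv_radius (fps_nth (fps_deriv F))"
    then have s: "summable (\<lambda>m. fps_nth (fps_deriv F) m * r ^ m)"
      by (intro summable_in_conv_radius) simp
    have "summable (\<lambda>m. gcount {1} id 0 m * r ^ m)"
    proof (rule summable_comparison_test'[OF s])
      fix m :: nat assume "1 \<le> m"
      then show "norm (gcount {1} id 0 m * r ^ m) \<le> fps_nth (fps_deriv F) m * r ^ m"
        unfolding nth using F_coeff_lower[of m g] gcount_nonneg[of "{1}" id 0 m] r
        by (simp add: abs_mult mult_right_mono)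
    qed
    then show "\<exists>z. norm z = r \<and> summable (\<lambda>n. gcount {1} id 0 n * z ^ n)"
      using r by (intro exI[of _ r]) auto
  qed
  also have "\<dots> \<le> ereal (2/27)" by (rule genus_0_radius)
  finally show ?thesis .
qed

theorem theorem1p1:
  fixes g :: nat
  shows "ereal (1/54) \<le> conv_radius (F_coeff g) \<and> conv_radius (F_coeff g) \<le> ereal (2/27)"
  using conv_radius_ge conv_radius_le by blast

end
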